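(* Let $q$ be a prime power with $q \equiv 3 \pmod 4$ and let $m\geq 1$ be an integer. Then $\mathrm{P}\Omega^-(4m+2,q)$ contains weakly real elements, that is, elements which are real but not strongly real in $\mathrm{P}\Omega^-(4m+2,q)$.
   Context: Let $q$ be an odd prime power and let $V=\mathbb{F}_q^n$ carry a quadratic form $Q$ with associated non-degenerate symmetric bilinear form $B$, so $Q(u+v)=Q(u)+2B(u,v)+Q(v)$. The orthogonal group is the group of isometries of $Q$. For even $n=2k$ there are two equivalence classes of such forms: the split ($+$-type) form, equivalent to $x_1x_2+x_3x_4+\cdots+x_{2k-1}x_{2k}$, and the non-split ($-$-type) form; the corresponding orthogonal groups are $\mathrm{O}^{+}(n,q)$ and $\mathrm{O}^{-}(n,q)$. The group $\Omega^{\pm}(n,q)$ is the derived (commutator) subgroup of $\mathrm{O}^{\pm}(n,q)$, and $\mathrm{P}\Omega^{\pm}(n,q)=\Omega^{\pm}(n,q)/Z$ where $Z$ is the center of $\Omega^{\pm}(n,q)$. An element $g$ of a finite group $G$ is real in $G$ if there is $h\in G$ with $hgh^{-1}=g^{-1}$; it is strongly real in $G$ if there is $s\in G$ with $s^2=1$ and $sgs^{-1}=g^{-1}$; it is weakly real in $G$ if it is real but not strongly real in $G$. *)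

theory Defs
  imports
    "HOL-Algebra.Coset"
    "HOL-Algebra.Generated_Groups"
    "HOL-Number_Theory.Cong"
    "HOL-Number_Theory.Prime_Powers"
    "HOL-Library.Cardinality"
    "Jordan_Normal_Form.Matrix"
begin

text \<open>
  The space $V = F^n$ is \<^term>\<open>carrier_vec n\<close> over a finite field of odd order, given as a type.
  A quadratic form is a function on vectors, of which only the values on $V$ matter.
\<close>

text \<open>
  Solving $Q(u+v) = Q(u) + 2B(u,v) + Q(v)$ for $B$; this presupposes that 2 is
  invertible in the field.
\<close>

definition assoc_form :: "('k::field vec \<Rightarrow> 'k) \<Rightarrow> 'k vec \<Rightarrow> 'k vec \<Rightarrow> 'k" where
  "assoc_form Q u v = (Q (u + v) - Q u - Q v) / 2"

text \<open>Linearity in the first argument suffices, since \<^const>\<open>assoc_form\<close> is symmetric on $V$.\<close>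

definition quadratic_form :: "nat \<Rightarrow> ('k::field vec \<Rightarrow> 'k) \<Rightarrow> bool" where
  "quadratic_form n Q \<longleftrightarrow>
     (\<forall>a. \<forall>v\<in>carrier_vec n. Q (a \<cdot>\<^sub>v v) = a\<^sup>2 * Q v) \<and>
     (\<forall>u\<in>carrier_vec n. \<forall>v\<in>carrier_vec n. \<forall>w\<in>carrier_vec n.
        assoc_form Q (u + v) w = assoc_form Q u w + assoc_form Q v w) \<and>
     (\<forall>a. \<forall>u\<in>carrier_vec n. \<forall>w\<in>carrier_vec n.
        assoc_form Q (a \<cdot>\<^sub>v u) w = a * assoc_form Q u w)"

definition nondegenerate :: "nat \<Rightarrow> ('k::field vec \<Rightarrow> 'k) \<Rightarrow> bool" where
  "nondegenerate n Q \<longleftrightarrow>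
     (\<forall>u\<in>carrier_vec n. (\<forall>v\<in>carrier_vec n. assoc_form Q u v = 0) \<longrightarrow> u = 0\<^sub>v n)"

definition equivalent_forms ::
    "nat \<Rightarrow> ('k::field vec \<Rightarrow> 'k) \<Rightarrow> ('k vec \<Rightarrow> 'k) \<Rightarrow> bool" where
  "equivalent_forms n Q Q' \<longleftrightarrow>
     (\<exists>A\<in>carrier_mat n n. invertible_mat A \<and> (\<forall>v\<in>carrier_vec n. Q' (A *\<^sub>v v) = Q v))"

text \<open>The form $x_1x_2 + x_3x_4 + \cdots + x_{n-1}x_n$ for even $n$ (vector indices start at 0).\<close>

definition split_form :: "nat \<Rightarrow> 'k::field vec \<Rightarrow> 'k" where
  "split_form n v = (\<Sum>i<n div 2. v $ (2 * i) * v $ (2 * i + 1))"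

text \<open>
  Over a finite field of odd order, the non-degenerate forms of a given even positive
  dimension fall into two equivalence classes; the minus type is the class that does not
  contain the split form.
\<close>

definition minus_type :: "nat \<Rightarrow> ('k::field vec \<Rightarrow> 'k) \<Rightarrow> bool" where
  "minus_type n Q \<longleftrightarrow> even n \<and> quadratic_form n Q \<and> nondegenerate n Q \<and>
     \<not> equivalent_forms n Q (split_form n)"

definition orthogonal_group :: "nat \<Rightarrow> ('k::field vec \<Rightarrow> 'k) \<Rightarrow> 'k mat monoid" where
  "orthogonal_group n Q =
     \<lparr>carrier = {A \<in> carrier_mat n n. invertible_mat A \<and> (\<forall>v\<in>carrier_vec n. Q (A *\<^sub>v v) = Q v)},
      monoid.mult = (*), one = 1\<^sub>m n\<rparr>"

definition group_center :: "('g, 'b) monoid_scheme \<Rightarrow> 'g set" where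
  "group_center G = {z \<in> carrier G. \<forall>g\<in>carrier G. z \<otimes>\<^bsub>G\<^esub> g = g \<otimes>\<^bsub>G\<^esub> z}"

definition Omega_group :: "nat \<Rightarrow> ('k::field vec \<Rightarrow> 'k) \<Rightarrow> 'k mat monoid" where
  "Omega_group n Q = (orthogonal_group n Q)
     \<lparr>carrier := derived (orthogonal_group n Q) (carrier (orthogonal_group n Q))\<rparr>"

definition POmega_group :: "nat \<Rightarrow> ('k::field vec \<Rightarrow> 'k) \<Rightarrow> 'k mat set monoid" where
  "POmega_group n Q = Omega_group n Q Mod group_center (Omega_group n Q)"

definition real_in :: "('g, 'b) monoid_scheme \<Rightarrow> 'g \<Rightarrow> bool" where
  "real_in G g \<longleftrightarrow> g \<in> carrier G \<and>
     (\<exists>h\<in>carrier G. h \<otimes>\<^bsub>G\<^esub> g \<otimes>\<^bsub>G\<^esub> inv\<^bsub>G\<^esub> h = inv\<^bsub>G\<^esub> g)"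

definition strongly_real_in :: "('g, 'b) monoid_scheme \<Rightarrow> 'g \<Rightarrow> bool" where
  "strongly_real_in G g \<longleftrightarrow> g \<in> carrier G \<and>
     (\<exists>s\<in>carrier G. s \<otimes>\<^bsub>G\<^esub> s = \<one>\<^bsub>G\<^esub> \<and> s \<otimes>\<^bsub>G\<^esub> g \<otimes>\<^bsub>G\<^esub> inv\<^bsub>G\<^esub> s = inv\<^bsub>G\<^esub> g)"

definition weakly_real_in :: "('g, 'b) monoid_scheme \<Rightarrow> 'g \<Rightarrow> bool" where
  "weakly_real_in G g \<longleftrightarrow> real_in G g \<and> \<not> strongly_real_in G g"

end

theory Submission
  imports Defs "Jordan_Normal_Form.Determinant" "HOL-Library.Function_Algebras"
begin

text \<open>
Write $n = 4m+2$. As $q \equiv 3 \pmod 4$, the element $-1$ is not a square, so the split form of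
dimension $n$ has non-square discriminant and every form of minus type is equivalent to
$x_1^2 + \dots + x_n^2$. All computations therefore take place in the group of linear maps that
preserve the standard dot product, and the result is carried over by an isomorphism of the
orthogonal groups.

Modulo its centre $\{1,-1\}$, an element $g$ of the derived group $\Omega$ is strongly real iff some
$s \in \Omega$ satisfies $s^2 = \pm 1$ and $sgs^{-1} = \pm g^{-1}$. Choose $a, b$ with
$a^2+b^2 = -1$. With the isometry $i$ that turns each pair of consecutive coordinates by a right
angle, the vectors $e = (1,0,a,b,0,\dots)$ and $f = ie$ span a totally singular plane. It carries
the map $N v = (v \cdot e) f - (v \cdot f) e$, which satisfies $N^2 = 0$, and the unipotent
isometry $\tau = 1 + N$. An isometry $s$ with $s \tau s^{-1} = \tau^{-1}$ acts on the plane
$\langle e, f\rangle$ with determinant $-1$ (\<open>anticommuting_action\<close>).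

If $m = 1$, take $g = \tau$. An inverting $s$ cannot satisfy $s^2 = -1$, since a $2 \times 2$ matrix of
determinant $-1$ does not square to $-1$ here. If $s^2 = 1$, then the plane contains an eigenvector
for each of the eigenvalues $1$ and $-1$, and if moreover $s$ has determinant $1$, then one of its two
eigenspaces on the whole space is a hyperbolic plane. Such an involution is not in $\Omega$, by the
parity argument below. An
inverting element that does lie in $\Omega$ is obtained by rotating the anisotropic complement by a
non-square of the rotation group.

If $m \geq 2$, take $g = \tau\pi$, where the signed permutation $\pi$ is $i$ except for a single signed
$4$-cycle. The signed $4$-cycle is there to put $g$ into $\Omega$: $\pi$ then is a product of an even
number of conjugates of one quarter turn, whereas $i$ is a product of an odd number. If
$sgs^{-1} = -g^{-1}$, then $s$ commutes with $i$ on $\langle e,f\rangle$, where it is multiplication by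
some $\kappa = \alpha + \beta i$ of norm $\alpha^2 + \beta^2 = -1$, so $\kappa^2 \neq \pm 1$ and $s^2 \neq \pm 1$. If
$sgs^{-1} = g^{-1}$, then $s$ anticommutes with $i$ on that plane, which forces $s^2 = 1$ there and hence
everywhere. The map $g - g^{-1}$ is injective and exchanges the two eigenspaces of $s$, whose common
dimension is the odd number $n/2$; so $s$ has determinant $-1$ and is not in $\Omega$.

Both obstructions to membership in $\Omega$ come from one fact (\<open>derived_involution_moved_card\<close>):
on a finite set that is invariant under all isometries, a commutator acts as an even permutation, so an
involution in $\Omega$ moves a number of points that is divisible by $4$. For the set of all vectors this
detects the determinant, and for the vectors of norm $1$ it detects the product of determinant and
spinor norm.
\<close>

section \<open>Weak reality modulo the centre\<close>

text \<open>
The conclusion of the theorem for $\Omega/Z(\Omega)$, with $\Omega$ the derived group of $G$, expressed by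
elements of $G$: conjugation of the coset of $g$ into its inverse means that $hgh^{-1}g$ is central.
In this form the property is visibly invariant under isomorphisms of $G$.
\<close>

definition quotient_weakly_real :: "('g, 'b) monoid_scheme \<Rightarrow> bool" where
  "quotient_weakly_real G \<longleftrightarrow>
     (let D = derived G (carrier G); Z = group_center (G\<lparr>carrier := D\<rparr>) in
      \<exists>g\<in>D. (\<exists>h\<in>D. h \<otimes>\<^bsub>G\<^esub> g \<otimes>\<^bsub>G\<^esub> inv\<^bsub>G\<^esub> h \<otimes>\<^bsub>G\<^esub> g \<in> Z) \<and>
        (\<forall>s\<in>D. s \<otimes>\<^bsub>G\<^esub> s \<in> Z \<longrightarrow> s \<otimes>\<^bsub>G\<^esub> g \<otimes>\<^bsub>G\<^esub> inv\<^bsub>G\<^esub> s \<otimes>\<^bsub>G\<^esub> g \<notin> Z))"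

lemma (in group) group_center_normal: "group_center G \<lhd> G"
proof -
  have sub: "subgroup (group_center G) G"
  proof (rule subgroupI)
    show "group_center G \<subseteq> carrier G" by (auto simp: group_center_def)
    show "group_center G \<noteq> {}" by (force simp: group_center_def)
    fix a assume a: "a \<in> group_center G"
    then have ac: "a \<in> carrier G" and comm: "\<And>g. g \<in> carrier G \<Longrightarrow> a \<otimes> g = g \<otimes> a"
      by (auto simp: group_center_def)
    have "inv a \<otimes> g = g \<otimes> inv a" if g: "g \<in> carrier G" for g
    proof -
      have "inv a \<otimes> g = inv a \<otimes> (g \<otimes> a) \<otimes> inv a" using ac g by (simp add: m_assoc)
      also have "\<dots> = inv a \<otimes> (a \<otimes> g) \<otimes> inv a" using comm[OF g] by simp
      also have "\<dots> = g \<otimes> inv a" using ac g by (simp add: m_assoc[symmetric])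
      finally show ?thesis .
    qed
    then show "inv a \<in> group_center G" using ac by (simp add: group_center_def)
    fix b assume b: "b \<in> group_center G"
    then have bc: "b \<in> carrier G" and comm': "\<And>g. g \<in> carrier G \<Longrightarrow> b \<otimes> g = g \<otimes> b"
      by (auto simp: group_center_def)
    have "a \<otimes> b \<otimes> g = g \<otimes> (a \<otimes> b)" if g: "g \<in> carrier G" for g
    proof -
      have "a \<otimes> b \<otimes> g = a \<otimes> (g \<otimes> b)" using ac bc g comm'[OF g] by (simp add: m_assoc)
      also have "\<dots> = g \<otimes> a \<otimes> b" using ac bc g comm[OF g] by (simp add: m_assoc[symmetric])
      finally show ?thesis using ac bc g by (simp add: m_assoc)
    qed
    then show "a \<otimes> b \<in> group_center G" using ac bc by (simp add: group_center_def)
  qed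
  show ?thesis
    unfolding normal_inv_iff
  proof (intro conjI ballI)
    fix x z assume x: "x \<in> carrier G" and z: "z \<in> group_center G"
    then have zc: "z \<in> carrier G" "x \<otimes> z = z \<otimes> x" by (auto simp: group_center_def)
    have "x \<otimes> z \<otimes> inv x = z" using x zc by (simp add: m_assoc)
    then show "x \<otimes> z \<otimes> inv x \<in> group_center G" using z by simp
  qed (rule sub)
qed

lemma (in group) weakly_real_in_factor_group:
  assumes Z: "Z \<lhd> G" and g: "g \<in> carrier G" and h: "h \<in> carrier G"
    and real: "h \<otimes> g \<otimes> inv h \<otimes> g \<in> Z"
    and not: "\<And>s. s \<in> carrier G \<Longrightarrow> s \<otimes> s \<in> Z \<Longrightarrow> s \<otimes> g \<otimes> inv s \<otimes> g \<in> Z \<Longrightarrow> False"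
  shows "weakly_real_in (G Mod Z) (Z #> g)"
proof -
  interpret Z: normal Z G by fact
  interpret Q: group "G Mod Z" by (rule Z.factorgroup_is_group)
  have car: "Z #> x \<in> carrier (G Mod Z)" if "x \<in> carrier G" for x
    using that by (auto simp: carrier_FactGroup)
  have mult: "(Z #> x) \<otimes>\<^bsub>G Mod Z\<^esub> (Z #> y) = Z #> (x \<otimes> y)"
    if "x \<in> carrier G" "y \<in> carrier G" for x y
    using that by (simp add: FactGroup_def Z.rcos_sum)
  have inv: "inv\<^bsub>G Mod Z\<^esub> (Z #> x) = Z #> inv x" if "x \<in> carrier G" for x
    using that by (metis Z.inv_FactGroup Z.rcos_inv car)
  have one: "Z #> x = \<one>\<^bsub>G Mod Z\<^esub> \<longleftrightarrow> x \<in> Z" if "x \<in> carrier G" for x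
    using that Z.subgroup_axioms
    by (metis FactGroup_def coset_join1 coset_join2 monoid.simps(2) normal_imp_subgroup Z.is_subgroup)
  have crit: "(Z #> x) \<otimes>\<^bsub>G Mod Z\<^esub> (Z #> g) \<otimes>\<^bsub>G Mod Z\<^esub> inv\<^bsub>G Mod Z\<^esub> (Z #> x) = inv\<^bsub>G Mod Z\<^esub> (Z #> g)
     \<longleftrightarrow> x \<otimes> g \<otimes> inv x \<otimes> g \<in> Z" if x: "x \<in> carrier G" for x
  proof -
    have "(Z #> x) \<otimes>\<^bsub>G Mod Z\<^esub> (Z #> g) \<otimes>\<^bsub>G Mod Z\<^esub> inv\<^bsub>G Mod Z\<^esub> (Z #> x) = Z #> (x \<otimes> g \<otimes> inv x)"
      using x g by (simp add: mult inv del: mult_FactGroup)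
    moreover have "Z #> (x \<otimes> g \<otimes> inv x) = inv\<^bsub>G Mod Z\<^esub> (Z #> g)
        \<longleftrightarrow> (Z #> (x \<otimes> g \<otimes> inv x)) \<otimes>\<^bsub>G Mod Z\<^esub> (Z #> g) = \<one>\<^bsub>G Mod Z\<^esub>"
      using x g car by (metis Q.inv_equality Q.l_inv inv_closed m_closed)
    ultimately show ?thesis using x g by (simp add: mult one del: mult_FactGroup one_FactGroup)
  qed
  show ?thesis
    unfolding weakly_real_in_def real_in_def strongly_real_in_def
  proof (intro conjI notI)
    show "Z #> g \<in> carrier (G Mod Z)" by (rule car[OF g])
    show "\<exists>h\<in>carrier (G Mod Z). h \<otimes>\<^bsub>G Mod Z\<^esub> (Z #> g) \<otimes>\<^bsub>G Mod Z\<^esub> inv\<^bsub>G Mod Z\<^esub> h = inv\<^bsub>G Mod Z\<^esub> (Z #> g)"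
      using crit[OF h] car[OF h] real by blast
    assume "Z #> g \<in> carrier (G Mod Z) \<and> (\<exists>s\<in>carrier (G Mod Z). s \<otimes>\<^bsub>G Mod Z\<^esub> s = \<one>\<^bsub>G Mod Z\<^esub> \<and>
       s \<otimes>\<^bsub>G Mod Z\<^esub> (Z #> g) \<otimes>\<^bsub>G Mod Z\<^esub> inv\<^bsub>G Mod Z\<^esub> s = inv\<^bsub>G Mod Z\<^esub> (Z #> g))"
    then obtain S where S: "S \<in> carrier (G Mod Z)" "S \<otimes>\<^bsub>G Mod Z\<^esub> S = \<one>\<^bsub>G Mod Z\<^esub>"
       "S \<otimes>\<^bsub>G Mod Z\<^esub> (Z #> g) \<otimes>\<^bsub>G Mod Z\<^esub> inv\<^bsub>G Mod Z\<^esub> S = inv\<^bsub>G Mod Z\<^esub> (Z #> g)" by blast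
    then obtain s where s: "s \<in> carrier G" "S = Z #> s" by (auto simp: carrier_FactGroup)
    have "s \<otimes> s \<in> Z" using S(2) s by (simp add: mult one del: mult_FactGroup one_FactGroup)
    moreover have "s \<otimes> g \<otimes> inv s \<otimes> g \<in> Z" using S(3) s crit by blast
    ultimately show False using not s by blast
  qed
qed

lemma (in group) ex_weakly_real_in_factor_group:
  assumes "quotient_weakly_real G"
  defines "O' \<equiv> G\<lparr>carrier := derived G (carrier G)\<rparr>"
  shows "\<exists>x\<in>carrier (O' Mod group_center O'). weakly_real_in (O' Mod group_center O') x"
proof -
  have sub: "subgroup (derived G (carrier G)) G"
    by (rule derived_is_subgroup) simp
  interpret D: group O' unfolding O'_def by (rule subgroup.subgroup_is_group[OF sub is_group])
  have inv: "inv\<^bsub>O'\<^esub> x = inv x" if "x \<in> derived G (carrier G)" for x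
    using that sub unfolding O'_def by (metis m_inv_consistent)
  from assms(1) obtain g h where gh: "g \<in> derived G (carrier G)" "h \<in> derived G (carrier G)"
    "h \<otimes> g \<otimes> inv h \<otimes> g \<in> group_center O'"
    "\<And>s. s \<in> derived G (carrier G) \<Longrightarrow> s \<otimes> s \<in> group_center O' \<Longrightarrow> s \<otimes> g \<otimes> inv s \<otimes> g \<in> group_center O' \<Longrightarrow> False"
    unfolding quotient_weakly_real_def Let_def O'_def by blast
  have "weakly_real_in (O' Mod group_center O') (group_center O' #>\<^bsub>O'\<^esub> g)"
  proof (rule D.weakly_real_in_factor_group[OF D.group_center_normal, of g h])
    fix s assume "s \<in> carrier O'" "s \<otimes>\<^bsub>O'\<^esub> s \<in> group_center O'"
      "s \<otimes>\<^bsub>O'\<^esub> g \<otimes>\<^bsub>O'\<^esub> inv\<^bsub>O'\<^esub> s \<otimes>\<^bsub>O'\<^esub> g \<in> group_center O'"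
    then show False using gh(4)[of s] inv[of s] by (simp add: O'_def)
  qed (use gh(1-3) inv[of h] in \<open>simp_all add: O'_def\<close>)
  then show ?thesis unfolding weakly_real_in_def real_in_def by blast
qed

lemma iso_derived_image:
  assumes "group G" "group H" "\<phi> \<in> iso G H"
  shows "\<phi> ` derived G (carrier G) = derived H (carrier H)"
proof -
  interpret group_hom G H \<phi>
    using assms by (auto simp: group_hom_def group_hom_axioms_def iso_def)
  show ?thesis using derived_img[of "carrier G"] assms(3) by (auto simp: iso_def bij_betw_def)
qed

lemma iso_quotient_weakly_real:
  assumes G: "group G" and H: "group H" and \<phi>: "\<phi> \<in> iso G H" and q: "quotient_weakly_real G"
  shows "quotient_weakly_real H"
proof -
  interpret h: group_hom G H \<phi>
    using assms by (auto simp: group_hom_def group_hom_axioms_def iso_def)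
  define D where "D = derived G (carrier G)"
  define D' where "D' = derived H (carrier H)"
  define Z where "Z = group_center (G\<lparr>carrier := D\<rparr>)"
  define Z' where "Z' = group_center (H\<lparr>carrier := D'\<rparr>)"
  have im: "\<phi> ` D = D'" unfolding D_def D'_def by (rule iso_derived_image[OF G H \<phi>])
  have sub: "subgroup D G" unfolding D_def by (rule h.G.derived_is_subgroup) simp
  have DG: "x \<in> carrier G" if "x \<in> D" for x using that subgroup.subset[OF sub] by blast
  have inj: "inj_on \<phi> (carrier G)" using \<phi> by (auto simp: iso_def bij_betw_def)
  have Ziff: "\<phi> x \<in> Z' \<longleftrightarrow> x \<in> Z" if x: "x \<in> D" for x
  proof -
    have "\<phi> x \<in> Z' \<longleftrightarrow> (\<forall>y\<in>D. \<phi> x \<otimes>\<^bsub>H\<^esub> \<phi> y = \<phi> y \<otimes>\<^bsub>H\<^esub> \<phi> x)"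
      using x unfolding Z'_def group_center_def im[symmetric] by auto
    also have "\<dots> \<longleftrightarrow> (\<forall>y\<in>D. \<phi> (x \<otimes>\<^bsub>G\<^esub> y) = \<phi> (y \<otimes>\<^bsub>G\<^esub> x))"
      using DG x by (simp add: h.hom_mult)
    also have "\<dots> \<longleftrightarrow> (\<forall>y\<in>D. x \<otimes>\<^bsub>G\<^esub> y = y \<otimes>\<^bsub>G\<^esub> x)"
      using DG x inj by (metis inj_onD h.G.m_closed)
    finally show ?thesis using x by (auto simp: Z_def group_center_def)
  qed
  from q obtain g k where gk: "g \<in> D" "k \<in> D" "k \<otimes>\<^bsub>G\<^esub> g \<otimes>\<^bsub>G\<^esub> inv\<^bsub>G\<^esub> k \<otimes>\<^bsub>G\<^esub> g \<in> Z"
    "\<And>s. s \<in> D \<Longrightarrow> s \<otimes>\<^bsub>G\<^esub> s \<in> Z \<Longrightarrow> s \<otimes>\<^bsub>G\<^esub> g \<otimes>\<^bsub>G\<^esub> inv\<^bsub>G\<^esub> s \<otimes>\<^bsub>G\<^esub> g \<notin> Z"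
    unfolding quotient_weakly_real_def Let_def D_def[symmetric] Z_def[symmetric] by blast
  have cl: "x \<otimes>\<^bsub>G\<^esub> y \<in> D" "inv\<^bsub>G\<^esub> x \<in> D" if "x \<in> D" "y \<in> D" for x y
    using that sub by (auto simp: subgroup.m_closed subgroup.m_inv_closed)
  have conj_D: "s \<otimes>\<^bsub>G\<^esub> g \<otimes>\<^bsub>G\<^esub> inv\<^bsub>G\<^esub> s \<otimes>\<^bsub>G\<^esub> g \<in> D" if "s \<in> D" for s
    by (intro cl(1) cl(2)[OF that that] that gk(1))
  have eq: "\<phi> s \<otimes>\<^bsub>H\<^esub> \<phi> g \<otimes>\<^bsub>H\<^esub> inv\<^bsub>H\<^esub> (\<phi> s) \<otimes>\<^bsub>H\<^esub> \<phi> g = \<phi> (s \<otimes>\<^bsub>G\<^esub> g \<otimes>\<^bsub>G\<^esub> inv\<^bsub>G\<^esub> s \<otimes>\<^bsub>G\<^esub> g)" if "s \<in> D" for s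
    using that gk(1) DG by (simp add: h.hom_mult)
  have "\<phi> k \<otimes>\<^bsub>H\<^esub> \<phi> g \<otimes>\<^bsub>H\<^esub> inv\<^bsub>H\<^esub> (\<phi> k) \<otimes>\<^bsub>H\<^esub> \<phi> g \<in> Z'"
    using Ziff[OF conj_D[OF gk(2)]] gk(3) eq[OF gk(2)] by simp
  moreover have "s' \<otimes>\<^bsub>H\<^esub> \<phi> g \<otimes>\<^bsub>H\<^esub> inv\<^bsub>H\<^esub> s' \<otimes>\<^bsub>H\<^esub> \<phi> g \<notin> Z'" if s': "s' \<in> D'" "s' \<otimes>\<^bsub>H\<^esub> s' \<in> Z'" for s'
  proof -
    obtain s where s: "s \<in> D" "s' = \<phi> s" using s' im by blast
    have "s \<otimes>\<^bsub>G\<^esub> s \<in> Z" using s' s Ziff[OF cl(1)[OF s(1) s(1)]] DG by (simp add: h.hom_mult)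
    then have "s \<otimes>\<^bsub>G\<^esub> g \<otimes>\<^bsub>G\<^esub> inv\<^bsub>G\<^esub> s \<otimes>\<^bsub>G\<^esub> g \<notin> Z" using gk(4) s by blast
    then show ?thesis using Ziff[OF conj_D[OF s(1)]] eq[OF s(1)] s(2) by simp
  qed
  ultimately have "\<exists>g\<in>D'. (\<exists>h\<in>D'. h \<otimes>\<^bsub>H\<^esub> g \<otimes>\<^bsub>H\<^esub> inv\<^bsub>H\<^esub> h \<otimes>\<^bsub>H\<^esub> g \<in> Z') \<and>
        (\<forall>s\<in>D'. s \<otimes>\<^bsub>H\<^esub> s \<in> Z' \<longrightarrow> s \<otimes>\<^bsub>H\<^esub> g \<otimes>\<^bsub>H\<^esub> inv\<^bsub>H\<^esub> s \<otimes>\<^bsub>H\<^esub> g \<notin> Z')"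
    using gk(1,2) im by blast
  then show ?thesis
    unfolding quotient_weakly_real_def Let_def D'_def[symmetric] Z'_def[symmetric] .
qed

section \<open>Squares in a finite field\<close>

lemma card_nonzero_le_double_squares:
  "CARD('k) - 1 \<le> 2 * card ((\<lambda>x. x\<^sup>2) ` (UNIV - {0::'k::{field,finite}}))"
proof -
  let ?S = "(\<lambda>x. x\<^sup>2) ` (UNIV - {0::'k})"
  have "UNIV - {0::'k} = (\<Union>s\<in>?S. {x. x\<^sup>2 = s \<and> x \<noteq> 0})" by auto
  then have "card (UNIV - {0::'k}) = card (\<Union>s\<in>?S. {x. x\<^sup>2 = s \<and> x \<noteq> 0})"
    by (rule arg_cong)
  also have "\<dots> \<le> (\<Sum>s\<in>?S. card {x. x\<^sup>2 = s \<and> x \<noteq> 0})"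
    by (rule card_UN_le) simp
  also have "\<dots> \<le> (\<Sum>s\<in>?S. 2)"
  proof (rule sum_mono)
    fix s assume "s \<in> ?S"
    then obtain y where y: "s = y\<^sup>2" by auto
    have "{x. x\<^sup>2 = s \<and> x \<noteq> 0} \<subseteq> {y, - y}" by (auto simp: y power2_eq_iff)
    then have "card {x. x\<^sup>2 = s \<and> x \<noteq> 0} \<le> card {y, - y}" by (intro card_mono) auto
    also have "\<dots> \<le> 2" by (simp add: card_insert_if)
    finally show "card {x. x\<^sup>2 = s \<and> x \<noteq> 0} \<le> 2" .
  qed
  finally show ?thesis by (simp add: mult.commute)
qed

text \<open>
The sets of values of $Ax^2$ and of $c - By^2$ each have more than half as many elements as the field,
so they meet.
\<close>

lemma binary_form_universal:
  fixes A B c :: "'k::{field,finite}"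
  assumes "A \<noteq> 0" "B \<noteq> 0"
  shows "\<exists>x y. A * x\<^sup>2 + B * y\<^sup>2 = c"
proof -
  let ?S = "range (\<lambda>x::'k. x\<^sup>2)"
  let ?T = "(\<lambda>x. x\<^sup>2) ` (UNIV - {0::'k})"
  have "?S = insert 0 ?T" by (auto simp: image_iff)
  moreover have "0 \<notin> ?T" by auto
  ultimately have "card ?S = Suc (card ?T)" by simp
  moreover have "0 < CARD('k)" by simp
  ultimately have S: "CARD('k) < 2 * card ?S"
    using card_nonzero_le_double_squares[where 'k='k] by linarith
  have "(\<lambda>s. A * s) ` ?S \<inter> (\<lambda>s. c - B * s) ` ?S \<noteq> {}"
  proof
    assume "(\<lambda>s. A * s) ` ?S \<inter> (\<lambda>s. c - B * s) ` ?S = {}"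
    then have "card ((\<lambda>s. A * s) ` ?S \<union> (\<lambda>s. c - B * s) ` ?S)
        = card ((\<lambda>s. A * s) ` ?S) + card ((\<lambda>s. c - B * s) ` ?S)"
      by (intro card_Un_disjoint) auto
    also have "\<dots> = 2 * card ?S"
      using assms by (subst (1 2) card_image) (auto simp: inj_on_def)
    finally have "2 * card ?S \<le> CARD('k)"
      by (metis card_mono finite subset_UNIV)
    then show False using S by simp
  qed
  then obtain x y where "A * x\<^sup>2 = c - B * y\<^sup>2" by blast
  then have "A * x\<^sup>2 + B * y\<^sup>2 = c" by simp
  then show ?thesis by blast
qed

text \<open>
In characteristic $2$ the translation $x \mapsto x+1$ would split the field into pairs.
\<close>

lemma two_nonzero_of_odd_card:
  assumes "odd CARD('k::{field,finite})"
  shows "(2::'k) \<noteq> 0"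
proof
  assume two: "(2::'k) = 0"
  have shift: "x + 1 + 1 = x" for x :: 'k
    using two by (metis add.assoc add_0_right one_add_one)
  let ?P = "(\<lambda>x::'k. {x, x + 1}) ` UNIV"
  have "2 * card ?P = card (\<Union>?P)"
  proof (rule card_partition)
    fix c assume "c \<in> ?P"
    then show "card c = 2" by auto
  next
    fix c d assume "c \<in> ?P" "d \<in> ?P" "c \<noteq> d"
    then obtain x y where xy: "c = {x, x + 1}" "d = {y, y + 1}" by auto
    have "c = d" if "x = y \<or> x = y + 1 \<or> x + 1 = y"
      using that shift[of x] shift[of y] unfolding xy by auto
    then show "c \<inter> d = {}" using \<open>c \<noteq> d\<close> unfolding xy by auto
  qed auto
  moreover have "\<Union>?P = UNIV" by auto
  ultimately have "CARD('k) = 2 * card ?P" by metis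
  then show False using assms by simp
qed

text \<open>
Multiplication by $x$ permutes the non-zero elements, so $x^{q-1} = 1$; but $(q-1)/2$ is odd, hence
$x^2 = -1$ would give $x^{q-1} = -1$.
\<close>

lemma neg_one_nonsquare:
  fixes x :: "'k::{field,finite}"
  assumes "CARD('k) mod 4 = 3"
  shows "x\<^sup>2 \<noteq> - 1"
proof
  assume sq: "x\<^sup>2 = - 1"
  have "odd CARD('k)" using assms by presburger
  then have two: "(2::'k) \<noteq> 0" by (rule two_nonzero_of_odd_card)
  have x0: "x \<noteq> 0" using sq by auto
  let ?U = "UNIV - {0::'k}"
  have "bij_betw (\<lambda>y. x * y) ?U ?U"
    by (rule bij_betwI[of _ _ _ "\<lambda>y. y / x"]) (use x0 in auto)
  then have "(\<Prod>y\<in>?U. y) = (\<Prod>y\<in>?U. x * y)"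
    by (rule prod.reindex_bij_betw[symmetric])
  also have "\<dots> = x ^ card ?U * (\<Prod>y\<in>?U. y)" by (simp add: prod.distrib)
  finally have one: "x ^ card ?U = 1" by (simp add: prod_zero_iff)
  obtain k where k: "CARD('k) = 4 * k + 3" using assms by (metis mod_mult_div_eq add.commute)
  have "x ^ card ?U = (x\<^sup>2) ^ (2 * k + 1)" using k by (simp add: card_Diff_singleton power_mult[symmetric] del: power_Suc)
  also have "\<dots> = - 1" unfolding sq by simp
  finally have "(1::'k) = - 1" using one by simp
  then have "(2::'k) = 0" by (metis add.right_inverse one_add_one)
  then show False using two by simp
qed

text \<open>
The non-zero squares and their negatives are disjoint, and together they are numerous enough to
exhaust the non-zero elements.
\<close>

lemma square_or_neg_square:
  fixes x :: "'k::{field,finite}"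
  assumes "CARD('k) mod 4 = 3"
  shows "\<exists>y. x = y\<^sup>2 \<or> - x = y\<^sup>2"
proof (cases "x = 0")
  case False
  let ?T = "(\<lambda>x. x\<^sup>2) ` (UNIV - {0::'k})"
  have "?T \<inter> uminus ` ?T = {}"
  proof (rule ccontr)
    assume "?T \<inter> uminus ` ?T \<noteq> {}"
    then obtain a b :: 'k where "a \<noteq> 0" "b \<noteq> 0" "a\<^sup>2 = - (b\<^sup>2)" by auto
    then have "(a / b)\<^sup>2 = - 1" by (simp add: power_divide)
    then show False using neg_one_nonsquare[OF assms] by blast
  qed
  then have "card (?T \<union> uminus ` ?T) = 2 * card ?T"
    by (subst card_Un_disjoint) (auto simp: card_image)
  moreover have "?T \<union> uminus ` ?T \<subseteq> UNIV - {0}" by auto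
  moreover have "card (UNIV - {0::'k}) = CARD('k) - 1" by simp
  ultimately have "?T \<union> uminus ` ?T = UNIV - {0}"
    using card_nonzero_le_double_squares[where 'k='k]
    by (metis (no_types, lifting) card_seteq finite)
  then have "x \<in> ?T \<union> uminus ` ?T" using False by simp
  then show ?thesis by auto
qed auto

section \<open>Diagonalisation of quadratic forms\<close>

lemma ex_inverse_of_trivial_kernel:
  fixes A :: "'k::field mat"
  assumes A: "A \<in> carrier_mat n n" and inj: "\<And>v. v \<in> carrier_vec n \<Longrightarrow> A *\<^sub>v v = 0\<^sub>v n \<Longrightarrow> v = 0\<^sub>v n"
  shows "\<exists>B\<in>carrier_mat n n. A * B = 1\<^sub>m n \<and> B * A = 1\<^sub>m n"
proof -
  have "det A \<noteq> 0" using det_0_iff_vec_prod_zero_field[OF A] inj by blast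
  from det_non_zero_imp_unit[OF A this, of "()"] show ?thesis
    by (auto simp: Units_def ring_mat_def)
qed

lemma invertible_matI:
  assumes "A \<in> carrier_mat n n" "B \<in> carrier_mat n n" "A * B = 1\<^sub>m n" "B * A = 1\<^sub>m n"
  shows "invertible_mat A"
  using assms unfolding invertible_mat_def inverts_mat_def by (auto intro!: exI[of _ B])

lemma invertible_matE:
  assumes "invertible_mat A" "A \<in> carrier_mat n n"
  obtains B where "B \<in> carrier_mat n n" "A * B = 1\<^sub>m n" "B * A = 1\<^sub>m n"
proof -
  from assms obtain B where B: "A * B = 1\<^sub>m n" "B * A = 1\<^sub>m (dim_row B)"
    unfolding invertible_mat_def inverts_mat_def by auto
  have "dim_col B = n" using B(1) by (metis index_mult_mat(3) index_one_mat(3))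
  moreover have "dim_row B = n" using B(2) assms(2) by (metis carrier_matD(2) index_mult_mat(3) index_one_mat(3))
  ultimately have "B \<in> carrier_mat n n" by auto
  then show ?thesis using that B by auto
qed

fun lincomb_upto :: "nat \<Rightarrow> nat \<Rightarrow> (nat \<Rightarrow> 'k::field) \<Rightarrow> (nat \<Rightarrow> 'k vec) \<Rightarrow> 'k vec" where
  "lincomb_upto n 0 c b = 0\<^sub>v n"
| "lincomb_upto n (Suc k) c b = lincomb_upto n k c b + c k \<cdot>\<^sub>v b k"

lemma lincomb_upto_carrier:
  "(\<And>i. i < k \<Longrightarrow> b i \<in> carrier_vec n) \<Longrightarrow> lincomb_upto n k c b \<in> carrier_vec n"
  by (induction k) auto

lemma lincomb_upto_cong:
  "(\<And>i. i < k \<Longrightarrow> c i = c' i) \<Longrightarrow> lincomb_upto n k c b = lincomb_upto n k c' b"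
  by (induction k) auto

lemma lincomb_upto_index:
  assumes "\<And>i. i < k \<Longrightarrow> b i \<in> carrier_vec n" "i < n"
  shows "lincomb_upto n k c b $ i = (\<Sum>j<k. c j * b j $ i)"
  using assms(1)
proof (induction k)
  case (Suc k)
  have "lincomb_upto n k c b \<in> carrier_vec n" using Suc.prems by (intro lincomb_upto_carrier) auto
  moreover have "b k \<in> carrier_vec n" using Suc.prems by simp
  ultimately have "lincomb_upto n (Suc k) c b $ i = lincomb_upto n k c b $ i + c k * b k $ i"
    using assms(2) by (simp add: carrier_vecD)
  then show ?case using Suc by simp
qed (use assms in auto)

locale quadratic_space =
  fixes n :: nat and Q :: "'k::{field,finite} vec \<Rightarrow> 'k"
  assumes quad: "quadratic_form n Q" and nondeg: "nondegenerate n Q" and two: "(2::'k) \<noteq> 0"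
begin

abbreviation "V \<equiv> carrier_vec n :: 'k vec set"
abbreviation "B \<equiv> assoc_form Q"

lemma B_sym: "u \<in> V \<Longrightarrow> v \<in> V \<Longrightarrow> B u v = B v u"
  by (simp add: assoc_form_def comm_add_vec[of u n v] algebra_simps)

lemma B_add: "u \<in> V \<Longrightarrow> v \<in> V \<Longrightarrow> w \<in> V \<Longrightarrow> B (u + v) w = B u w + B v w"
  using quad by (simp add: quadratic_form_def)

lemma B_smult: "u \<in> V \<Longrightarrow> w \<in> V \<Longrightarrow> B (a \<cdot>\<^sub>v u) w = a * B u w"
  using quad by (simp add: quadratic_form_def)

lemma B_add_right: "u \<in> V \<Longrightarrow> v \<in> V \<Longrightarrow> w \<in> V \<Longrightarrow> B w (u + v) = B w u + B w v"
  by (simp add: B_sym[of w] B_add)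

lemma B_smult_right: "u \<in> V \<Longrightarrow> w \<in> V \<Longrightarrow> B w (a \<cdot>\<^sub>v u) = a * B w u"
  by (simp add: B_sym[of w] B_smult)

lemma Q_smult: "v \<in> V \<Longrightarrow> Q (a \<cdot>\<^sub>v v) = a\<^sup>2 * Q v"
  using quad by (simp add: quadratic_form_def)

lemma Q_eq_B: assumes v: "v \<in> V" shows "Q v = B v v"
proof -
  have "v + v = 2 \<cdot>\<^sub>v v" using v by (intro eq_vecI) auto
  then have "Q (v + v) = 2\<^sup>2 * Q v" using Q_smult[OF v] by simp
  then show ?thesis using two by (simp add: assoc_form_def field_simps power2_eq_square)
qed

lemma Q_add: "u \<in> V \<Longrightarrow> v \<in> V \<Longrightarrow> Q (u + v) = Q u + 2 * B u v + Q v"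
  using two by (simp add: assoc_form_def field_simps)

lemma B_zero: "w \<in> V \<Longrightarrow> B (0\<^sub>v n) w = 0"
proof -
  assume w: "w \<in> V"
  have "(0::'k) \<cdot>\<^sub>v 0\<^sub>v n = 0\<^sub>v n" by (intro eq_vecI) auto
  then show ?thesis using B_smult[of "0\<^sub>v n" w 0] w by simp
qed

lemma B_lincomb:
  assumes "\<And>i. i < k \<Longrightarrow> b i \<in> V" "w \<in> V"
  shows "B (lincomb_upto n k c b) w = (\<Sum>j<k. c j * B (b j) w)"
  using assms(1)
proof (induction k)
  case (Suc k)
  have "lincomb_upto n k c b \<in> V" using Suc.prems by (intro lincomb_upto_carrier) auto
  then show ?case using Suc assms(2) by (simp add: B_add B_smult)
qed (simp add: B_zero assms)

lemma nondegD: "u \<in> V \<Longrightarrow> (\<And>v. v \<in> V \<Longrightarrow> B u v = 0) \<Longrightarrow> u = 0\<^sub>v n"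
  using nondeg by (auto simp: nondegenerate_def)

definition orthogonal_upto :: "nat \<Rightarrow> (nat \<Rightarrow> 'k vec) \<Rightarrow> bool" where
  "orthogonal_upto k b \<longleftrightarrow> (\<forall>i<k. b i \<in> V \<and> Q (b i) \<noteq> 0) \<and> (\<forall>i<k. \<forall>j<k. i \<noteq> j \<longrightarrow> B (b i) (b j) = 0)"

lemma B_lincomb_orthogonal:
  assumes b: "orthogonal_upto k b" and j: "j < k"
  shows "B (lincomb_upto n k c b) (b j) = c j * Q (b j)"
proof -
  have "B (lincomb_upto n k c b) (b j) = (\<Sum>i<k. c i * B (b i) (b j))"
    using b j by (intro B_lincomb) (auto simp: orthogonal_upto_def)
  also have "\<dots> = (\<Sum>i<k. if i = j then c j * Q (b j) else 0)"
    using b j by (intro sum.cong) (auto simp: orthogonal_upto_def Q_eq_B)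
  finally show ?thesis using j by simp
qed

lemma Q_lincomb_orthogonal:
  assumes b: "orthogonal_upto k b"
  shows "Q (lincomb_upto n k c b) = (\<Sum>j<k. (c j)\<^sup>2 * Q (b j))"
proof -
  let ?l = "lincomb_upto n k c b"
  have l: "?l \<in> V" using b by (intro lincomb_upto_carrier) (auto simp: orthogonal_upto_def)
  have "Q ?l = (\<Sum>j<k. c j * B (b j) ?l)"
    using b l by (subst Q_eq_B[OF l], subst B_lincomb) (auto simp: orthogonal_upto_def)
  also have "\<dots> = (\<Sum>j<k. (c j)\<^sup>2 * Q (b j))"
    using b l by (intro sum.cong refl)
      (auto simp: B_sym[of _ ?l] B_lincomb_orthogonal orthogonal_upto_def power2_eq_square)
  finally show ?thesis .
qed

text \<open>
Otherwise the form vanishes on the orthogonal complement $R$ of the given vectors, and so does the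
bilinear form, by polarization. Projecting along the given vectors shows that $R$ is orthogonal to the
whole space, so $R = 0$ and $k < n$ vectors span a space with $q^n$ elements.
\<close>

lemma ex_anisotropic_perp:
  assumes b: "orthogonal_upto k b" and k: "k < n"
  shows "\<exists>v\<in>V. Q v \<noteq> 0 \<and> (\<forall>i<k. B v (b i) = 0)"
proof (rule ccontr)
  assume neg: "\<not> ?thesis"
  define R where "R = {v \<in> V. \<forall>i<k. B v (b i) = 0}"
  have bV: "b i \<in> V" if "i < k" for i using b that by (auto simp: orthogonal_upto_def)
  have R0: "Q v = 0" if "v \<in> R" for v using neg that by (auto simp: R_def)
  have RB: "B u v = 0" if u: "u \<in> R" and v: "v \<in> R" for u v
  proof -
    have "u + v \<in> R" using u v by (auto simp: R_def B_add bV)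
    then have "Q (u + v) = 0" by (rule R0)
    then show ?thesis using R0 u v two by (simp add: assoc_form_def)
  qed
  have span: "x \<in> range (\<lambda>c. lincomb_upto n k c b)" if x: "x \<in> V" for x
  proof -
    \<comment> \<open>\<open>l\<close> is the projection to the span of the \<open>b i\<close> and \<open>p\<close> the one to \<open>R\<close>\<close>
    define l where "l y = lincomb_upto n k (\<lambda>i. B y (b i) / Q (b i)) b" for y
    define p where "p y = y + (- 1) \<cdot>\<^sub>v l y" for y
    have lV: "l y \<in> V" for y unfolding l_def by (rule lincomb_upto_carrier) (rule bV)
    have pR: "p y \<in> R" if y: "y \<in> V" for y
    proof -
      have "B (p y) (b i) = 0" if i: "i < k" for i
      proof -
        have "B (l y) (b i) = B y (b i)"
          unfolding l_def using b i by (subst B_lincomb_orthogonal) (auto simp: orthogonal_upto_def)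
        then show ?thesis using y lV bV[OF i] by (simp add: p_def B_add B_smult)
      qed
      then show ?thesis using y lV by (auto simp: R_def p_def)
    qed
    have pV: "p y \<in> V" if "y \<in> V" for y using pR[OF that] by (simp add: R_def)
    have decomp: "y = p y + l y" if y: "y \<in> V" for y
      using y lV[of y] by (intro eq_vecI) (auto simp: p_def)
    have "p x = 0\<^sub>v n"
    proof (rule nondegD)
      show "p x \<in> V" by (rule pV[OF x])
      fix y assume y: "y \<in> V"
      have "B (p x) (l y) = B (l y) (p x)" by (rule B_sym[OF pV[OF x] lV])
      also have "\<dots> = (\<Sum>j<k. (B y (b j) / Q (b j)) * B (b j) (p x))"
        unfolding l_def by (rule B_lincomb[OF bV pV[OF x]])
      also have "\<dots> = 0"
        using pR[OF x] bV pV[OF x] by (intro sum.neutral) (auto simp: R_def B_sym[of _ "p x"])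
      finally have "B (p x) (l y) = 0" .
      moreover have "B (p x) (p y) = 0" by (rule RB[OF pR[OF x] pR[OF y]])
      ultimately show "B (p x) y = 0"
        using B_add_right[OF pV[OF y] lV pV[OF x], of y] unfolding decomp[OF y, symmetric] by simp
    qed
    then have "x = l x" using decomp[OF x] lV[of x] by simp
    then show ?thesis unfolding l_def by blast
  qed
  let ?L = "(\<lambda>c. lincomb_upto n k c b) ` (Pi\<^sub>E {..<k} (\<lambda>_. UNIV :: 'k set))"
  have "V \<subseteq> ?L"
  proof
    fix x assume "x \<in> V"
    then obtain c where "x = lincomb_upto n k c b" using span by blast
    also have "\<dots> = lincomb_upto n k (restrict c {..<k}) b" by (rule lincomb_upto_cong) simp
    finally show "x \<in> ?L" by (auto intro!: image_eqI[of _ _ "restrict c {..<k}"])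
  qed
  moreover have fin: "finite (Pi\<^sub>E {..<k} (\<lambda>_. UNIV :: 'k set))" by (intro finite_PiE) auto
  ultimately have fV: "finite V" and "card V \<le> card (Pi\<^sub>E {..<k} (\<lambda>_. UNIV :: 'k set))"
    by (auto intro: finite_subset) (meson card_image_le card_mono finite_imageI le_trans)
  then have "card V \<le> CARD('k) ^ k" by (simp add: card_PiE)
  moreover have "CARD('k) ^ n \<le> card V"
  proof -
    have "inj_on (vec n) (Pi\<^sub>E {..<n} (\<lambda>_. UNIV :: 'k set))"
    proof (rule inj_onI)
      fix c d assume c: "c \<in> Pi\<^sub>E {..<n} (\<lambda>_. UNIV :: 'k set)" and d: "d \<in> Pi\<^sub>E {..<n} (\<lambda>_. UNIV :: 'k set)"
        and eq: "vec n c = vec n d"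
      show "c = d"
      proof (rule PiE_ext[OF c d])
        fix i assume "i \<in> {..<n}"
        then show "c i = d i" using arg_cong[OF eq, of "\<lambda>v. v $ i"] by simp
      qed
    qed
    then have "card (vec n ` (Pi\<^sub>E {..<n} (\<lambda>_. UNIV :: 'k set))) = CARD('k) ^ n"
      by (simp add: card_image card_PiE)
    then show ?thesis using fV by (metis (no_types, lifting) card_mono image_subsetI vec_carrier)
  qed
  moreover have "1 < CARD('k)"
    using card_mono[of UNIV "{0, 1::'k}"] by simp
  ultimately show False using k by (meson leD le_trans power_strict_increasing)
qed

lemma orthogonal_upto_extend:
  assumes b: "orthogonal_upto k b" and v: "v \<in> V" "Q v \<noteq> 0" "\<And>i. i < k \<Longrightarrow> B v (b i) = 0"
  shows "orthogonal_upto (Suc k) (b(k := v))"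
  using b v by (auto simp: orthogonal_upto_def less_Suc_eq B_sym[of _ v])

text \<open>
Two dimensions of complement suffice to represent the value $1$, because a non-degenerate binary
form is universal. This is why a diagonal basis can be normalised except for its last vector.
\<close>

lemma ex_unit_perp:
  assumes b: "orthogonal_upto k b" and k: "Suc k < n"
  shows "\<exists>v\<in>V. Q v = 1 \<and> (\<forall>i<k. B v (b i) = 0)"
proof -
  obtain u where u: "u \<in> V" "Q u \<noteq> 0" "\<forall>i<k. B u (b i) = 0"
    using ex_anisotropic_perp[OF b] k by auto
  have "orthogonal_upto (Suc k) (b(k := u))" using b u by (intro orthogonal_upto_extend) auto
  then obtain w where w: "w \<in> V" "Q w \<noteq> 0" "\<forall>i<Suc k. B w ((b(k := u)) i) = 0"
    using ex_anisotropic_perp k by blast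
  obtain x y where xy: "Q u * x\<^sup>2 + Q w * y\<^sup>2 = 1"
    using binary_form_universal[OF u(2) w(2)] by blast
  have wu: "B w u = 0" using w(3)[rule_format, of k] by simp
  have wb: "B w (b i) = 0" if "i < k" for i using w(3)[rule_format, of i] that by simp
  show ?thesis
  proof (intro bexI[of _ "x \<cdot>\<^sub>v u + y \<cdot>\<^sub>v w"] conjI allI impI)
    show "x \<cdot>\<^sub>v u + y \<cdot>\<^sub>v w \<in> V" using u w by simp
    have "B u w = 0" using wu B_sym[OF u(1) w(1)] by simp
    then show "Q (x \<cdot>\<^sub>v u + y \<cdot>\<^sub>v w) = 1"
      using u w xy by (simp add: Q_add Q_smult B_smult B_smult_right algebra_simps)
    fix i assume i: "i < k"
    then have "b i \<in> V" using b by (auto simp: orthogonal_upto_def)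
    then show "B (x \<cdot>\<^sub>v u + y \<cdot>\<^sub>v w) (b i) = 0"
      using u w wb[OF i] i by (simp add: B_add B_smult)
  qed
qed

lemma ex_orthonormal_upto:
  "k < n \<Longrightarrow> \<exists>b. orthogonal_upto k b \<and> (\<forall>i<k. Q (b i) = 1)"
proof (induction k)
  case 0
  then show ?case by (auto simp: orthogonal_upto_def)
next
  case (Suc k)
  then obtain b where b: "orthogonal_upto k b" "\<forall>i<k. Q (b i) = 1" by auto
  obtain v where v: "v \<in> V" "Q v = 1" "\<forall>i<k. B v (b i) = 0" using ex_unit_perp[OF b(1) Suc.prems] by auto
  have "orthogonal_upto (Suc k) (b(k := v))" using b(1) v by (intro orthogonal_upto_extend) auto
  moreover have "\<forall>i<Suc k. Q ((b(k := v)) i) = 1" using b(2) v(2) by (simp add: less_Suc_eq)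
  ultimately show ?case by blast
qed

text \<open>
The last diagonal entry is a square or minus a square, so scaling turns it into $1$ or $-1$.
\<close>

lemma ex_diagonalising_matrix:
  assumes q: "CARD('k) mod 4 = 3" and n: "0 < n"
  shows "\<exists>P P' \<delta>. P \<in> carrier_mat n n \<and> P' \<in> carrier_mat n n \<and> P * P' = 1\<^sub>m n \<and> P' * P = 1\<^sub>m n \<and>
     (\<delta> = 1 \<or> \<delta> = - 1) \<and>
     (\<forall>v\<in>V. Q (P *\<^sub>v v) = (\<Sum>i<n - 1. (v $ i)\<^sup>2) + \<delta> * (v $ (n - 1))\<^sup>2)"
proof -
  obtain m where m: "n = Suc m" using n by (cases n) auto
  obtain b where b: "orthogonal_upto m b" "\<forall>i<m. Q (b i) = 1" using ex_orthonormal_upto[of m] m by auto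
  obtain u where u: "u \<in> V" "Q u \<noteq> 0" "\<forall>i<m. B u (b i) = 0"
    using ex_anisotropic_perp[OF b(1)] m by auto
  obtain y where y: "Q u = y\<^sup>2 \<or> - Q u = y\<^sup>2" using square_or_neg_square[OF q] by blast
  define \<delta> where "\<delta> = Q u / y\<^sup>2"
  have y0: "y \<noteq> 0" using y u by auto
  have \<delta>: "\<delta> = 1 \<or> \<delta> = - 1" using y y0 unfolding \<delta>_def
    by (metis divide_self minus_divide_left minus_equation_iff u(2) zero_eq_power2 divide_minus_left)
  define c where "c = b(m := (1 / y) \<cdot>\<^sub>v u)"
  have "orthogonal_upto (Suc m) c" unfolding c_def
    using b(1) u y0 by (intro orthogonal_upto_extend) (auto simp: Q_smult B_smult orthogonal_upto_def)
  then have c: "orthogonal_upto n c" using m by simp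
  have cV: "c i \<in> V" if "i < n" for i using c that by (auto simp: orthogonal_upto_def)
  define P where "P = mat n n (\<lambda>(i, j). c j $ i)"
  have P: "P \<in> carrier_mat n n" by (simp add: P_def)
  have Pv: "P *\<^sub>v v = lincomb_upto n n (\<lambda>i. v $ i) c" if v: "v \<in> V" for v
  proof (rule eq_vecI)
    have l: "lincomb_upto n n (\<lambda>i. v $ i) c \<in> V" by (rule lincomb_upto_carrier) (rule cV)
    then show dim: "dim_vec (P *\<^sub>v v) = dim_vec (lincomb_upto n n (\<lambda>i. v $ i) c)" by (simp add: P_def)
    fix i assume "i < dim_vec (lincomb_upto n n (\<lambda>i. v $ i) c)"
    then have i: "i < n" using l by simp
    show "(P *\<^sub>v v) $ i = lincomb_upto n n (\<lambda>i. v $ i) c $ i"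
      using i v by (subst lincomb_upto_index[OF cV i])
        (auto simp: P_def scalar_prod_def atLeast0LessThan mult.commute intro!: sum.cong)
  qed
  have QP: "Q (P *\<^sub>v v) = (\<Sum>i<n - 1. (v $ i)\<^sup>2) + \<delta> * (v $ (n - 1))\<^sup>2" if v: "v \<in> V" for v
    unfolding Pv[OF v] Q_lincomb_orthogonal[OF c] using b(2) u(1)
    by (simp add: m c_def Q_smult \<delta>_def power_divide)
  have "\<exists>P'\<in>carrier_mat n n. P * P' = 1\<^sub>m n \<and> P' * P = 1\<^sub>m n"
  proof (rule ex_inverse_of_trivial_kernel[OF P])
    fix v assume v: "v \<in> V" and 0: "P *\<^sub>v v = 0\<^sub>v n"
    have "v $ j = 0" if j: "j < n" for j
    proof -
      have "v $ j * Q (c j) = B (P *\<^sub>v v) (c j)"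
        unfolding Pv[OF v] using B_lincomb_orthogonal[OF c j, of "\<lambda>i. v $ i"] by simp
      also have "\<dots> = 0" unfolding 0 by (rule B_zero[OF cV[OF j]])
      finally show ?thesis using c j by (auto simp: orthogonal_upto_def)
    qed
    then show "v = 0\<^sub>v n" using v by (intro eq_vecI) auto
  qed
  then show ?thesis using P QP \<delta> by blast
qed

end

section \<open>The orthogonal group of the sum of squares\<close>

text \<open>
Vectors are functions on \<^typ>\<open>nat\<close>, of which only the first $n$ coordinates count; this makes
composition of maps and coordinate changes free of side conditions.
\<close>

definition dot :: "nat \<Rightarrow> (nat \<Rightarrow> 'k::field) \<Rightarrow> (nat \<Rightarrow> 'k) \<Rightarrow> 'k" where
  "dot n u v = (\<Sum>i<n. u i * v i)"

definition smul :: "'k::field \<Rightarrow> (nat \<Rightarrow> 'k) \<Rightarrow> nat \<Rightarrow> 'k" where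
  "smul c v = (\<lambda>i. c * v i)"

text \<open>
Linear maps of the first $n$ coordinates, extended by the identity on the remaining ones. The last
point makes the extension unique, so the group of these maps is isomorphic to a matrix group.
\<close>

definition isometry :: "nat \<Rightarrow> ((nat \<Rightarrow> 'k::field) \<Rightarrow> nat \<Rightarrow> 'k) \<Rightarrow> bool" where
  "isometry n f \<longleftrightarrow> bij f \<and> (\<forall>u v. f (u + v) = f u + f v) \<and> (\<forall>c v. f (smul c v) = smul c (f v)) \<and>
     (\<forall>v. \<forall>i\<ge>n. f v i = v i) \<and> (\<forall>v. (\<forall>i<n. v i = 0) \<longrightarrow> f v = v) \<and>
     (\<forall>u v. dot n (f u) (f v) = dot n u v)"

definition isometry_group :: "nat \<Rightarrow> ((nat \<Rightarrow> 'k::field) \<Rightarrow> nat \<Rightarrow> 'k) monoid" where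
  "isometry_group n = \<lparr>carrier = {f. isometry n f}, monoid.mult = (\<circ>), one = id\<rparr>"

lemma dot_add: "dot n (u + v) w = dot n u w + dot n v w" "dot n w (u + v) = dot n w u + dot n w v"
  by (simp_all add: dot_def algebra_simps sum.distrib)

lemma dot_diff: "dot n (u - v) w = dot n u w - dot n v w" "dot n w (u - v) = dot n w u - dot n w v"
  by (simp_all add: dot_def algebra_simps sum_subtractf)

lemma dot_minus: "dot n (- u) w = - dot n u w" "dot n w (- u) = - dot n w u"
  by (simp_all add: dot_def sum_negf)

lemma dot_smul: "dot n (smul c u) w = c * dot n u w" "dot n w (smul c u) = c * dot n w u"
  by (simp_all add: dot_def smul_def sum_distrib_left algebra_simps)

lemma dot_zero: "dot n 0 w = 0" "dot n w 0 = 0"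
  by (simp_all add: dot_def)

lemmas dot_linear = dot_add dot_diff dot_minus dot_smul dot_zero

lemma dot_commute: "dot n u v = dot n v u"
  by (simp add: dot_def mult.commute)

lemma smul_apply [simp]: "smul c v i = c * v i" by (simp add: smul_def)

lemma isometry_bij: "isometry n f \<Longrightarrow> bij f"
  and isometry_add: "isometry n f \<Longrightarrow> f (u + v) = f u + f v"
  and isometry_smul: "isometry n f \<Longrightarrow> f (smul c v) = smul c (f v)"
  and isometry_ge: "isometry n f \<Longrightarrow> n \<le> i \<Longrightarrow> f v i = v i"
  and isometry_tail: "isometry n f \<Longrightarrow> (\<And>i. i < n \<Longrightarrow> v i = 0) \<Longrightarrow> f v = v"
  and isometry_dot: "isometry n f \<Longrightarrow> dot n (f u) (f v) = dot n u v"
  by (simp_all add: isometry_def)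

lemma isometry_zero: "isometry n f \<Longrightarrow> f 0 = 0"
  by (simp add: isometry_tail)

lemma isometry_minus: "isometry n f \<Longrightarrow> f (- v) = - f v"
  using isometry_smul[of n f "- 1" v] by (simp add: smul_def fun_Compl_def)

lemma isometry_diff: "isometry n f \<Longrightarrow> f (u - v) = f u - f v"
  using isometry_add[of n f u "- v"] isometry_minus[of n f v] by (simp only: add_uminus_conv_diff)

lemmas isometry_linear = isometry_add isometry_diff isometry_minus isometry_smul isometry_zero

lemma isometry_inj: "isometry n f \<Longrightarrow> f u = f v \<longleftrightarrow> u = v"
  using isometry_bij[of n f] by (auto simp: bij_def inj_def)

lemma isometry_id: "isometry n id"
  by (simp add: isometry_def)

lemma isometry_comp: "isometry n f \<Longrightarrow> isometry n g \<Longrightarrow> isometry n (f \<circ> g)"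
  by (simp add: isometry_def bij_comp)

lemma isometry_inv: assumes f: "isometry n f" shows "isometry n (inv_into UNIV f)"
proof -
  note b = isometry_bij[OF f]
  have eq: "inv_into UNIV f x = y \<longleftrightarrow> x = f y" for x y using b by (metis bij_inv_eq_iff)
  have fi: "f (inv_into UNIV f x) = x" for x using eq by metis
  show ?thesis unfolding isometry_def
  proof (intro conjI allI impI)
    show "bij (inv_into UNIV f)" by (rule bij_imp_bij_inv[OF b])
    show "inv_into UNIV f (u + v) = inv_into UNIV f u + inv_into UNIV f v" for u v by (simp add: eq isometry_add[OF f] fi)
    show "inv_into UNIV f (smul c v) = smul c (inv_into UNIV f v)" for c v by (simp add: eq isometry_smul[OF f] fi)
    show "inv_into UNIV f v i = v i" if "n \<le> i" for v i using isometry_ge[OF f that, of "inv_into UNIV f v"] by (simp add: fi)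
    show "inv_into UNIV f v = v" if "\<forall>i<n. v i = 0" for v using isometry_tail[OF f, of v] that by (simp add: eq)
    show "dot n (inv_into UNIV f u) (inv_into UNIV f v) = dot n u v" for u v
      using isometry_dot[OF f, of "inv_into UNIV f u" "inv_into UNIV f v"] by (simp add: fi)
  qed
qed

lemma isometry_group_is_group: "group (isometry_group n)"
proof (rule groupI)
  fix f assume "f \<in> carrier (isometry_group n :: ((nat \<Rightarrow> 'a) \<Rightarrow> nat \<Rightarrow> 'a) monoid)"
  then show "\<exists>g\<in>carrier (isometry_group n). g \<otimes>\<^bsub>isometry_group n\<^esub> f = \<one>\<^bsub>isometry_group n\<^esub>"
    by (intro bexI[of _ "inv_into UNIV f"])
      (auto simp: isometry_group_def isometry_inv dest: isometry_bij intro: inv_o_cancel bij_is_inj)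
qed (auto simp: isometry_group_def isometry_comp isometry_id comp_assoc)

lemma orthogonal_group_is_group: "group (orthogonal_group n Q)"
proof (rule groupI)
  fix A assume "A \<in> carrier (orthogonal_group n Q)"
  then have A: "A \<in> carrier_mat n n" "invertible_mat A" "\<And>v. v \<in> carrier_vec n \<Longrightarrow> Q (A *\<^sub>v v) = Q v"
    by (auto simp: orthogonal_group_def)
  then obtain B where B: "B \<in> carrier_mat n n" "A * B = 1\<^sub>m n" "B * A = 1\<^sub>m n" by (elim invertible_matE)
  have "Q (B *\<^sub>v v) = Q v" if v: "v \<in> carrier_vec n" for v
  proof -
    have "Q (B *\<^sub>v v) = Q (A *\<^sub>v (B *\<^sub>v v))" using A B v by simp
    also have "A *\<^sub>v (B *\<^sub>v v) = v" using A B v by (simp flip: assoc_mult_mat_vec)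
    finally show ?thesis .
  qed
  then show "\<exists>B\<in>carrier (orthogonal_group n Q). B \<otimes>\<^bsub>orthogonal_group n Q\<^esub> A = \<one>\<^bsub>orthogonal_group n Q\<^esub>"
    using A B invertible_matI[OF B(1) A(1)] by (intro bexI[of _ B]) (auto simp: orthogonal_group_def)
next
  fix A B assume "A \<in> carrier (orthogonal_group n Q)" "B \<in> carrier (orthogonal_group n Q)"
  then have A: "A \<in> carrier_mat n n" "invertible_mat A" "\<And>v. v \<in> carrier_vec n \<Longrightarrow> Q (A *\<^sub>v v) = Q v"
    and B: "B \<in> carrier_mat n n" "invertible_mat B" "\<And>v. v \<in> carrier_vec n \<Longrightarrow> Q (B *\<^sub>v v) = Q v"
    by (auto simp: orthogonal_group_def)
  obtain A' where A': "A' \<in> carrier_mat n n" "A * A' = 1\<^sub>m n" "A' * A = 1\<^sub>m n"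
    using A by (elim invertible_matE)
  obtain B' where B': "B' \<in> carrier_mat n n" "B * B' = 1\<^sub>m n" "B' * B = 1\<^sub>m n"
    using B by (elim invertible_matE)
  have cancel: "X * Y * (Y' * X') = 1\<^sub>m n"
    if "X \<in> carrier_mat n n" "Y \<in> carrier_mat n n" "Y' \<in> carrier_mat n n" "X' \<in> carrier_mat n n"
      "Y * Y' = 1\<^sub>m n" "X * X' = 1\<^sub>m n" for X Y X' Y' :: "'a mat"
  proof -
    have "X * Y * (Y' * X') = X * (Y * (Y' * X'))" using that by (intro assoc_mult_mat) auto
    also have "Y * (Y' * X') = Y * Y' * X'" using that by (intro assoc_mult_mat[symmetric]) auto
    finally show ?thesis using that by simp
  qed
  have "invertible_mat (A * B)"
    using A B A' B' by (intro invertible_matI[of _ n "B' * A'"] cancel) auto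
  then show "A \<otimes>\<^bsub>orthogonal_group n Q\<^esub> B \<in> carrier (orthogonal_group n Q)"
    using A B by (auto simp: orthogonal_group_def assoc_mult_mat_vec)
next
  fix A B C assume "A \<in> carrier (orthogonal_group n Q)" "B \<in> carrier (orthogonal_group n Q)"
    "C \<in> carrier (orthogonal_group n Q)"
  then show "A \<otimes>\<^bsub>orthogonal_group n Q\<^esub> B \<otimes>\<^bsub>orthogonal_group n Q\<^esub> C
    = A \<otimes>\<^bsub>orthogonal_group n Q\<^esub> (B \<otimes>\<^bsub>orthogonal_group n Q\<^esub> C)"
    by (auto simp: orthogonal_group_def)
qed (auto simp: orthogonal_group_def intro: invertible_matI[of _ n "1\<^sub>m n"])

definition mat_of :: "nat \<Rightarrow> ((nat \<Rightarrow> 'k::field) \<Rightarrow> nat \<Rightarrow> 'k) \<Rightarrow> 'k mat" where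
  "mat_of n f = mat n n (\<lambda>(i, j). f (\<lambda>l. if l = j then 1 else 0) i)"

lemma mat_of_carrier [simp]: "mat_of n f \<in> carrier_mat n n" by (simp add: mat_of_def)

lemma mat_of_mult_vec:
  assumes add: "\<And>u v. f (u + v) = f u + f v" and smul: "\<And>c v. f (smul c v) = smul c (f v)"
    and tail: "\<And>v i. (\<And>j. j < n \<Longrightarrow> v j = 0) \<Longrightarrow> i < n \<Longrightarrow> f v i = 0"
  shows "mat_of n f *\<^sub>v vec n v = vec n (f v)"
proof (rule eq_vecI)
  fix i assume "i < dim_vec (vec n (f v))"
  then have i: "i < n" by simp
  let ?\<delta> = "\<lambda>j l. if l = j then 1 else 0 :: 'a"
  have "f v i = (\<Sum>j<k. v j * f (?\<delta> j) i) + f (\<lambda>l. if l < k then 0 else v l) i" for k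
  proof (induction k)
    case (Suc k)
    have "(\<lambda>l. if l < k then 0 else v l) = smul (v k) (?\<delta> k) + (\<lambda>l. if l < Suc k then 0 else v l)"
      by (auto simp: fun_eq_iff less_Suc_eq)
    then show ?case using Suc.IH by (simp add: add smul)
  qed simp
  from this[of n] have "f v i = (\<Sum>j<n. v j * f (?\<delta> j) i)" using i by (simp add: tail)
  then show "(mat_of n f *\<^sub>v vec n v) $ i = vec n (f v) $ i"
    using i by (simp add: mat_of_def scalar_prod_def atLeast0LessThan mult.commute)
qed (simp add: mat_of_def)

lemma isometry_mat_of:
  assumes "isometry n f" shows "mat_of n f *\<^sub>v vec n v = vec n (f v)"
  using assms by (intro mat_of_mult_vec) (auto simp: isometry_linear isometry_tail)

lemma mat_eq_of_mult_vec_eq: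
  assumes A: "A \<in> carrier_mat n n" and B: "B \<in> carrier_mat n n"
    and eq: "\<And>v. v \<in> carrier_vec n \<Longrightarrow> A *\<^sub>v v = B *\<^sub>v (v :: 'k::field vec)"
  shows "A = B"
proof (rule eq_matI)
  fix i j assume "i < dim_row B" "j < dim_col B"
  then have ij: "i < n" "j < n" using B by auto
  have "(A *\<^sub>v unit_vec n j) $ i = (B *\<^sub>v unit_vec n j) $ i" using eq by simp
  then show "A $$ (i, j) = B $$ (i, j)" using A B ij by simp
qed (use A B in auto)

lemma mult_mat_zero_vec: "A \<in> carrier_mat n n \<Longrightarrow> A *\<^sub>v 0\<^sub>v n = (0\<^sub>v n :: 'k::field vec)"
  by (intro eq_vecI) auto

text \<open>
A matrix $A$ corresponds to the action of $P^{-1}AP$ on the first $n$ coordinates.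
\<close>

lemma isometry_group_iso_orthogonal_group:
  fixes Q :: "'k::{field,finite} vec \<Rightarrow> 'k"
  assumes P: "P \<in> carrier_mat n n" and P': "P' \<in> carrier_mat n n"
    and PP': "P * P' = 1\<^sub>m n" and P'P: "P' * P = 1\<^sub>m n" and two: "(2::'k) \<noteq> 0"
    and QP: "\<And>v. v \<in> carrier_vec n \<Longrightarrow> Q (P *\<^sub>v v) = (\<Sum>i<n. (v $ i)\<^sup>2)"
  shows "\<exists>\<phi>. \<phi> \<in> iso (isometry_group n :: ((nat \<Rightarrow> 'k) \<Rightarrow> nat \<Rightarrow> 'k) monoid) (orthogonal_group n Q)"
proof -
  let ?G = "orthogonal_group n Q" and ?H = "isometry_group n :: ((nat \<Rightarrow> 'k) \<Rightarrow> nat \<Rightarrow> 'k) monoid"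
  define act where "act A v = (\<lambda>i. if i < n then (P' *\<^sub>v (A *\<^sub>v (P *\<^sub>v vec n v))) $ i else v i)"
    for A and v :: "nat \<Rightarrow> 'k"
  have P'Pv: "P' *\<^sub>v (P *\<^sub>v v) = v" if "v \<in> carrier_vec n" for v
    using P P' P'P that by (simp flip: assoc_mult_mat_vec)
  have PP'v: "P *\<^sub>v (P' *\<^sub>v v) = v" if "v \<in> carrier_vec n" for v
    using P P' PP' that by (simp flip: assoc_mult_mat_vec)
  have vec_act: "vec n (act A v) = P' *\<^sub>v (A *\<^sub>v (P *\<^sub>v vec n v))" if "A \<in> carrier_mat n n" for A v
    using P P' that by (intro eq_vecI) (auto simp: act_def)
  have act_mult: "act (A * B) = act A \<circ> act B" if "A \<in> carrier_mat n n" "B \<in> carrier_mat n n" for A B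
  proof (rule ext)
    fix v
    have "A * B *\<^sub>v (P *\<^sub>v vec n v) = A *\<^sub>v (B *\<^sub>v (P *\<^sub>v vec n v))"
      using that P by (intro assoc_mult_mat_vec) auto
    then show "act (A * B) v = (act A \<circ> act B) v"
      using that P unfolding act_def[of "A * B"] comp_def act_def[of A "act B v"] vec_act[OF that(2)]
      by (auto simp: PP'v act_def fun_eq_iff)
  qed
  have act_one: "act (1\<^sub>m n) = id"
    using P by (auto simp: act_def fun_eq_iff P'Pv)
  have act_in: "isometry n (act A)" if A: "A \<in> carrier ?G" for A
  proof -
    from A have AC: "A \<in> carrier_mat n n" "invertible_mat A" and AQ: "\<And>v. v \<in> carrier_vec n \<Longrightarrow> Q (A *\<^sub>v v) = Q v"
      by (auto simp: orthogonal_group_def)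
    obtain B where B: "B \<in> carrier_mat n n" "A * B = 1\<^sub>m n" "B * A = 1\<^sub>m n"
      using AC by (elim invertible_matE)
    have bij: "bij (act A)"
      using act_mult[OF AC(1) B(1)] act_mult[OF B(1) AC(1)] act_one B by (intro o_bij[of "act B"]) auto
    have add: "act A (u + v) = act A u + act A v" for u v
    proof -
      have "vec n (u + v) = vec n u + vec n v" by (intro eq_vecI) auto
      then show ?thesis using P P' AC
        by (auto simp: act_def fun_eq_iff mult_add_distrib_mat_vec[of _ n n])
    qed
    have smul: "act A (smul c v) = smul c (act A v)" for c v
    proof -
      have "vec n (smul c v) = c \<cdot>\<^sub>v vec n v" by (intro eq_vecI) auto
      then show ?thesis using P P' AC
        by (auto simp: act_def fun_eq_iff mult_mat_vec[of _ n n])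
    qed
    have tail: "act A v = v" if "\<forall>i<n. v i = 0" for v
    proof -
      have v: "vec n v = 0\<^sub>v n" using that by (intro eq_vecI) auto
      have "P' *\<^sub>v (A *\<^sub>v (P *\<^sub>v vec n v)) = 0\<^sub>v n" unfolding v using P P' AC(1) by (simp add: mult_mat_zero_vec)
      then show ?thesis using that by (simp add: act_def fun_eq_iff)
    qed
    have sq: "dot n (act A v) (act A v) = dot n v v" for v
    proof -
      let ?w = "A *\<^sub>v (P *\<^sub>v vec n v)"
      have w: "?w \<in> carrier_vec n" using AC P by simp
      have "dot n (act A v) (act A v) = (\<Sum>i<n. ((P' *\<^sub>v ?w) $ i)\<^sup>2)"
        by (simp add: dot_def act_def power2_eq_square)
      also have "\<dots> = Q (P *\<^sub>v (P' *\<^sub>v ?w))" using QP P' w by simp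
      also have "\<dots> = Q (P *\<^sub>v vec n v)" unfolding PP'v[OF w] using P by (intro AQ) simp
      also have "\<dots> = dot n v v" by (subst QP) (auto simp: dot_def power2_eq_square)
      finally show ?thesis .
    qed
    have "dot n (act A u) (act A v) = dot n u v" for u v
    proof -
      have "2 * dot n (act A u) (act A v) = 2 * dot n u v"
        using sq[of "u + v"] sq[of u] sq[of v] dot_commute[of n "act A u" "act A v"] dot_commute[of n u v]
        by (simp add: add dot_add)
      then show ?thesis using two by simp
    qed
    then show ?thesis using bij add smul tail by (auto simp: isometry_def act_def)
  qed
  have "act \<in> iso ?G ?H"
  proof (rule isoI)
    show "act \<in> hom ?G ?H"
      by (rule homI) (use act_in act_mult in \<open>auto simp: isometry_group_def orthogonal_group_def\<close>)
    show "bij_betw act (carrier ?G) (carrier ?H)"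
    proof (rule bij_betwI')
      fix A B assume "A \<in> carrier ?G" "B \<in> carrier ?G"
      then have AB: "A \<in> carrier_mat n n" "B \<in> carrier_mat n n" by (auto simp: orthogonal_group_def)
      show "act A = act B \<longleftrightarrow> A = B"
      proof
        assume eq: "act A = act B"
        show "A = B"
        proof (rule mat_eq_of_mult_vec_eq[OF AB])
          fix w :: "'k vec" assume w: "w \<in> carrier_vec n"
          let ?v = "\<lambda>i. (P' *\<^sub>v w) $ i"
          have v: "vec n ?v = P' *\<^sub>v w" using P' by (intro eq_vecI) auto
          have "P' *\<^sub>v (A *\<^sub>v w) = P' *\<^sub>v (B *\<^sub>v w)"
            using arg_cong[OF eq, of "\<lambda>f. vec n (f ?v)"] unfolding vec_act[OF AB(1)] vec_act[OF AB(2)] v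
            by (simp add: PP'v w)
          then have "P *\<^sub>v (P' *\<^sub>v (A *\<^sub>v w)) = P *\<^sub>v (P' *\<^sub>v (B *\<^sub>v w))" by simp
          then show "A *\<^sub>v w = B *\<^sub>v w" using AB w by (simp add: PP'v)
        qed
      qed simp
    next
      fix A assume "A \<in> carrier ?G"
      then show "act A \<in> carrier ?H" using act_in by (simp add: isometry_group_def)
    next
      fix f assume "f \<in> carrier ?H"
      then have f: "isometry n f" by (simp add: isometry_group_def)
      define A where "A = P * mat_of n f * P'"
      have A: "A \<in> carrier_mat n n"
        unfolding A_def by (rule mult_carrier_mat[OF mult_carrier_mat[OF P mat_of_carrier] P'])
      have AP: "A *\<^sub>v (P *\<^sub>v vec n v) = P *\<^sub>v vec n (f v)" for v
      proof -
        have "A *\<^sub>v (P *\<^sub>v vec n v) = P *\<^sub>v (mat_of n f *\<^sub>v (P' *\<^sub>v (P *\<^sub>v vec n v)))"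
          using P P' unfolding A_def
          by (simp add: assoc_mult_mat_vec[of _ n n _ n])
        then show ?thesis by (simp add: P'Pv isometry_mat_of[OF f])
      qed
      have ex: "\<exists>v. w = P *\<^sub>v vec n v \<and> (\<forall>i\<ge>n. v i = 0)" if w: "w \<in> carrier_vec n" for w
      proof -
        let ?v = "\<lambda>i. if i < n then (P' *\<^sub>v w) $ i else 0"
        have "vec n ?v = P' *\<^sub>v w" using P' by (intro eq_vecI) auto
        then have "w = P *\<^sub>v vec n ?v" using w by (simp add: PP'v)
        then show ?thesis by (intro exI[of _ ?v]) auto
      qed
      have AQ: "Q (A *\<^sub>v w) = Q w" if w: "w \<in> carrier_vec n" for w
      proof -
        obtain v where v: "w = P *\<^sub>v vec n v" using ex[OF w] by blast
        have "Q (A *\<^sub>v w) = dot n (f v) (f v)"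
          unfolding v AP by (subst QP) (auto simp: dot_def power2_eq_square)
        also have "\<dots> = dot n v v" by (rule isometry_dot[OF f])
        also have "\<dots> = Q w" unfolding v by (subst QP) (auto simp: dot_def power2_eq_square)
        finally show ?thesis .
      qed
      have "\<exists>B\<in>carrier_mat n n. A * B = 1\<^sub>m n \<and> B * A = 1\<^sub>m n"
      proof (rule ex_inverse_of_trivial_kernel[OF A])
        fix w assume w: "w \<in> carrier_vec n" and 0: "A *\<^sub>v w = 0\<^sub>v n"
        obtain v where v: "w = P *\<^sub>v vec n v" "\<forall>i\<ge>n. v i = 0" using ex[OF w] by blast
        have "P *\<^sub>v vec n (f v) = 0\<^sub>v n" using 0 unfolding v AP .
        then have "P' *\<^sub>v (P *\<^sub>v vec n (f v)) = P' *\<^sub>v 0\<^sub>v n" by simp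
        then have z: "vec n (f v) = 0\<^sub>v n" using P' by (simp add: P'Pv mult_mat_zero_vec)
        have "f v i = 0" for i
        proof (cases "i < n")
          case True
          then show ?thesis using arg_cong[OF z, of "\<lambda>x. x $ i"] by simp
        next
          case False
          then show ?thesis using v(2) isometry_ge[OF f, of i v] by simp
        qed
        then have "f v = f 0" by (simp add: isometry_zero[OF f] fun_eq_iff)
        then have "v = 0" using isometry_inj[OF f] by blast
        then have "vec n v = 0\<^sub>v n" by (intro eq_vecI) auto
        then show "w = 0\<^sub>v n" unfolding v(1) using P by (simp add: mult_mat_zero_vec)
      qed
      then have "A \<in> carrier ?G" using A AQ by (auto simp: orthogonal_group_def intro: invertible_matI)
      moreover have "f = act A"
        using isometry_ge[OF f] by (auto simp: fun_eq_iff act_def AP P'Pv)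
      ultimately show "\<exists>A\<in>carrier ?G. f = act A" by blast
    qed
  qed
  then have "inv_into (carrier ?G) act \<in> iso ?H ?G"
    by (rule group.iso_set_sym[OF orthogonal_group_is_group])
  then show ?thesis by blast
qed

section \<open>Forms of minus type are sums of squares\<close>

text \<open>
After diagonalisation only the sign $\delta$ of the last square is open. For $\delta = -1$ the form is
split: with $a^2+b^2=-1$, four squares are $x^2 - p^2 + y^2 - r^2$ for suitable linear forms $p, r$ in
$z, w$, which is a sum of two products; and the two remaining coordinates contribute
$x^2 - y^2 = (x-y)(x+y)$. The map \<open>T\<close> in the proof collects these factors.
\<close>

lemma minus_type_sum_of_squares:
  fixes Q :: "'k::{field,finite} vec \<Rightarrow> 'k"
  assumes q: "CARD('k) mod 4 = 3" and minus: "minus_type (4 * m + 2) Q"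
  shows "\<exists>P\<in>carrier_mat (4 * m + 2) (4 * m + 2). \<exists>P'\<in>carrier_mat (4 * m + 2) (4 * m + 2).
    P * P' = 1\<^sub>m (4 * m + 2) \<and> P' * P = 1\<^sub>m (4 * m + 2) \<and>
    (\<forall>v\<in>carrier_vec (4 * m + 2). Q (P *\<^sub>v v) = (\<Sum>i<4 * m + 2. (v $ i)\<^sup>2))"
proof -
  let ?n = "4 * m + 2"
  have "odd CARD('k)" using q by presburger
  then have two: "(2::'k) \<noteq> 0" by (rule two_nonzero_of_odd_card)
  interpret quadratic_space ?n Q
    using minus two by unfold_locales (auto simp: minus_type_def)
  obtain P P' \<delta> where P: "P \<in> carrier_mat ?n ?n" "P' \<in> carrier_mat ?n ?n"
      "P * P' = 1\<^sub>m ?n" "P' * P = 1\<^sub>m ?n" and \<delta>: "\<delta> = 1 \<or> \<delta> = - 1"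
    and QP: "\<And>v. v \<in> V \<Longrightarrow> Q (P *\<^sub>v v) = (\<Sum>i<?n - 1. (v $ i)\<^sup>2) + \<delta> * (v $ (?n - 1))\<^sup>2"
    using ex_diagonalising_matrix[OF q] by auto
  have "\<delta> = 1"
  proof (rule ccontr)
    assume "\<delta> \<noteq> 1"
    then have \<delta>': "\<delta> = - 1" using \<delta> by simp
    obtain a b :: 'k where ab: "a\<^sup>2 + b\<^sup>2 = - 1"
      using binary_form_universal[of 1 1 "- 1 :: 'k"] by auto
    define T :: "(nat \<Rightarrow> 'k) \<Rightarrow> nat \<Rightarrow> 'k" where
      "T v i = (if i < 4 * m then
          (let j = i - i mod 4; p = a * v (j + 2) - b * v (j + 3); r = b * v (j + 2) + a * v (j + 3) in
           if i mod 4 = 0 then v j - p else if i mod 4 = 1 then v j + p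
           else if i mod 4 = 2 then v (j + 1) - r else v (j + 1) + r)
        else if i = 4 * m then v (4 * m) - v (4 * m + 1)
        else if i = 4 * m + 1 then v (4 * m) + v (4 * m + 1) else v i)" for v i
    have T_add: "T (u + v) = T u + T v" for u v by (auto simp: fun_eq_iff T_def Let_def algebra_simps)
    have T_smul: "T (smul c v) = smul c (T v)" for c v by (auto simp: fun_eq_iff T_def Let_def algebra_simps)
    have T_tail: "T v i = 0" if v: "\<And>j. j < ?n \<Longrightarrow> v j = 0" and i: "i < ?n" for v i
    proof -
      have "v (i - i mod 4 + 3) = 0" if "i < 4 * m"
      proof -
        have "i - i mod 4 + 3 < ?n" using that by presburger
        then show ?thesis by (rule v)
      qed
      then show ?thesis using i by (auto simp: T_def Let_def v)
    qed
    have T_sum: "(\<Sum>i<2 * k. T v (2 * i) * T v (2 * i + 1)) = (\<Sum>i<4 * k. (v i)\<^sup>2)" if "k \<le> m" for k v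
      using that
    proof (induction k)
      case (Suc k)
      define x y z w where xyzw: "x = v (4 * k)" "y = v (4 * k + 1)" "z = v (4 * k + 2)" "w = v (4 * k + 3)"
      have ms: "4 * k mod 4 = 0" "(4 * k + 1) mod 4 = 1" "(4 * k + 2) mod 4 = 2" "(4 * k + 3) mod 4 = 3"
        by presburger+
      have T4: "T v (4 * k) = x - (a * z - b * w)" "T v (4 * k + 1) = x + (a * z - b * w)"
        "T v (4 * k + 2) = y - (b * z + a * w)" "T v (4 * k + 3) = y + (b * z + a * w)"
        using Suc.prems unfolding T_def Let_def ms xyzw by simp_all
      have "T v (4 * k) * T v (4 * k + 1) + T v (4 * k + 2) * T v (4 * k + 3)
          = x\<^sup>2 + y\<^sup>2 - (a\<^sup>2 + b\<^sup>2) * (z\<^sup>2 + w\<^sup>2)"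
        unfolding T4 by (simp add: algebra_simps power2_eq_square)
      also have "\<dots> = x\<^sup>2 + y\<^sup>2 + z\<^sup>2 + w\<^sup>2" by (simp add: ab)
      finally have step: "T v (4 * k) * T v (4 * k + 1) + T v (4 * k + 2) * T v (4 * k + 3)
          = x\<^sup>2 + y\<^sup>2 + z\<^sup>2 + w\<^sup>2" .
      have "2 * Suc k = Suc (Suc (2 * k))" by simp
      then have s1: "(\<Sum>i<2 * Suc k. T v (2 * i) * T v (2 * i + 1)) = (\<Sum>i<2 * k. T v (2 * i) * T v (2 * i + 1))
          + (T v (4 * k) * T v (4 * k + 1) + T v (4 * k + 2) * T v (4 * k + 3))"
        by (simp add: add.assoc numeral_3_eq_3)
      have "4 * Suc k = Suc (Suc (Suc (Suc (4 * k))))" by simp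
      then have s2: "(\<Sum>i<4 * Suc k. (v i)\<^sup>2) = (\<Sum>i<4 * k. (v i)\<^sup>2) + (x\<^sup>2 + y\<^sup>2 + z\<^sup>2 + w\<^sup>2)"
        unfolding xyzw by (simp only: sum.lessThan_Suc) (simp add: numeral_3_eq_3)
      show ?case by (simp only: s1 s2 step Suc.IH[OF Suc_leD[OF Suc.prems]])
    qed simp
    define A where "A = mat_of ?n T * P'"
    have A: "A \<in> carrier_mat ?n ?n"
      unfolding A_def by (rule mult_carrier_mat[OF mat_of_carrier P(2)])
    have split: "split_form ?n (A *\<^sub>v x) = Q x" if x: "x \<in> V" for x
    proof -
      define v where "v = (\<lambda>i. (P' *\<^sub>v x) $ i)"
      have v: "vec ?n v = P' *\<^sub>v x" using P by (intro eq_vecI) (auto simp: v_def)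
      have "A *\<^sub>v x = mat_of ?n T *\<^sub>v vec ?n v"
        unfolding v A_def by (rule assoc_mult_mat_vec[OF mat_of_carrier P(2) x])
      also have "\<dots> = vec ?n (T v)" by (intro mat_of_mult_vec T_add T_smul T_tail)
      finally have "split_form ?n (A *\<^sub>v x) = (\<Sum>i<2 * m + 1. vec ?n (T v) $ (2 * i) * vec ?n (T v) $ (2 * i + 1))"
        by (simp add: split_form_def)
      also have "\<dots> = (\<Sum>i<2 * m + 1. T v (2 * i) * T v (2 * i + 1))"
        by (intro sum.cong refl) simp
      also have "\<dots> = (\<Sum>i<2 * m. T v (2 * i) * T v (2 * i + 1)) + T v (4 * m) * T v (4 * m + 1)"
        by simp
      also have "\<dots> = (\<Sum>i<4 * m. (v i)\<^sup>2) + (v (4 * m) - v (4 * m + 1)) * (v (4 * m) + v (4 * m + 1))"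
        unfolding T_sum[OF order_refl] by (simp add: T_def)
      also have "\<dots> = (\<Sum>i<4 * m. (v i)\<^sup>2) + (v (4 * m))\<^sup>2 + \<delta> * (v (4 * m + 1))\<^sup>2"
        unfolding \<delta>' by (simp add: algebra_simps power2_eq_square)
      also have "\<dots> = (\<Sum>i<?n - 1. ((P' *\<^sub>v x) $ i)\<^sup>2) + \<delta> * ((P' *\<^sub>v x) $ (?n - 1))\<^sup>2"
        by (simp add: v_def)
      also have "\<dots> = Q (P *\<^sub>v (P' *\<^sub>v x))" using P x by (intro QP[symmetric]) simp
      also have "P *\<^sub>v (P' *\<^sub>v x) = x" using P x by (simp flip: assoc_mult_mat_vec)
      finally show ?thesis .
    qed
    have "\<exists>B\<in>carrier_mat ?n ?n. A * B = 1\<^sub>m ?n \<and> B * A = 1\<^sub>m ?n"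
    proof (rule ex_inverse_of_trivial_kernel[OF A])
      fix u :: "'k vec" assume u: "u \<in> V" and 0: "A *\<^sub>v u = 0\<^sub>v ?n"
      show "u = 0\<^sub>v ?n"
      proof (rule nondegD[OF u])
        fix w assume w: "w \<in> V"
        have "Q u = 0" using split[OF u] unfolding 0 by (simp add: split_form_def)
        moreover have "A *\<^sub>v (u + w) = A *\<^sub>v w"
          using A u w 0 by (simp add: mult_add_distrib_mat_vec[OF A u w])
        then have "Q (u + w) = Q w" using split[of "u + w"] split[OF w] u w by simp
        ultimately show "B u w = 0" by (simp add: assoc_form_def)
      qed
    qed
    then have "equivalent_forms ?n Q (split_form ?n)"
      using A split unfolding equivalent_forms_def by (blast intro: invertible_matI)
    then show False using minus by (simp add: minus_type_def)
  qed
  then show ?thesis using P QP by (intro bexI[of _ P] bexI[of _ P']) auto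
qed

section \<open>Elements of the derived group\<close>

definition derived_isometries :: "nat \<Rightarrow> ((nat \<Rightarrow> 'k::field) \<Rightarrow> nat \<Rightarrow> 'k) set" where
  "derived_isometries n = derived (isometry_group n) (carrier (isometry_group n))"

lemma isometry_group_simps [simp]:
  "carrier (isometry_group n) = {f. isometry n f}"
  "f \<otimes>\<^bsub>isometry_group n\<^esub> g = f \<circ> g"
  "\<one>\<^bsub>isometry_group n\<^esub> = id"
  by (simp_all add: isometry_group_def)

lemma isometry_group_inv: 
  assumes "isometry n f" shows "inv\<^bsub>isometry_group n\<^esub> f = inv_into UNIV f"
proof (rule group.inv_equality[OF isometry_group_is_group])
  show "inv_into UNIV f \<otimes>\<^bsub>isometry_group n\<^esub> f = \<one>\<^bsub>isometry_group n\<^esub>"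
    using isometry_bij[OF assms] by (simp add: bij_is_inj)
qed (use assms isometry_inv in auto)

lemma subgroup_derived_isometries: "subgroup (derived_isometries n) (isometry_group n)"
  unfolding derived_isometries_def by (rule group.derived_is_subgroup[OF isometry_group_is_group]) simp

lemma derived_isometry: "f \<in> derived_isometries n \<Longrightarrow> isometry n f"
  using subgroup.subset[OF subgroup_derived_isometries] by auto

lemma derived_comp: "f \<in> derived_isometries n \<Longrightarrow> g \<in> derived_isometries n \<Longrightarrow> f \<circ> g \<in> derived_isometries n"
  using subgroup.m_closed[OF subgroup_derived_isometries] by fastforce

lemma derived_id: "id \<in> derived_isometries n"
  using subgroup.one_closed[OF subgroup_derived_isometries] by simp

lemma derived_commutator:
  assumes f: "isometry n f" and g: "isometry n g" and x: "f \<circ> g = x \<circ> (g \<circ> f)"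
  shows "x \<in> derived_isometries n"
proof -
  interpret group "isometry_group n" by (rule isometry_group_is_group)
  have bij: "bij (g \<circ> f)" using f g by (auto intro: bij_comp dest: isometry_bij)
  have "g \<circ> f \<circ> inv_into UNIV (g \<circ> f) = id"
    using bij_is_surj[OF bij] surj_iff by blast
  then have "x = f \<circ> g \<circ> inv_into UNIV (g \<circ> f)"
    unfolding x comp_assoc[of x] by simp
  also have "inv_into UNIV (g \<circ> f) = inv_into UNIV f \<circ> inv_into UNIV g"
    using isometry_bij[OF f] isometry_bij[OF g] by (rule o_inv_distrib[rotated])
  finally have "x = f \<otimes>\<^bsub>isometry_group n\<^esub> g \<otimes>\<^bsub>isometry_group n\<^esub> inv\<^bsub>isometry_group n\<^esub> f
      \<otimes>\<^bsub>isometry_group n\<^esub> inv\<^bsub>isometry_group n\<^esub> g"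
    by (simp only: isometry_group_simps isometry_group_inv[OF f] isometry_group_inv[OF g] comp_assoc)
  then have "x \<in> derived_set (isometry_group n) (carrier (isometry_group n))" using f g by auto
  then show ?thesis unfolding derived_isometries_def derived_def by (rule generate.incl)
qed

definition rot :: "nat \<Rightarrow> nat \<Rightarrow> 'k::field \<Rightarrow> 'k \<Rightarrow> (nat \<Rightarrow> 'k) \<Rightarrow> nat \<Rightarrow> 'k" where
  "rot a b c d v = v(a := c * v a - d * v b, b := d * v a + c * v b)"

lemma dot_split_pair:
  assumes "a < n" "b < n" "a \<noteq> b"
  shows "dot n u v = u a * v a + u b * v b + (\<Sum>i\<in>{..<n} - {a, b}. u i * v i)"
proof -
  have "dot n u v = u a * v a + (\<Sum>i\<in>{..<n} - {a}. u i * v i)"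
    unfolding dot_def using assms by (intro sum.remove) auto
  also have "(\<Sum>i\<in>{..<n} - {a}. u i * v i) = u b * v b + (\<Sum>i\<in>{..<n} - {a} - {b}. u i * v i)"
    using assms by (intro sum.remove) auto
  also have "{..<n} - {a} - {b} = {..<n} - {a, b}" by auto
  finally show ?thesis by simp
qed

lemma rot_inverse:
  assumes "a \<noteq> b" "c\<^sup>2 + d\<^sup>2 = 1"
  shows "rot a b c d \<circ> rot b a c d = id"
proof -
  have "c * (d * y + c * x) - d * (c * y - d * x) = (c\<^sup>2 + d\<^sup>2) * x"
    "d * (d * y + c * x) + c * (c * y - d * x) = (c\<^sup>2 + d\<^sup>2) * y" for x y
    by (simp_all add: algebra_simps power2_eq_square)
  then show ?thesis using assms by (auto simp: fun_eq_iff rot_def)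
qed

lemma isometry_rot:
  assumes ab: "a < n" "b < n" "a \<noteq> b" and cd: "c\<^sup>2 + d\<^sup>2 = 1"
  shows "isometry n (rot a b c d)"
proof -
  have "bij (rot a b c d)" using rot_inverse[of a b c d] rot_inverse[of b a c d] ab cd
    by (intro o_bij[of "rot b a c d"]) auto
  moreover have "dot n (rot a b c d u) (rot a b c d v) = dot n u v" for u v
  proof -
    have "(c * u a - d * u b) * (c * v a - d * v b) + (d * u a + c * u b) * (d * v a + c * v b)
        = (c\<^sup>2 + d\<^sup>2) * (u a * v a + u b * v b)"
      by (simp add: algebra_simps power2_eq_square)
    moreover have "(\<Sum>i\<in>{..<n} - {a, b}. rot a b c d u i * rot a b c d v i) = (\<Sum>i\<in>{..<n} - {a, b}. u i * v i)"
      by (intro sum.cong) (auto simp: rot_def)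
    ultimately show ?thesis using ab cd
      by (simp add: dot_split_pair[OF ab] rot_def del: fun_upd_apply) (simp add: rot_def)
  qed
  ultimately show ?thesis
    using ab unfolding isometry_def by (auto simp: rot_def fun_eq_iff algebra_simps)
qed

lemma isometry_permute:
  assumes p: "p permutes {..<n}" shows "isometry n (\<lambda>v. v \<circ> p :: nat \<Rightarrow> 'k::field)"
proof -
  have "bij (\<lambda>v. v \<circ> p :: nat \<Rightarrow> 'k)"
    using permutes_inv_o[OF p] by (intro o_bij[of "\<lambda>v. v \<circ> inv_into UNIV p"]) (auto simp: fun_eq_iff comp_assoc)
  moreover have "dot n (u \<circ> p) (v \<circ> p) = dot n u v" for u v :: "nat \<Rightarrow> 'k"
    unfolding dot_def using sum.permute[OF p, of "\<lambda>i. u i * v i"] by (simp add: comp_def)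
  moreover have "p i = i" if "n \<le> i" for i using permutes_not_in[OF p] that by simp
  moreover have "p i < n" if "i < n" for i using permutes_in_image[OF p, of i] that by simp
  ultimately show ?thesis
    unfolding isometry_def by (auto simp: fun_eq_iff) (metis not_le)
qed

lemma rot_conj_permute:
  assumes "inj p" "p a = x" "p b = y" "a \<noteq> b"
  shows "(\<lambda>v. v \<circ> p) \<circ> rot x y c d = rot a b c d \<circ> (\<lambda>v. v \<circ> p)"
proof -
  have "p i = x \<longleftrightarrow> i = a" "p i = y \<longleftrightarrow> i = b" for i using assms by (auto dest: injD)
  then show ?thesis using assms(4) by (auto simp: fun_eq_iff rot_def assms(2,3))
qed

text \<open>
Reversing the order of the two coordinates inverts a rotation, and all coordinate planes with an order
are permuted transitively by permutations of coordinates. So the second rotation is conjugate to the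
inverse of the first, and the product is a commutator.
\<close>

lemma rot_pair_derived:
  assumes ab: "a < n" "b < n" "a \<noteq> b" and ab': "a' < n" "b' < n" "a' \<noteq> b'" and cd: "c\<^sup>2 + d\<^sup>2 = 1"
  shows "rot a b c d \<circ> rot a' b' c d \<in> derived_isometries n"
proof -
  \<comment> \<open>\<open>p\<close> maps \<open>a\'\<close> to \<open>b\<close> and \<open>b\'\<close> to \<open>a\<close>\<close>
  define p where "p = transpose (transpose a' b b') a \<circ> transpose a' b"
  have y: "transpose a' b b' < n" "transpose a' b b' \<noteq> b"
    using ab ab' by (auto simp: transpose_def)
  have p: "p permutes {..<n}"
    unfolding p_def using ab ab' y by (intro permutes_compose permutes_swap_id) auto
  have "p a' = b" "p b' = a" using y ab by (auto simp: p_def transpose_def)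
  then have conj: "(\<lambda>v. v \<circ> p) \<circ> rot b a c d = rot a' b' c d \<circ> (\<lambda>v. v \<circ> p)"
    using permutes_inj[OF p] ab by (intro rot_conj_permute) auto
  have "rot a b c d \<circ> rot a' b' c d \<circ> ((\<lambda>v. v \<circ> p) \<circ> rot a b c d)
      = rot a b c d \<circ> (rot a' b' c d \<circ> (\<lambda>v. v \<circ> p)) \<circ> rot a b c d" by (simp only: comp_assoc)
  also have "\<dots> = rot a b c d \<circ> (\<lambda>v. v \<circ> p) \<circ> (rot b a c d \<circ> rot a b c d)"
    unfolding conj[symmetric] by (simp only: comp_assoc)
  also have "\<dots> = rot a b c d \<circ> (\<lambda>v. v \<circ> p)" using rot_inverse[of b a c d] ab cd by simp
  finally show ?thesis
    using isometry_rot[OF ab cd] isometry_permute[OF p]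
    by (intro derived_commutator[where f = "rot a b c d" and g = "\<lambda>v. v \<circ> p"]) (simp_all add: comp_assoc)
qed

definition neg :: "nat \<Rightarrow> (nat \<Rightarrow> 'k::field) \<Rightarrow> nat \<Rightarrow> 'k" where
  "neg n v = (\<lambda>i. if i < n then - v i else v i)"

lemma neg_derived:
  "2 * k \<le> n \<Longrightarrow> (neg (2 * k) :: (nat \<Rightarrow> 'k::field) \<Rightarrow> _) \<in> derived_isometries n"
proof (induction k)
  case 0
  have "neg (2 * 0) = (id :: (nat \<Rightarrow> 'k) \<Rightarrow> _)" by (simp add: neg_def fun_eq_iff)
  then show ?case using derived_id by (simp only:)
next
  case (Suc k)
  have "neg (2 * Suc k) = (neg (2 * k) :: (nat \<Rightarrow> 'k) \<Rightarrow> _) \<circ> (rot (2 * k) (2 * k + 1) 0 1 \<circ> rot (2 * k) (2 * k + 1) 0 1)"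
    by (auto simp: fun_eq_iff neg_def rot_def less_Suc_eq)
  moreover have "(neg (2 * k) :: (nat \<Rightarrow> 'k) \<Rightarrow> _) \<in> derived_isometries n" using Suc by simp
  moreover have "(rot (2 * k) (2 * k + 1) 0 1 \<circ> rot (2 * k) (2 * k + 1) 0 1 :: (nat \<Rightarrow> 'k) \<Rightarrow> _) \<in> derived_isometries n"
    using Suc.prems by (intro rot_pair_derived) auto
  ultimately show ?case by (simp only: derived_comp)
qed

text \<open>
The complex structure that sends the basis vector $\varepsilon_{2j}$ to $\varepsilon_{2j+1}$ and
$\varepsilon_{2j+1}$ to $-\varepsilon_{2j}$, restricted to the first $l$ of these pairs.
\<close>

definition cplx :: "nat \<Rightarrow> (nat \<Rightarrow> 'k::field) \<Rightarrow> nat \<Rightarrow> 'k" where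
  "cplx l v = (\<lambda>i. if i < 2 * l then if even i then - v (Suc i) else v (i - 1) else v i)"

lemma cplx_Suc: "cplx (Suc l) = cplx l \<circ> rot (2 * l) (2 * l + 1) 0 1"
proof (intro ext)
  fix v :: "nat \<Rightarrow> 'a" and i
  have "Suc i < 2 * l" if "i < 2 * l" "even i" using that by presburger
  moreover have "i - 1 < 2 * l" if "i < 2 * l" using that by simp
  ultimately show "cplx (Suc l) v i = (cplx l \<circ> rot (2 * l) (2 * l + 1) 0 1) v i"
    by (auto simp: cplx_def rot_def less_Suc_eq)
qed

lemma cplx_even_derived:
  "4 * k \<le> n \<Longrightarrow> (cplx (2 * k) :: (nat \<Rightarrow> 'k::field) \<Rightarrow> _) \<in> derived_isometries n"
proof (induction k)
  case 0
  have "cplx (2 * 0) = (id :: (nat \<Rightarrow> 'k) \<Rightarrow> _)" by (simp add: cplx_def fun_eq_iff)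
  then show ?case using derived_id by (simp only:)
next
  case (Suc k)
  have "cplx (2 * Suc k) = (cplx (2 * k) :: (nat \<Rightarrow> 'k) \<Rightarrow> _) \<circ>
      (rot (4 * k) (4 * k + 1) 0 1 \<circ> rot (4 * k + 2) (4 * k + 3) 0 1)"
    by (simp add: cplx_Suc comp_assoc numeral_3_eq_3)
  moreover have "(cplx (2 * k) :: (nat \<Rightarrow> 'k) \<Rightarrow> _) \<in> derived_isometries n" using Suc by simp
  moreover have "(rot (4 * k) (4 * k + 1) 0 1 \<circ> rot (4 * k + 2) (4 * k + 3) 0 1 :: (nat \<Rightarrow> 'k) \<Rightarrow> _) \<in> derived_isometries n"
    using Suc.prems by (intro rot_pair_derived) auto
  ultimately show ?case by (simp only: derived_comp)
qed

section \<open>Involutions in the derived group\<close>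

lemma involution_sign:
  assumes "p permutes Y" "finite Y" "p \<circ> p = id"
  shows "\<exists>k. card {y. p y \<noteq> y} = 2 * k \<and> sign p = (- 1) ^ k"
  using assms
proof (induction "card {y. p y \<noteq> y}" arbitrary: p rule: less_induct)
  case less
  note p = less.prems(1) and Y = less.prems(2) and pp = less.prems(3)
  have ppx: "p (p x) = x" for x using pp by (metis comp_apply id_apply)
  have sub: "{y. p y \<noteq> y} \<subseteq> Y" using permutes_not_in[OF p] by blast
  have fin: "finite {y. p y \<noteq> y}" by (rule finite_subset[OF sub Y])
  show ?case
  proof (cases "\<exists>y. p y \<noteq> y")
    case False
    then have "p = id" by (auto simp: fun_eq_iff)
    then show ?thesis by (intro exI[of _ 0]) simp
  next
    case True
    then obtain y where y: "p y \<noteq> y" by blast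
    define q where "q = p \<circ> transpose y (p y)"
    have q_app: "q x = (if x = y \<or> x = p y then x else p x)" for x
      using ppx by (auto simp: q_def transpose_def)
    have yY: "y \<in> Y" "p y \<in> Y" using y ppx sub by auto
    have q: "q permutes Y" unfolding q_def using p yY by (intro permutes_compose permutes_swap_id) auto
    have qq: "q \<circ> q = id" using ppx by (auto simp: fun_eq_iff q_app) metis+
    have "{x. q x \<noteq> x} = {x. p x \<noteq> x} - {y, p y}" by (auto simp: q_app)
    moreover have "{y, p y} \<subseteq> {x. p x \<noteq> x}" using y ppx by auto
    ultimately have card: "card {x. p x \<noteq> x} = card {x. q x \<noteq> x} + 2"
      using fin y card_mono[OF fin, of "{y, p y}"] by (simp add: card_Diff_subset)
    obtain k where k: "card {x. q x \<noteq> x} = 2 * k" "sign q = (- 1) ^ k"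
      using less.hyps[of q] card q Y qq by auto
    have "sign q = sign p * sign (transpose y (p y))"
      unfolding q_def using p Y
      by (intro sign_compose) (auto intro: permutation_permutes[THEN iffD2] permutation_swap_id)
    then have "sign p = (- 1) ^ Suc k" using k y by (simp add: sign_swap_id)
    then show ?thesis using card k by (intro exI[of _ "Suc k"]) simp
  qed
qed

text \<open>
The sign of the permutation induced on $Y$ is a homomorphism to $\{1,-1\}$ and therefore trivial on
commutators. An involution with $2k$ moved points has sign $(-1)^k$.
\<close>

lemma derived_involution_moved_card:
  fixes s :: "(nat \<Rightarrow> 'k::field) \<Rightarrow> nat \<Rightarrow> 'k"
  assumes s: "s \<in> derived_isometries n" and ss: "s \<circ> s = id"
    and Y: "finite Y" and inv: "\<And>f y. isometry n f \<Longrightarrow> y \<in> Y \<Longrightarrow> f y \<in> Y"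
  shows "4 dvd card {y \<in> Y. s y \<noteq> y}"
proof -
  define r where "r f = restrict_id f Y" for f :: "(nat \<Rightarrow> 'k) \<Rightarrow> nat \<Rightarrow> 'k"
  have r_app: "r f y = (if y \<in> Y then f y else y)" for f y by (simp add: r_def restrict_id_def)
  have perm: "r f permutes Y" if f: "isometry n f" for f
  proof (rule bij_imp_permutes)
    have "inj_on f Y" using isometry_inj[OF f] by (auto simp: inj_on_def)
    moreover have "f ` Y \<subseteq> Y" using inv[OF f] by blast
    ultimately have "bij_betw f Y Y" using Y by (simp add: bij_betw_def endo_inj_surj)
    then show "bij_betw (r f) Y Y" by (subst bij_betw_cong[of _ _ f]) (auto simp: r_app)
  qed (simp add: r_app)
  have permutation: "permutation (r f)" if "isometry n f" for f
    using perm[OF that] Y by (auto simp: permutation_permutes)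
  have r_comp: "r (f \<circ> g) = r f \<circ> r g" if "isometry n g" for f g
    using inv[OF that] by (auto simp: fun_eq_iff r_app)
  have sign_comp: "sign (r (f \<circ> g)) = sign (r f) * sign (r g)" if "isometry n f" "isometry n g" for f g
    using that by (simp add: r_comp sign_compose permutation)
  have sign_inv: "sign (r (inv_into UNIV f)) = sign (r f)" if f: "isometry n f" for f
  proof -
    have "f \<circ> inv_into UNIV f = id" using isometry_bij[OF f] by (simp add: bij_is_surj surj_iff[symmetric])
    then have "sign (r f) * sign (r (inv_into UNIV f)) = sign (r id)"
      using sign_comp[OF f isometry_inv[OF f]] by simp
    moreover have "r id = id" by (simp add: fun_eq_iff r_app)
    ultimately show ?thesis by (cases "r f" rule: sign_cases) auto
  qed
  have "sign (r f) = 1 \<and> isometry n f" if "f \<in> derived_isometries n" for f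
    using that unfolding derived_isometries_def derived_def
  proof (induction rule: generate.induct)
    case one
    have "r id = id" by (simp add: fun_eq_iff r_app)
    then show ?case by (simp only: isometry_group_simps sign_id isometry_id simp_thms)
  next
    case (incl h)
    then obtain f g where fg: "isometry n f" "isometry n g"
      and h: "h = f \<circ> g \<circ> inv_into UNIV f \<circ> inv_into UNIV g"
      by (auto simp only: isometry_group_inv isometry_group_simps mem_Collect_eq UN_iff insert_iff empty_iff)
    have "isometry n h" unfolding h by (intro isometry_comp isometry_inv fg)
    moreover have "sign (r h) = 1" unfolding h
      by (simp only: sign_comp sign_inv isometry_comp isometry_inv fg)
        (cases "r f" rule: sign_cases; cases "r g" rule: sign_cases; simp)
    ultimately show ?case by simp
  next
    case (inv h)
    then obtain f g where fg: "isometry n f" "isometry n g"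
      and h: "h = f \<circ> g \<circ> inv_into UNIV f \<circ> inv_into UNIV g"
      by (auto simp only: isometry_group_inv isometry_group_simps mem_Collect_eq UN_iff insert_iff empty_iff)
    have hi: "isometry n h" unfolding h by (intro isometry_comp isometry_inv fg)
    moreover have "sign (r h) = 1" unfolding h
      by (simp only: sign_comp sign_inv isometry_comp isometry_inv fg)
        (cases "r f" rule: sign_cases; cases "r g" rule: sign_cases; simp)
    ultimately show ?case by (simp only: isometry_group_inv sign_inv isometry_inv simp_thms)
  next
    case (eng h1 h2)
    then show ?case by (simp only: isometry_group_simps sign_comp isometry_comp simp_thms mult_1)
  qed
  then have sgn: "sign (r s) = 1" and si: "isometry n s" using s by auto
  have "r id = id" by (rule ext) (simp add: r_app)
  then have "r s \<circ> r s = id" using r_comp[OF si, of s] unfolding ss by simp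
  then obtain k where k: "card {y. r s y \<noteq> y} = 2 * k" "sign (r s) = (- 1) ^ k"
    using involution_sign[OF perm[OF si] Y] by blast
  have "even k" using k sgn by (cases "even k") auto
  moreover have "{y. r s y \<noteq> y} = {y \<in> Y. s y \<noteq> y}" by (auto simp: r_app)
  ultimately show ?thesis using k by (auto elim!: evenE)
qed

section \<open>The centre of the derived group\<close>

lemma dot_unit: "a < n \<Longrightarrow> dot n v (\<lambda>i. if i = a then 1 else 0) = v a"
  by (simp add: dot_def if_distrib[of "\<lambda>x. _ * x"] cong: if_cong)

text \<open>
The derived group contains the squares of the quarter turns, which negate just two coordinates.
Commuting with all of them forces a map to be diagonal, and commuting with products of two quarter
turns forces its diagonal entries to agree.
\<close>

lemma center_derived_isometries:
  fixes z :: "(nat \<Rightarrow> 'k::field) \<Rightarrow> nat \<Rightarrow> 'k"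
  assumes z: "z \<in> group_center ((isometry_group n)\<lparr>carrier := derived_isometries n\<rparr>)"
    and n: "3 \<le> n" and two: "(2::'k) \<noteq> 0"
  shows "z = id \<or> z = neg n"
proof -
  have zD: "z \<in> derived_isometries n" and comm: "\<And>g. g \<in> derived_isometries n \<Longrightarrow> z \<circ> g = g \<circ> z"
    using z by (auto simp: group_center_def)
  note zi = derived_isometry[OF zD]
  define e where "e a = (\<lambda>i. if i = a then 1 else 0 :: 'k)" for a :: nat
  have e_app: "e a i = (if i = a then 1 else 0)" for a i by (simp add: e_def)
  have dot_e: "dot n v (e a) = v a" if "a < n" for a v using dot_unit[OF that] by (simp add: e_def)
  have zero: "z (e a) i = 0" if a: "a < n" and ia: "i \<noteq> a" for a i
  proof -
    have "\<exists>b\<in>{0, 1, 2}. b \<noteq> a \<and> b \<noteq> i"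
      by (cases "a = 0 \<or> i = 0"; cases "a = 1 \<or> i = 1") auto
    then obtain b where b': "b \<in> {0, 1, 2}" and b: "b \<noteq> a" "b \<noteq> i" by blast
    have bn: "b < n" using b' n by auto
    let ?g = "rot a b 0 1 \<circ> rot a b 0 1 :: (nat \<Rightarrow> 'k) \<Rightarrow> _"
    have "?g \<in> derived_isometries n" using a b bn by (intro rot_pair_derived) auto
    then have "z (?g (e a)) i = ?g (z (e a)) i" using comm by (metis comp_apply)
    moreover have "?g (e a) = - e a" using b by (auto simp: fun_eq_iff rot_def e_app)
    moreover have "?g w i = w i" for w using b ia by (simp add: rot_def)
    ultimately have "z (- e a) i = z (e a) i" by simp
    then have "z (e a) i - (- z (e a) i) = 0" unfolding isometry_minus[OF zi] by simp
    then have "2 * z (e a) i = 0" by (simp only: mult_2 diff_minus_eq_add)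
    then show ?thesis using two by simp
  qed
  define c where "c = z (e 0) 0"
  have ze: "z (e a) = smul c (e a)" if a: "a < n" for a
  proof -
    have scal: "z (e b) = smul (z (e b) b) (e b)" if "b < n" for b
    proof (rule ext)
      show "z (e b) i = smul (z (e b) b) (e b) i" for i
        using zero[OF that, of i] by (cases "i = b") (simp_all add: e_app)
    qed
    have "z (e a) a = c" if a0: "a \<noteq> 0"
    proof -
      obtain b :: nat where b: "b < n" "b \<noteq> a" "b \<noteq> 0"
        using n that[of 1] that[of 2] by (cases "a = 1") auto
      let ?g = "rot 0 a 0 1 \<circ> rot 0 b 0 1 :: (nat \<Rightarrow> 'k) \<Rightarrow> _"
      have "?g \<in> derived_isometries n" using a a0 b by (intro rot_pair_derived) auto
      then have "z (?g (e a)) 0 = ?g (z (e a)) 0" using comm by (metis comp_apply)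
      moreover have "?g (e a) = - e 0" using a0 b by (auto simp: fun_eq_iff rot_def e_app)
      ultimately have "- z (e 0) 0 = ?g (z (e a)) 0" by (simp add: isometry_minus[OF zi])
      also have "\<dots> = - z (e a) a" using a0 b by (simp add: rot_def)
      finally show ?thesis by (simp add: c_def)
    qed
    then have "z (e a) a = c" by (cases "a = 0") (simp_all add: c_def)
    then show ?thesis using scal[OF a] by simp
  qed
  have "dot n (e 0) (e 0) = 1" using n by (simp add: dot_e e_app)
  then have cc: "c * c = 1" using isometry_dot[OF zi, of "e 0" "e 0"] ze[of 0] n by (simp add: dot_smul)
  then have c: "c = 1 \<or> c = - 1" by (simp add: square_eq_1_iff)
  have zv: "z v i = c * v i" if i: "i < n" for v i
  proof -
    have "dot n (z v) (z (e i)) = dot n v (e i)" by (rule isometry_dot[OF zi])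
    then have "c * z v i = v i" using ze[OF i] i by (simp add: dot_smul dot_e)
    then have "c * c * z v i = c * v i" by (simp only: mult.assoc)
    then show ?thesis unfolding cc by simp
  qed
  from c show ?thesis
  proof
    assume c1: "c = 1"
    have "z v i = id v i" for v i
      using zv[of i v] isometry_ge[OF zi, of i v] by (cases "i < n") (simp_all add: c1)
    then have "z = id" by (intro ext)
    then show ?thesis ..
  next
    assume c1: "c = - 1"
    have "z v i = neg n v i" for v i
      using zv[of i v] isometry_ge[OF zi, of i v] by (cases "i < n") (simp_all add: c1 neg_def)
    then have "z = neg n" by (intro ext)
    then show ?thesis ..
  qed
qed

section \<open>A criterion for weak reality\<close>

definition vecs :: "nat \<Rightarrow> (nat \<Rightarrow> 'k::field) set" where
  "vecs n = {v. \<forall>i\<ge>n. v i = 0}"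

lemma isometry_vecs: "isometry n f \<Longrightarrow> v \<in> vecs n \<Longrightarrow> f v \<in> vecs n"
  by (simp add: vecs_def isometry_ge)

lemma neg_vecs: "v \<in> vecs n \<Longrightarrow> neg n v = - v"
  by (auto simp: vecs_def neg_def fun_eq_iff)

lemma eq_neg_imp_zero:
  assumes "x = - x" "(2::'k::field) \<noteq> 0" shows "x = (0::'k)"
proof -
  have "x + x = x + (- x)" using assms(1) by (rule arg_cong)
  then have "2 * x = 0" by (simp only: mult_2 add.right_inverse)
  then show ?thesis using assms(2) by simp
qed

lemma vecs_nonzero_dot:
  assumes u: "u \<in> vecs n" "u \<noteq> 0" shows "\<exists>w\<in>vecs n. dot n u w \<noteq> 0"
proof -
  obtain i where i: "u i \<noteq> 0" using u(2) by (auto simp: fun_eq_iff)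
  then have "i < n" using u(1) by (auto simp: vecs_def not_le[symmetric])
  then have "dot n u (\<lambda>j. if j = i then 1 else 0) \<noteq> 0" "(\<lambda>j. if j = i then 1 else 0) \<in> vecs n"
    using i by (auto simp: dot_unit vecs_def)
  then show ?thesis by blast
qed

lemma isometry_neg_commute: assumes f: "isometry n f" shows "f (neg n v) = neg n (f v)"
proof -
  define t where "t = (\<lambda>i. if i < n then 0 else v i)"
  have ft: "f t = t" by (rule isometry_tail[OF f]) (simp add: t_def)
  have "neg n v = (t - v) + t" by (auto simp: neg_def t_def fun_eq_iff)
  then have "f (neg n v) = (t - f v) + t" by (simp only: isometry_linear[OF f] ft)
  also have "\<dots> = neg n (f v)" by (auto simp: neg_def t_def fun_eq_iff isometry_ge[OF f])
  finally show ?thesis .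
qed

lemma neg_neg: "neg n (neg n v) = v"
  by (auto simp: neg_def)

text \<open>
Since $\pm 1$ are central, $hgh^{-1} = \varepsilon g^{-1}$ can be written without inverses as
$ghg = \varepsilon h$.
\<close>

lemma quotient_weakly_realI:
  fixes g h :: "(nat \<Rightarrow> 'k::field) \<Rightarrow> nat \<Rightarrow> 'k"
  assumes n: "3 \<le> n" "even n" and two: "(2::'k) \<noteq> 0"
    and g: "g \<in> derived_isometries n" and h: "h \<in> derived_isometries n"
    and \<epsilon>: "\<epsilon> \<in> {id, neg n}" and gh: "\<And>v. g (h (g v)) = \<epsilon> (h v)"
    and not: "\<And>s \<epsilon> \<eta>. s \<in> derived_isometries n \<Longrightarrow> \<epsilon> \<in> {id, neg n} \<Longrightarrow> \<eta> \<in> {id, neg n} \<Longrightarrow>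
      (\<And>v. s (s v) = \<epsilon> v) \<Longrightarrow> (\<And>v. g (s (g v)) = \<eta> (s v)) \<Longrightarrow> False"
  shows "quotient_weakly_real (isometry_group n :: ((nat \<Rightarrow> 'k) \<Rightarrow> nat \<Rightarrow> 'k) monoid)"
proof -
  let ?D = "derived_isometries n :: ((nat \<Rightarrow> 'k) \<Rightarrow> nat \<Rightarrow> 'k) set"
  let ?Z = "group_center ((isometry_group n)\<lparr>carrier := ?D\<rparr>)"
  have Z: "z \<in> {id, neg n}" if "z \<in> ?Z" for z
    using center_derived_isometries[OF that n(1) two] by simp
  have negD: "neg n \<in> ?D" using neg_derived[of "n div 2" n] n(2) by simp
  have Z': "z \<in> ?Z" if z: "z \<in> {id, neg n}" for z
  proof -
    have "z \<circ> f = f \<circ> z" if "f \<in> ?D" for f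
    proof (rule ext)
      show "(z \<circ> f) v = (f \<circ> z) v" for v
        using z isometry_neg_commute[OF derived_isometry[OF that], of v] by auto
    qed
    moreover have "z \<in> ?D" using z negD derived_id by auto
    ultimately show ?thesis by (simp add: group_center_def)
  qed
  have conj: "h \<circ> g \<circ> inv_into UNIV h \<circ> g = \<eta> \<longleftrightarrow> (\<forall>v. g (h (g v)) = \<eta> (h v))"
    if h: "h \<in> ?D" and \<eta>: "\<eta> \<in> {id, neg n}" for h \<eta>
  proof -
    note gi = derived_isometry[OF g] and hi = derived_isometry[OF h]
    have gg: "g (inv_into UNIV g v) = v" "inv_into UNIV g (g v) = v" for v
      using isometry_bij[OF gi] by (simp_all add: bij_is_surj surj_f_inv_f bij_is_inj)
    have hh: "h (inv_into UNIV h v) = v" "inv_into UNIV h (h v) = v" for v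
      using isometry_bij[OF hi] by (simp_all add: bij_is_surj surj_f_inv_f bij_is_inj)
    have \<eta>g: "g (\<eta> v) = \<eta> (g v)" for v using \<eta> isometry_neg_commute[OF gi] by auto
    have "h \<circ> g \<circ> inv_into UNIV h \<circ> g = \<eta> \<longleftrightarrow> (\<forall>v. h (g (inv_into UNIV h (g v))) = \<eta> v)"
      by (simp add: fun_eq_iff)
    also have "\<dots> \<longleftrightarrow> (\<forall>v. h (g v) = \<eta> (inv_into UNIV g (h v)))"
      by (metis gg hh)
    also have "\<dots> \<longleftrightarrow> (\<forall>v. g (h (g v)) = \<eta> (h v))"
      by (metis gg \<eta>g)
    finally show ?thesis .
  qed
  have inv: "inv\<^bsub>isometry_group n\<^esub> f = inv_into UNIV f" if "f \<in> ?D" for f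
    by (rule isometry_group_inv[OF derived_isometry[OF that]])
  have "h \<circ> g \<circ> inv_into UNIV h \<circ> g = \<epsilon>" using conj[OF h \<epsilon>] gh by blast
  then have real: "h \<circ> g \<circ> inv_into UNIV h \<circ> g \<in> ?Z" using Z'[OF \<epsilon>] by simp
  have "s \<circ> g \<circ> inv_into UNIV s \<circ> g \<notin> ?Z" if s: "s \<in> ?D" "s \<circ> s \<in> ?Z" for s
  proof
    assume "s \<circ> g \<circ> inv_into UNIV s \<circ> g \<in> ?Z"
    from Z[OF this] conj[OF s(1)] have "\<And>v. g (s (g v)) = (s \<circ> g \<circ> inv_into UNIV s \<circ> g) (s v)" by blast
    moreover have "s (s v) = (s \<circ> s) v" for v by simp
    ultimately show False using not[OF s(1) Z[OF s(2)] Z[OF \<open>s \<circ> g \<circ> inv_into UNIV s \<circ> g \<in> ?Z\<close>]] by blast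
  qed
  then have "s \<circ> g \<circ> inv\<^bsub>isometry_group n\<^esub> s \<circ> g \<notin> ?Z" if "s \<in> ?D" "s \<circ> s \<in> ?Z" for s
    unfolding inv[OF that(1)] using that by blast
  moreover have "h \<circ> g \<circ> inv\<^bsub>isometry_group n\<^esub> h \<circ> g \<in> ?Z"
    unfolding inv[OF h] by (rule real)
  ultimately have "\<exists>g\<in>?D. (\<exists>h\<in>?D. h \<circ> g \<circ> inv\<^bsub>isometry_group n\<^esub> h \<circ> g \<in> ?Z) \<and>
      (\<forall>s\<in>?D. s \<circ> s \<in> ?Z \<longrightarrow> s \<circ> g \<circ> inv\<^bsub>isometry_group n\<^esub> s \<circ> g \<notin> ?Z)"
    using g h by blast
  then show ?thesis
    unfolding quotient_weakly_real_def Let_def derived_isometries_def[symmetric]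
    unfolding isometry_group_simps .
qed

section \<open>Eigenspaces of involutions\<close>

definition lin_subspace :: "nat \<Rightarrow> (nat \<Rightarrow> 'k::field) set \<Rightarrow> bool" where
  "lin_subspace n S \<longleftrightarrow> S \<subseteq> vecs n \<and> S \<noteq> {} \<and> (\<forall>u\<in>S. \<forall>v\<in>S. u + v \<in> S) \<and> (\<forall>c. \<forall>v\<in>S. smul c v \<in> S)"

lemma lin_subspace_add: "lin_subspace n S \<Longrightarrow> u \<in> S \<Longrightarrow> v \<in> S \<Longrightarrow> u + v \<in> S"
  and lin_subspace_smul: "lin_subspace n S \<Longrightarrow> v \<in> S \<Longrightarrow> smul c v \<in> S"
  by (simp_all add: lin_subspace_def)

lemma lin_subspace_diff: "lin_subspace n S \<Longrightarrow> u \<in> S \<Longrightarrow> v \<in> S \<Longrightarrow> u - v \<in> S"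
proof -
  assume S: "lin_subspace n S" "u \<in> S" "v \<in> S"
  have "u - v = u + smul (- 1) v" by (simp add: fun_eq_iff)
  then show ?thesis using lin_subspace_add[OF S(1,2) lin_subspace_smul[OF S(1,3)]] by (simp only:)
qed

lemma finite_vecs: "finite (vecs n :: (nat \<Rightarrow> 'k::{field,finite}) set)"
  and card_vecs: "card (vecs n :: (nat \<Rightarrow> 'k::{field,finite}) set) = CARD('k) ^ n"
proof -
  have "bij_betw (\<lambda>v. restrict v {..<n}) (vecs n) (Pi\<^sub>E {..<n} (\<lambda>_. UNIV :: 'k set))"
    by (rule bij_betwI[of _ _ _ "\<lambda>c i. if i < n then c i else 0"])
      (auto simp: vecs_def fun_eq_iff PiE_def extensional_def)
  then show "finite (vecs n :: (nat \<Rightarrow> 'k) set)" "card (vecs n :: (nat \<Rightarrow> 'k) set) = CARD('k) ^ n"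
    using bij_betw_finite bij_betw_same_card finite_PiE[of "{..<n}" "\<lambda>_. UNIV :: 'k set"]
    by (fastforce simp: card_PiE)+
qed

lemma lin_subspace_vecs: "lin_subspace n (vecs n)"
  by (auto simp: lin_subspace_def vecs_def)

lemma lin_subspace_finite: "lin_subspace n S \<Longrightarrow> finite (S :: (nat \<Rightarrow> 'k::{field,finite}) set)"
  using finite_vecs finite_subset by (auto simp: lin_subspace_def)

definition fixed :: "nat \<Rightarrow> ((nat \<Rightarrow> 'k::field) \<Rightarrow> nat \<Rightarrow> 'k) \<Rightarrow> (nat \<Rightarrow> 'k) set" where
  "fixed n s = {v \<in> vecs n. s v = v}"

definition negated :: "nat \<Rightarrow> ((nat \<Rightarrow> 'k::field) \<Rightarrow> nat \<Rightarrow> 'k) \<Rightarrow> (nat \<Rightarrow> 'k) set" where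
  "negated n s = {v \<in> vecs n. s v = - v}"

text \<open>
The decomposition of $S$ into eigenspaces, stated for cardinalities; these replace dimensions
throughout.
\<close>

lemma card_involution_split:
  fixes s :: "(nat \<Rightarrow> 'k::{field,finite}) \<Rightarrow> nat \<Rightarrow> 'k"
  assumes s: "isometry n s" and ss: "\<And>v. s (s v) = v" and two: "(2::'k) \<noteq> 0"
    and S: "lin_subspace n S" and inv: "\<And>v. v \<in> S \<Longrightarrow> s v \<in> S"
  shows "card S = card (S \<inter> fixed n s) * card (S \<inter> negated n s)"
proof -
  have SV: "v \<in> vecs n" if "v \<in> S" for v using S that by (auto simp: lin_subspace_def)
  have half: "smul (1 / 2) w + smul (1 / 2) w = w" for w :: "nat \<Rightarrow> 'k"
    using two by (simp add: fun_eq_iff field_simps)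
  define p where "p x = smul (1 / 2) (x + s x)" for x
  define m where "m x = smul (1 / 2) (x - s x)" for x
  have sp: "s (p x) = p x" and sm: "s (m x) = - m x" for x
    by (simp_all add: p_def m_def isometry_linear[OF s] ss) (simp_all add: fun_eq_iff algebra_simps)
  have pm: "p x + m x = x" for x
    using two by (simp add: p_def m_def fun_eq_iff field_simps)
  have bij: "bij_betw (\<lambda>(x, y). x + y) ((S \<inter> fixed n s) \<times> (S \<inter> negated n s)) S"
  proof (rule bij_betwI[of _ _ _ "\<lambda>x. (p x, m x)"])
    show "(\<lambda>(x, y). x + y) \<in> (S \<inter> fixed n s) \<times> (S \<inter> negated n s) \<rightarrow> S"
      using S by (auto simp: lin_subspace_def)
    show "(\<lambda>x. (p x, m x)) \<in> S \<rightarrow> (S \<inter> fixed n s) \<times> (S \<inter> negated n s)"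
    proof (intro funcsetI SigmaI IntI)
      fix x assume x: "x \<in> S"
      show pS: "p x \<in> S" unfolding p_def by (intro lin_subspace_smul[OF S] lin_subspace_add[OF S] x inv)
      show mS: "m x \<in> S" unfolding m_def by (intro lin_subspace_smul[OF S] lin_subspace_diff[OF S] x inv)
      show "p x \<in> fixed n s" using SV[OF pS] sp by (simp add: fixed_def)
      show "m x \<in> negated n s" using SV[OF mS] sm by (simp add: negated_def)
    qed
    show "(case (\<lambda>x. (p x, m x)) x of (x, y) \<Rightarrow> x + y) = x" if "x \<in> S" for x using pm by simp
    fix z assume "z \<in> (S \<inter> fixed n s) \<times> (S \<inter> negated n s)"
    then obtain x y where z: "z = (x, y)" "s x = x" "s y = - y" by (auto simp: fixed_def negated_def)
    have "s (x + y) = x - y" using z by (simp add: isometry_linear[OF s])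
    then have "p (x + y) = x" "m (x + y) = y"
      using two by (simp_all add: p_def m_def fun_eq_iff field_simps)
    then show "(\<lambda>x. (p x, m x)) (case z of (x, y) \<Rightarrow> x + y) = z" by (simp add: z)
  qed
  show ?thesis using bij_betw_same_card[OF bij] by (simp add: card_cartesian_product)
qed

lemma power_mod_4:
  assumes "q mod 4 = (3::nat)" shows "q ^ k mod 4 = (if even k then 1 else 3)"
proof (induction k)
  case (Suc k)
  have "q ^ Suc k mod 4 = (q mod 4) * (q ^ k mod 4) mod 4" by (simp add: mod_mult_eq)
  then show ?case using Suc assms by simp
qed simp

text \<open>
The determinant obstruction: a fixed space of odd dimension would have $q^{2j+1} \equiv 3 \pmod 4$
elements, while the whole space has $q^n \equiv 1$, so the number of moved vectors would not be divisible
by $4$.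
\<close>

lemma derived_involution_fixed_card:
  fixes s :: "(nat \<Rightarrow> 'k::{field,finite}) \<Rightarrow> nat \<Rightarrow> 'k"
  assumes q: "CARD('k) mod 4 = 3" and n: "even n"
    and s: "s \<in> derived_isometries n" and ss: "\<And>v. s (s v) = v"
  shows "card (fixed n s) mod 4 = 1"
proof -
  have "s \<circ> s = id" by (simp add: fun_eq_iff ss)
  then have "4 dvd card {v \<in> vecs n. s v \<noteq> v}"
    using derived_involution_moved_card[OF s _ finite_vecs] isometry_vecs by blast
  moreover have "card (vecs n :: (nat \<Rightarrow> 'k) set) = card (fixed n s) + card {v \<in> vecs n. s v \<noteq> v}"
    by (subst card_Un_disjoint[symmetric]) (auto simp: fixed_def finite_vecs intro: arg_cong[of _ _ card])
  moreover have "CARD('k) ^ n mod 4 = 1" using power_mod_4[OF q] n by simp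
  ultimately show ?thesis unfolding card_vecs by (auto elim!: dvdE)
qed

section \<open>Siegel transformations\<close>

text \<open>
The coordinates of $e$ are those of $(1, a + bi)$ over the field extended by a square root $i$ of $-1$,
and $f = ie$. The norm of $e$ is $1 + a^2 + b^2 = 0$, so the plane spanned by $e$ and $f$ is totally
singular, and $1 + cN$ is a Siegel transformation.
\<close>

locale siegel =
  fixes n :: nat and a b :: "'k::{field,finite}"
  assumes n4: "4 \<le> n" and n_even: "even n" and ab: "a\<^sup>2 + b\<^sup>2 = - 1" and q: "CARD('k) mod 4 = 3"
begin

lemma two: "(2::'k) \<noteq> 0"
proof (rule two_nonzero_of_odd_card)
  show "odd CARD('k)" using q by presburger
qed

lemma nonsquare: "x * x \<noteq> (- 1 :: 'k)"
  using neg_one_nonsquare[OF q, of x] by (simp add: power2_eq_square)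

lemma one_neq_minus_one: "(1::'k) \<noteq> - 1"
  using nonsquare[of 1] by simp

definition e :: "nat \<Rightarrow> 'k" where
  "e i = (if i = 0 then 1 else if i = 2 then a else if i = 3 then b else 0)"

definition f :: "nat \<Rightarrow> 'k" where
  "f i = (if i = 1 then 1 else if i = 2 then - b else if i = 3 then a else 0)"

definition N :: "(nat \<Rightarrow> 'k) \<Rightarrow> nat \<Rightarrow> 'k" where
  "N v = smul (dot n v e) f - smul (dot n v f) e"

definition tau :: "'k \<Rightarrow> (nat \<Rightarrow> 'k) \<Rightarrow> nat \<Rightarrow> 'k" where
  "tau c v = v + smul c (N v)"

lemma dot_four:
  assumes "\<And>i. 4 \<le> i \<Longrightarrow> w i = 0"
  shows "dot n v w = v 0 * w 0 + v 1 * w 1 + v 2 * w 2 + v 3 * w 3"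
proof -
  have "dot n v w = (\<Sum>i<4. v i * w i)"
    unfolding dot_def using n4 assms by (intro sum.mono_neutral_right) auto
  also have "{..<4} = {0, 1, 2, 3::nat}" by auto
  finally show ?thesis by simp
qed

lemma dot_e: "dot n v e = v 0 + a * v 2 + b * v 3"
  by (subst dot_four) (auto simp: e_def)

lemma dot_f: "dot n v f = v 1 - b * v 2 + a * v 3"
  by (subst dot_four) (auto simp: f_def)

lemma dot_ef [simp]: "dot n e e = 0" "dot n e f = 0" "dot n f e = 0" "dot n f f = 0"
proof -
  have "1 + (a * a + b * b) = 0" using ab by (simp add: power2_eq_square)
  then show "dot n e e = 0" "dot n f f = 0" "dot n e f = 0" "dot n f e = 0"
    by (simp_all add: dot_e dot_f e_def f_def algebra_simps)
qed

lemma ef_vecs: "e \<in> vecs n" "f \<in> vecs n"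
  using n4 by (auto simp: vecs_def e_def f_def)

lemma ef_lincomb: "(smul x e + smul y f) 0 = x" "(smul x e + smul y f) 1 = y"
  by (simp_all add: e_def f_def)

lemma ef_lincomb_eq: "smul x e + smul y f = smul x' e + smul y' f \<longleftrightarrow> x = x' \<and> y = y'"
  by (metis ef_lincomb)

lemma N_linear: "N (u + v) = N u + N v" "N (u - v) = N u - N v" "N (- v) = - N v" "N (smul c v) = smul c (N v)"
  by (simp_all add: N_def dot_linear fun_eq_iff algebra_simps)

lemma N_ef [simp]: "N e = 0" "N f = 0"
  by (simp_all add: N_def fun_eq_iff)

lemma N_N [simp]: "N (N v) = 0"
  by (subst (2) N_def) (simp add: N_linear fun_eq_iff)

lemma N_vecs: "N v \<in> vecs n"
  using ef_vecs by (simp add: N_def vecs_def)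

lemma N_skew: "dot n (N u) v = - dot n u (N v)"
  by (simp add: N_def dot_linear dot_commute[of n e] dot_commute[of n f] mult.commute)

lemma tau_tau: "tau c (tau d v) = tau (c + d) v"
  by (simp add: tau_def N_linear fun_eq_iff algebra_simps)

lemma tau_0 [simp]: "tau 0 v = v"
  by (simp add: tau_def fun_eq_iff)

lemma isometry_tau: "isometry n (tau c)"
  unfolding isometry_def
proof (intro conjI allI impI)
  show "bij (tau c)" by (rule o_bij[of "tau (- c)"]) (auto simp: fun_eq_iff tau_tau)
  show "tau c (u + v) = tau c u + tau c v" for u v
    by (simp add: tau_def N_linear fun_eq_iff algebra_simps)
  show "tau c (smul d v) = smul d (tau c v)" for d v
    by (simp add: tau_def N_linear fun_eq_iff algebra_simps)
  show "tau c v i = v i" if "n \<le> i" for v i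
    using N_vecs that by (simp add: tau_def vecs_def)
  show "tau c v = v" if "\<forall>i<n. v i = 0" for v
  proof -
    have "dot n v w = 0" for w using that by (simp add: dot_def)
    then show ?thesis by (simp add: tau_def N_def fun_eq_iff)
  qed
  show "dot n (tau c u) (tau c v) = dot n u v" for u v
    by (simp add: tau_def dot_linear N_skew dot_zero)
qed

lemma e_is_N: "e = N (\<lambda>i. if i = 1 then - 1 else 0)" and f_is_N: "f = N (\<lambda>i. if i = 0 then 1 else 0)"
  by (simp_all add: N_def dot_e dot_f fun_eq_iff)

text \<open>
$N$ is determined by $e \wedge f$, so conjugation by an isometry that preserves the plane multiplies
it by the determinant on the plane.
\<close>

lemma N_conj:
  assumes s: "isometry n s" and se: "s e = smul \<alpha> e + smul \<beta> f" and sf: "s f = smul \<gamma> e + smul \<delta> f"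
    and det: "\<alpha> * \<delta> - \<beta> * \<gamma> = - 1"
  shows "N (s v) = - s (N v)"
proof -
  define x where "x = dot n (s v) e"
  define y where "y = dot n (s v) f"
  have "dot n v e = dot n (s v) (s e)" "dot n v f = dot n (s v) (s f)" by (simp_all add: isometry_dot[OF s])
  then have ve: "dot n v e = \<alpha> * x + \<beta> * y" and vf: "dot n v f = \<gamma> * x + \<delta> * y"
    by (simp_all add: se sf dot_linear x_def y_def)
  have "s (N v) = smul (\<alpha> * x + \<beta> * y) (smul \<gamma> e + smul \<delta> f) - smul (\<gamma> * x + \<delta> * y) (smul \<alpha> e + smul \<beta> f)"
    by (simp add: N_def isometry_linear[OF s] ve vf se sf)
  also have "\<dots> = smul ((\<alpha> * \<delta> - \<beta> * \<gamma>) * x) f - smul ((\<alpha> * \<delta> - \<beta> * \<gamma>) * y) e"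
    by (simp add: fun_eq_iff algebra_simps)
  also have "\<dots> = - N (s v)" unfolding det N_def x_def y_def by (simp add: fun_eq_iff)
  finally show ?thesis by simp
qed

text \<open>
Here $e = N u_1$ and $f = N u_0$ for signed basis vectors $u_0, u_1$. Applying $s$ gives the matrix of
$s$ on the plane, and the equation $s u_0 \cdot s e = u_0 \cdot e = 1$ is its determinant condition.
\<close>

lemma anticommuting_action:
  assumes s: "isometry n s" and sN: "\<And>v. v \<in> vecs n \<Longrightarrow> s (N v) = - N (s v)"
  obtains \<alpha> \<beta> \<gamma> \<delta> where "s e = smul \<alpha> e + smul \<beta> f" "s f = smul \<gamma> e + smul \<delta> f"
    "\<alpha> * \<delta> - \<beta> * \<gamma> = - 1"
proof -
  define u0 :: "nat \<Rightarrow> 'k" where "u0 = (\<lambda>i. if i = 0 then 1 else 0 :: 'k)"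
  define u1 :: "nat \<Rightarrow> 'k" where "u1 = (\<lambda>i. if i = 1 then - 1 else 0 :: 'k)"
  have u: "u0 \<in> vecs n" "u1 \<in> vecs n" using n4 by (auto simp: u0_def u1_def vecs_def)
  define \<alpha> \<beta> \<gamma> \<delta> where defs: "\<alpha> = dot n (s u1) f" "\<beta> = - dot n (s u1) e"
    "\<gamma> = dot n (s u0) f" "\<delta> = - dot n (s u0) e"
  have "s e = - N (s u1)" using sN[OF u(2)] by (simp add: e_is_N u1_def)
  then have se: "s e = smul \<alpha> e + smul \<beta> f" by (simp add: N_def defs fun_eq_iff)
  have "s f = - N (s u0)" using sN[OF u(1)] by (simp add: f_is_N u0_def)
  then have sf: "s f = smul \<gamma> e + smul \<delta> f" by (simp add: N_def defs fun_eq_iff)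
  have "dot n (s u0) (s e) = dot n u0 e" by (rule isometry_dot[OF s])
  also have "\<dots> = 1" by (simp add: dot_e u0_def)
  finally have "\<alpha> * \<delta> - \<beta> * \<gamma> = - 1"
    by (simp add: se dot_linear defs) (simp add: algebra_simps)
  then show ?thesis using that se sf by blast
qed

text \<open>
In complex coordinates this is $(z_0, z_1) \mapsto (-z_1, -\alpha^2 z_0)$ with $\alpha = a + bi$. It
multiplies $e = (1, \alpha)$ by $-\alpha$, which has norm $-1$, and so inverts every \<open>tau c\<close>.
\<close>

definition flip :: "(nat \<Rightarrow> 'k) \<Rightarrow> nat \<Rightarrow> 'k" where
  "flip = rot 2 3 (b\<^sup>2 - a\<^sup>2) (- 2 * a * b) \<circ> (rot 0 2 0 1 \<circ> rot 1 3 0 1)"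

lemma rot_coeff: "(b\<^sup>2 - a\<^sup>2)\<^sup>2 + (- 2 * a * b)\<^sup>2 = 1"
proof -
  have "(b\<^sup>2 - a\<^sup>2)\<^sup>2 + (- 2 * a * b)\<^sup>2 = (a\<^sup>2 + b\<^sup>2)\<^sup>2"
    by (simp add: power2_eq_square algebra_simps)
  then show ?thesis by (simp add: ab)
qed

lemma isometry_flip: "isometry n flip"
  unfolding flip_def using n4 by (intro isometry_comp isometry_rot rot_coeff) auto

lemma flip_ef: "flip e = smul (- a) e + smul (- b) f" "flip f = smul b e + smul (- a) f"
  by (auto simp: flip_def rot_def e_def f_def fun_eq_iff power2_eq_square)

lemma N_flip: "N (flip v) = - flip (N v)"
proof (rule N_conj[OF isometry_flip flip_ef])
  show "- a * - a - - b * b = - 1" using ab by (simp add: power2_eq_square)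
qed

lemma flip_tau: "flip (tau c v) = tau (- c) (flip v)"
  by (simp add: tau_def isometry_linear[OF isometry_flip] N_flip fun_eq_iff)

text \<open>
As \<open>flip\<close> inverts $\tau_d$, the commutator of the two is $\tau_d^{-2} = \tau_{-2d}$.
\<close>

lemma tau_derived: "tau c \<in> derived_isometries n"
proof (rule derived_commutator[OF isometry_flip isometry_tau[of "- c / 2"]])
  show "flip \<circ> tau (- c / 2) = tau c \<circ> (tau (- c / 2) \<circ> flip)"
  proof (rule ext)
    fix v
    have "c + - c / 2 = - (- c / 2)" using two by (simp add: field_simps)
    then show "(flip \<circ> tau (- c / 2)) v = (tau c \<circ> (tau (- c / 2) \<circ> flip)) v"
      by (simp only: comp_apply flip_tau tau_tau)
  qed
qed

end

section \<open>Dimension six\<close>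

lemma card_hyperbolic_split:
  fixes u v :: "nat \<Rightarrow> 'k::{field,finite}"
  assumes S: "lin_subspace n S" and uv: "u \<in> S" "v \<in> S" "dot n u u = 0" "dot n v v = 0" "dot n u v = 1"
  shows "card S = (CARD('k))\<^sup>2 * card {x \<in> S. dot n x u = 0 \<and> dot n x v = 0}"
proof -
  let ?R = "{x \<in> S. dot n x u = 0 \<and> dot n x v = 0}"
  have vu: "dot n v u = 1" using uv by (simp add: dot_commute)
  have "bij_betw (\<lambda>(c, d, r). smul c u + smul d v + r) (UNIV \<times> UNIV \<times> ?R) S"
  proof (rule bij_betwI[of _ _ _ "\<lambda>x. (dot n x v, dot n x u, x - (smul (dot n x v) u + smul (dot n x u) v))"])
    show "(\<lambda>(c, d, r). smul c u + smul d v + r) \<in> UNIV \<times> UNIV \<times> ?R \<rightarrow> S"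
      using S uv by (auto simp: lin_subspace_def)
    show "(\<lambda>x. (dot n x v, dot n x u, x - (smul (dot n x v) u + smul (dot n x u) v))) \<in> S \<rightarrow> UNIV \<times> UNIV \<times> ?R"
    proof (intro funcsetI SigmaI UNIV_I CollectI conjI)
      fix x assume x: "x \<in> S"
      show "x - (smul (dot n x v) u + smul (dot n x u) v) \<in> S"
        by (intro lin_subspace_diff[OF S] lin_subspace_add[OF S] lin_subspace_smul[OF S] x uv)
    qed (simp_all add: dot_linear uv vu)
    fix z assume "z \<in> (UNIV :: 'k set) \<times> (UNIV :: 'k set) \<times> ?R"
    then show "(\<lambda>x. (dot n x v, dot n x u, x - (smul (dot n x v) u + smul (dot n x u) v)))
        (case z of (c, d, r) \<Rightarrow> smul c u + smul d v + r) = z"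
      by (auto simp: dot_linear uv vu)
  qed (auto simp: fun_eq_iff)
  from bij_betw_same_card[OF this] show ?thesis
    by (simp add: card_cartesian_product power2_eq_square)
qed

text \<open>
The fixed space of an involution is non-degenerate: averaging over $s$ any vector that is not
orthogonal to $u$ yields a fixed one, which can then be made singular by adding a multiple of $u$.
\<close>

lemma ex_hyperbolic_partner:
  fixes s :: "(nat \<Rightarrow> 'k::{field,finite}) \<Rightarrow> nat \<Rightarrow> 'k"
  assumes s: "isometry n s" and ss: "\<And>v. s (s v) = v" and two: "(2::'k) \<noteq> 0"
    and u: "u \<in> fixed n s" "u \<noteq> 0" "dot n u u = 0"
  shows "\<exists>v\<in>fixed n s. dot n v v = 0 \<and> dot n u v = 1"
proof -
  have uV: "u \<in> vecs n" and su: "s u = u" using u by (auto simp: fixed_def)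
  obtain w where w: "w \<in> vecs n" "dot n u w \<noteq> 0" using vecs_nonzero_dot[OF uV u(2)] by blast
  define y where "y = smul (1 / (2 * dot n u w)) (w + s w)"
  have "dot n u (s w) = dot n u w" using isometry_dot[OF s, of u w] su by simp
  then have uy: "dot n u y = 1"
    using w two by (simp add: y_def dot_linear)
  have sy: "s y = y" by (simp add: y_def isometry_linear[OF s] ss add.commute)
  have yV: "y \<in> vecs n" using w isometry_vecs[OF s w(1)] by (simp add: y_def vecs_def)
  define v where "v = y - smul (dot n y y / 2) u"
  have "v \<in> fixed n s" using sy su yV uV by (simp add: fixed_def v_def isometry_linear[OF s] vecs_def)
  moreover have "dot n u v = 1" by (simp add: v_def dot_linear uy u)
  moreover have "dot n v v = 0"
    using two by (simp add: v_def dot_linear u uy dot_commute[of n y u])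
  ultimately show ?thesis by blast
qed

text \<open>
The spinor norm obstruction, on the set $X$ of vectors of norm $1$. Since $-1$ is in the derived group
and moves every vector, $4$ divides $|X|$. A hyperbolic plane contains $q - 1 \equiv 2 \pmod 4$ vectors of
norm $1$, so an involution that fixes just such a plane moves the wrong number of elements of $X$.
\<close>

lemma fixed_hyperbolic_plane_impossible:
  fixes s :: "(nat \<Rightarrow> 'k::{field,finite}) \<Rightarrow> nat \<Rightarrow> 'k"
  assumes q: "CARD('k) mod 4 = 3" and n: "even n"
    and s: "s \<in> derived_isometries n" and ss: "\<And>v. s (s v) = v"
    and uv: "u \<in> fixed n s" "v \<in> fixed n s" "dot n u u = 0" "dot n v v = 0" "dot n u v = 1"
    and span: "\<And>x. x \<in> fixed n s \<Longrightarrow> x = smul (dot n x v) u + smul (dot n x u) v"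
  shows False
proof -
  have two: "(2::'k) \<noteq> 0" by (rule two_nonzero_of_odd_card) (use q in presburger)
  have si: "isometry n s" by (rule derived_isometry[OF s])
  have vu: "dot n v u = 1" using uv by (simp add: dot_commute)
  define X where "X = {x \<in> vecs n. dot n x x = (1::'k)}"
  have Xfin: "finite X" using finite_vecs by (auto simp: X_def intro: finite_subset)
  have X: "f x \<in> X" if "isometry n f" "x \<in> X" for f x
    using that by (simp add: X_def isometry_vecs isometry_dot)
  have moved: "4 dvd card {x \<in> X. t x \<noteq> x}" if "t \<in> derived_isometries n" "\<And>v. t (t v) = v" for t
  proof (rule derived_involution_moved_card[OF that(1)])
    show "t \<circ> t = id" using that(2) by (simp add: fun_eq_iff)
  qed (use Xfin X in auto)
  have neg_moved: "4 dvd card {x \<in> X. neg n x \<noteq> x}"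
    using neg_derived[of "n div 2" n] n by (intro moved neg_neg) simp
  have neg_moves: "neg n x \<noteq> x" if "x \<in> X" for x
  proof
    assume eq: "neg n x = x"
    have "neg n x = - x" using that by (intro neg_vecs) (simp add: X_def)
    then have "x i = - x i" for i using eq by (metis fun_Compl_def)
    then have "x i = 0" for i using two by (rule eq_neg_imp_zero)
    then have "dot n x x = 0" by (simp add: dot_def)
    then show False using that by (simp add: X_def)
  qed
  have "{x \<in> X. neg n x \<noteq> x} = X" using neg_moves by blast
  then have "4 dvd card X" using neg_moved by (simp only:)
  moreover have "card X = card (X \<inter> fixed n s) + card {x \<in> X. s x \<noteq> x}"
  proof -
    have "X = (X \<inter> fixed n s) \<union> {x \<in> X. s x \<noteq> x}" by (auto simp: fixed_def X_def)
    moreover have "(X \<inter> fixed n s) \<inter> {x \<in> X. s x \<noteq> x} = {}" by (auto simp: fixed_def)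
    ultimately show ?thesis using Xfin card_Un_disjoint[of "X \<inter> fixed n s" "{x \<in> X. s x \<noteq> x}"] by simp
  qed
  ultimately have "4 dvd card (X \<inter> fixed n s)" using moved[OF s ss] by (simp add: dvd_add_left_iff)
  moreover have "card (X \<inter> fixed n s) = CARD('k) - 1"
  proof -
    have "bij_betw (\<lambda>c. smul c u + smul (1 / (2 * c)) v) (UNIV - {0}) (X \<inter> fixed n s)"
    proof (rule bij_betwI[of _ _ _ "\<lambda>x. dot n x v"])
      show "(\<lambda>c. smul c u + smul (1 / (2 * c)) v) \<in> UNIV - {0} \<rightarrow> X \<inter> fixed n s"
        using uv two by (auto simp: X_def fixed_def vecs_def dot_linear vu isometry_linear[OF si] field_simps)
      have eq: "2 * (dot n x v * dot n x u) = 1" if "x \<in> X \<inter> fixed n s" for x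
      proof -
        have "x = smul (dot n x v) u + smul (dot n x u) v" using span that by blast
        then have "dot n x x = dot n (smul (dot n x v) u + smul (dot n x u) v) x" by simp
        also have "\<dots> = 2 * (dot n x v * dot n x u)"
          by (simp add: dot_linear dot_commute[of n u x] dot_commute[of n v x])
        finally show ?thesis using that by (simp add: X_def)
      qed
      have nz: "dot n x v \<noteq> 0" if "x \<in> X \<inter> fixed n s" for x using eq[OF that] by auto
      then show "(\<lambda>x. dot n x v) \<in> X \<inter> fixed n s \<rightarrow> UNIV - {0}" by blast
      show "dot n (smul c u + smul (1 / (2 * c)) v) v = c" for c by (simp add: dot_linear uv)
      show "smul (dot n x v) u + smul (1 / (2 * dot n x v)) v = x" if x: "x \<in> X \<inter> fixed n s" for x
      proof -
        have "1 / (2 * dot n x v) = dot n x u" using eq[OF x] nz[OF x] two by (simp add: field_simps)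
        then show ?thesis using span x by simp
      qed
    qed
    from bij_betw_same_card[OF this] show ?thesis by simp
  qed
  ultimately show False using q by presburger
qed

text \<open>
Each eigenspace contains a hyperbolic plane, and the complement $R$ of the two planes has $q^2$ elements.
If $R$ meets one of the eigenspaces trivially, then this eigenspace is a hyperbolic plane, and the
preceding lemma applies to $s$ or to $-s$. Otherwise $R$ contributes $q$ elements to each of them, and
both have dimension $3$, against the determinant obstruction.
\<close>

lemma fixed_negated_planes_impossible:
  fixes s :: "(nat \<Rightarrow> 'k::{field,finite}) \<Rightarrow> nat \<Rightarrow> 'k"
  assumes q: "CARD('k) mod 4 = 3" and s: "s \<in> derived_isometries 6" and ss: "\<And>v. s (s v) = v"
    and u: "u \<in> fixed 6 s" "u \<noteq> 0" "dot 6 u u = 0"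
    and w: "w \<in> negated 6 s" "w \<noteq> 0" "dot 6 w w = 0"
  shows False
proof -
  have two: "(2::'k) \<noteq> 0" by (rule two_nonzero_of_odd_card) (use q in presburger)
  have si: "isometry 6 s" by (rule derived_isometry[OF s])
  define t where "t = neg 6 \<circ> s"
  have t: "t \<in> derived_isometries 6"
    unfolding t_def using neg_derived[of 3 6] s by (intro derived_comp) auto
  have tt: "t (t v) = v" for v
    by (simp add: t_def isometry_neg_commute[OF si] ss neg_neg)
  have ti: "isometry 6 t" by (rule derived_isometry[OF t])
  have "s y = - y \<longleftrightarrow> t y = y" if "y \<in> vecs 6" for y
  proof -
    have "t y = - s y" unfolding t_def comp_apply by (rule neg_vecs[OF isometry_vecs[OF si that]])
    then show ?thesis by (metis minus_minus)
  qed
  then have neg_fix: "negated 6 s = fixed 6 t" by (auto simp: negated_def fixed_def)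
  obtain v where v: "v \<in> fixed 6 s" "dot 6 v v = 0" "dot 6 u v = 1"
    using ex_hyperbolic_partner[OF si ss two u] by blast
  obtain x where x: "x \<in> fixed 6 t" "dot 6 x x = 0" "dot 6 w x = 1"
    using ex_hyperbolic_partner[OF ti tt two, of w] w neg_fix by blast
  have perp: "dot 6 y z = 0" if "y \<in> fixed 6 s" "z \<in> negated 6 s" for y z
  proof -
    have "dot 6 y z = - dot 6 y z"
      using isometry_dot[OF si, of y z] that by (simp add: fixed_def negated_def dot_linear)
    then show ?thesis using two by (rule eq_neg_imp_zero)
  qed
  define S1 where "S1 = {y \<in> vecs 6. dot 6 y u = 0 \<and> dot 6 y v = 0}"
  define R where "R = {y \<in> S1. dot 6 y w = 0 \<and> dot 6 y x = 0}"
  have S1: "lin_subspace 6 S1" by (auto simp: S1_def lin_subspace_def vecs_def dot_linear intro: exI[of _ 0])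
  have R: "lin_subspace 6 R" by (auto simp: R_def S1_def lin_subspace_def vecs_def dot_linear intro: exI[of _ 0])
  have uV: "u \<in> vecs 6" "v \<in> vecs 6" using u v by (auto simp: fixed_def)
  have wV: "w \<in> vecs 6" "x \<in> vecs 6" using w x by (auto simp: fixed_def negated_def)
  have x': "x \<in> negated 6 s" using x neg_fix by simp
  have wS: "w \<in> S1" "x \<in> S1"
    using wV perp[OF u(1) w(1)] perp[OF v(1) w(1)] perp[OF u(1) x'] perp[OF v(1) x']
    by (auto simp: S1_def dot_commute)
  have "CARD('k) ^ 6 = (CARD('k))\<^sup>2 * ((CARD('k))\<^sup>2 * card R)"
    using card_hyperbolic_split[OF lin_subspace_vecs uV u(3) v(2,3)]
      card_hyperbolic_split[OF S1 wS w(3) x(2,3)] by (simp add: card_vecs S1_def R_def)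
  then have "CARD('k) ^ 4 * card R = CARD('k) ^ 4 * (CARD('k))\<^sup>2"
    by (simp add: power2_eq_square numeral_eq_Suc)
  moreover have "CARD('k) ^ 4 \<noteq> 0" by simp
  ultimately have R2: "card R = (CARD('k))\<^sup>2" using mult_left_cancel by blast
  have sR: "s y \<in> R" if "y \<in> R" for y
  proof -
    have "dot 6 (s y) z = dot 6 y (s z)" for z
      using isometry_dot[OF si, of y "s z"] by (simp add: ss)
    then show ?thesis using that u v w x' isometry_vecs[OF si]
      by (auto simp: R_def S1_def fixed_def negated_def dot_linear)
  qed
  have prod: "(CARD('k))\<^sup>2 = card (R \<inter> fixed 6 s) * card (R \<inter> negated 6 s)"
    using card_involution_split[OF si ss two R sR] R2 by simp
  have fixed_sub: "lin_subspace 6 (fixed 6 s)" "lin_subspace 6 (negated 6 s)"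
    by (auto simp: lin_subspace_def fixed_def negated_def vecs_def isometry_linear[OF si] fun_eq_iff intro!: exI[of _ 0])
  have fixed_R: "{y \<in> fixed 6 s. dot 6 y u = 0 \<and> dot 6 y v = 0} = R \<inter> fixed 6 s"
    using perp w(1) x' by (auto simp: R_def S1_def fixed_def)
  have negated_R: "{y \<in> negated 6 s. dot 6 y w = 0 \<and> dot 6 y x = 0} = R \<inter> negated 6 s"
  proof -
    have "y \<in> vecs 6 \<and> dot 6 y u = 0 \<and> dot 6 y v = 0" if "y \<in> negated 6 s" for y
      using perp[OF u(1) that] perp[OF v(1) that] that by (simp add: dot_commute negated_def)
    then show ?thesis by (auto simp: R_def S1_def)
  qed
  have large: "CARD('k) \<le> card T" if T: "lin_subspace 6 T" and r: "r \<in> T" "r \<noteq> 0" for T and r :: "nat \<Rightarrow> 'k"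
  proof -
    obtain i where "r i \<noteq> 0" using r by (auto simp: fun_eq_iff)
    then have "inj (\<lambda>c. smul c r)" by (auto simp: inj_def fun_eq_iff)
    then have "CARD('k) = card (range (\<lambda>c. smul c r))" by (simp add: card_image)
    also have "\<dots> \<le> card T" using T r by (intro card_mono lin_subspace_finite) (auto simp: lin_subspace_def)
    finally show ?thesis .
  qed
  have sub_R: "lin_subspace 6 (R \<inter> T)" if "lin_subspace 6 T" "0 \<in> T" for T
  proof -
    have "0 \<in> R" by (simp add: R_def S1_def vecs_def dot_zero)
    then show ?thesis using R that by (auto simp: lin_subspace_def)
  qed
  have zero: "0 \<in> fixed 6 s" "0 \<in> negated 6 s"
    by (auto simp: fixed_def negated_def vecs_def isometry_linear[OF si])
  have span: "y = smul (dot 6 y d) c + smul (dot 6 y c) d"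
    if T: "lin_subspace 6 T" and cd: "c \<in> T" "d \<in> T" "dot 6 c c = 0" "dot 6 d d = 0" "dot 6 c d = 1"
      and triv: "\<And>r. r \<in> T \<Longrightarrow> dot 6 r c = 0 \<Longrightarrow> dot 6 r d = 0 \<Longrightarrow> r = 0" and y: "y \<in> T" for T c d y
  proof -
    have "y - (smul (dot 6 y d) c + smul (dot 6 y c) d) = 0"
      using cd by (intro triv lin_subspace_diff[OF T] lin_subspace_add[OF T] lin_subspace_smul[OF T] y)
        (simp_all add: dot_linear dot_commute[of 6 d c])
    then show ?thesis by simp
  qed
  consider "\<forall>r\<in>R \<inter> fixed 6 s. r = 0" | "\<forall>r\<in>R \<inter> negated 6 s. r = 0"
    | r r' where "r \<in> R \<inter> fixed 6 s" "r \<noteq> 0" "r' \<in> R \<inter> negated 6 s" "r' \<noteq> 0" by blast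
  then show False
  proof cases
    case 1
    then have triv: "r = 0" if "r \<in> fixed 6 s" "dot 6 r u = 0" "dot 6 r v = 0" for r
      using fixed_R that by blast
    show False
      by (rule fixed_hyperbolic_plane_impossible[OF q _ s ss u(1) v(1) u(3) v(2,3)])
        (simp, rule span[OF fixed_sub(1) u(1) v(1) u(3) v(2,3) triv])
  next
    case 2
    then have triv: "r = 0" if "r \<in> fixed 6 t" "dot 6 r w = 0" "dot 6 r x = 0" for r
      using negated_R neg_fix that by blast
    have wt: "w \<in> fixed 6 t" using w(1) neg_fix by simp
    show False
      by (rule fixed_hyperbolic_plane_impossible[OF q _ t tt wt x(1) w(3) x(2,3)])
        (simp, rule span[OF fixed_sub(2)[unfolded neg_fix] wt x(1) w(3) x(2,3) triv])
  next
    case 3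
    note large = large[OF sub_R[OF fixed_sub(1) zero(1)] 3(1,2)] large[OF sub_R[OF fixed_sub(2) zero(2)] 3(3,4)]
    have "card (R \<inter> fixed 6 s) \<le> CARD('k)"
    proof (rule ccontr)
      assume "\<not> ?thesis"
      then have "CARD('k) * CARD('k) < card (R \<inter> fixed 6 s) * card (R \<inter> negated 6 s)"
        using large by (intro mult_less_le_imp_less) auto
      then show False using prod by (simp add: power2_eq_square)
    qed
    then have "card (R \<inter> fixed 6 s) = CARD('k)" using large by simp
    then have "card (fixed 6 s) = CARD('k) ^ 3"
      using card_hyperbolic_split[OF fixed_sub(1) u(1) v(1) u(3) v(2,3)] fixed_R
      by (simp add: power2_eq_square power3_eq_cube)
    then show False
      using derived_involution_fixed_card[OF q _ s ss] power_mod_4[OF q, of 3] by simp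
  qed
qed

context siegel
begin

lemma tau_eq_minus:
  assumes "tau 1 x = - x" shows "x = 0"
proof -
  have "tau 1 (tau 1 x) = x" unfolding assms isometry_minus[OF isometry_tau] by simp
  then have "tau 2 x = x" by (simp add: tau_tau)
  then have "x i + 2 * N x i = x i" for i unfolding tau_def by (metis plus_fun_apply smul_apply)
  then have "N x i = 0" for i using two by simp
  then have "x i = - x i" for i using fun_cong[OF assms, of i] by (simp add: tau_def)
  then have "x i = 0" for i using two by (rule eq_neg_imp_zero)
  then show ?thesis by (simp add: fun_eq_iff)
qed

text \<open>
The element $h$ combines \<open>flip\<close> with the rotation of the last two coordinates that has the same
coefficients. \<open>flip\<close> alone is a product of three rotations, one of which would remain
unpaired in \<open>rot_pair_derived\<close>.
\<close>

lemma six_dim_quotient_weakly_real: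
  assumes n: "n = 6"
  shows "quotient_weakly_real (isometry_group n :: ((nat \<Rightarrow> 'k) \<Rightarrow> nat \<Rightarrow> 'k) monoid)"
proof -
  define h where "h = rot 2 3 (b\<^sup>2 - a\<^sup>2) (- 2 * a * b) \<circ> rot 4 5 (b\<^sup>2 - a\<^sup>2) (- 2 * a * b) \<circ> (rot 0 2 0 1 \<circ> rot 1 3 0 1)"
  have hD: "h \<in> derived_isometries n"
    unfolding h_def using n by (intro derived_comp rot_pair_derived rot_coeff) auto
  note hi = derived_isometry[OF hD]
  have "h e = flip e" "h f = flip f"
    by (auto simp: h_def flip_def rot_def e_def f_def fun_eq_iff)
  then have hN: "N (h v) = - h (N v)" for v
    using ab by (intro N_conj[OF hi]) (auto simp: flip_ef power2_eq_square)
  have "tau 1 (h (tau 1 v)) = id (h v)" for v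
  proof -
    have "h (tau 1 v) = tau (- 1) (h v)"
      by (simp add: tau_def isometry_linear[OF hi] hN fun_eq_iff)
    then show ?thesis by (simp add: tau_tau)
  qed
  then show ?thesis
  proof (rule quotient_weakly_realI[OF _ n_even two tau_derived hD, rotated 2])
    fix s \<epsilon> \<eta> assume sD: "s \<in> derived_isometries n" and \<epsilon>: "\<epsilon> \<in> {id, neg n}" and \<eta>: "\<eta> \<in> {id, neg n}"
      and ss: "\<And>v. s (s v) = \<epsilon> v" and sg: "\<And>v. tau 1 (s (tau 1 v)) = \<eta> (s v)"
    note si = derived_isometry[OF sD]
    have e0: "e \<noteq> 0" by (metis (full_types) e_def zero_fun_apply zero_neq_one)
    have "\<eta> \<noteq> neg n"
    proof
      assume \<eta>n: "\<eta> = neg n"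
      have "tau 1 e = e" by (simp add: tau_def fun_eq_iff)
      then have "tau 1 (s e) = - s e"
        using sg[of e] neg_vecs[OF isometry_vecs[OF si ef_vecs(1)]] \<eta>n by simp
      then have "s e = 0" by (rule tau_eq_minus)
      then have "e = 0" using isometry_inj[OF si, of e 0] isometry_zero[OF si] by simp
      then show False using e0 by simp
    qed
    then have \<eta>: "\<eta> = id" using \<eta> by simp
    have sN: "s (N v) = - N (s v)" for v
    proof -
      have "tau 1 (s (tau 1 v)) = s v" using sg \<eta> by simp
      then have sum: "s (N v) + N (s v) + N (s (N v)) = 0"
        by (simp add: tau_def isometry_linear[OF si] N_linear fun_eq_iff algebra_simps)
      have "N (s (N v) + N (s v) + N (s (N v))) = N (s (N v))" by (simp add: N_linear)
      then have "N (s (N v)) = 0" unfolding sum by (simp add: N_def dot_zero fun_eq_iff)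
      then have "s (N v) + N (s v) = 0" using sum by simp
      then show ?thesis by (simp add: eq_neg_iff_add_eq_0)
    qed
    then obtain \<alpha> \<beta> \<gamma> \<delta> where se: "s e = smul \<alpha> e + smul \<beta> f" and sf: "s f = smul \<gamma> e + smul \<delta> f"
      and det: "\<alpha> * \<delta> - \<beta> * \<gamma> = - 1" using anticommuting_action[OF si] by blast
    have sse: "s (s e) = smul (\<alpha> * \<alpha> + \<beta> * \<gamma>) e + smul (\<beta> * (\<alpha> + \<delta>)) f"
      unfolding se by (simp add: isometry_linear[OF si] se sf fun_eq_iff algebra_simps)
    have ssf: "s (s f) = smul (\<gamma> * (\<alpha> + \<delta>)) e + smul (\<delta> * \<delta> + \<beta> * \<gamma>) f"
      unfolding sf by (simp add: isometry_linear[OF si] se sf fun_eq_iff algebra_simps)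
    have "\<epsilon> \<noteq> neg n"
    proof
      assume "\<epsilon> = neg n"
      then have "s (s e) = smul (- 1) e + smul 0 f" "s (s f) = smul 0 e + smul (- 1) f"
        using ss neg_vecs[OF ef_vecs(1)] neg_vecs[OF ef_vecs(2)] by (simp_all add: fun_eq_iff)
      then have eqs: "\<alpha> * \<alpha> + \<beta> * \<gamma> = - 1" "\<beta> * (\<alpha> + \<delta>) = 0" "\<gamma> * (\<alpha> + \<delta>) = 0" "\<delta> * \<delta> + \<beta> * \<gamma> = - 1"
        unfolding sse ssf ef_lincomb_eq by auto
      show False
      proof (cases "\<alpha> + \<delta> = 0")
        case True
        then have "\<delta> = - \<alpha>" by (simp add: eq_neg_iff_add_eq_0 add.commute)
        then have "- (\<alpha> * \<alpha> + \<beta> * \<gamma>) = - 1" using det by (simp add: algebra_simps)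
        then show False using eqs(1) one_neq_minus_one by simp
      next
        case False
        then have "\<beta> = 0" using eqs(2) by simp
        then show False using eqs(1) nonsquare by simp
      qed
    qed
    then have ss: "s (s v) = v" for v using ss \<epsilon> by auto
    \<comment> \<open>\<open>1 + c s\<close> maps to the eigenspace of \<open>c\<close> and cannot vanish on the plane, where it would make \<open>s\<close> a scalar of determinant 1\<close>
    have fixed: "\<exists>u. u \<in> vecs n \<and> u \<noteq> 0 \<and> dot n u u = 0 \<and> s u = smul c u" if c: "c = 1 \<or> c = - 1" for c
    proof -
      have cc: "c * c = 1" using c by auto
      have eig: "s (w + smul c (s w)) = smul c (w + smul c (s w))" for w
        by (simp add: isometry_linear[OF si] ss fun_eq_iff algebra_simps cc flip: mult.assoc)
      have iso: "dot n (smul x e + smul y f) (smul x e + smul y f) = 0" for x y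
        by (simp add: dot_linear)
      have we: "e + smul c (s e) = smul (1 + c * \<alpha>) e + smul (c * \<beta>) f"
        and wf: "f + smul c (s f) = smul (c * \<gamma>) e + smul (1 + c * \<delta>) f"
        by (simp_all add: se sf fun_eq_iff algebra_simps)
      have vecs: "smul x e + smul y f \<in> vecs n" for x y using ef_vecs by (simp add: vecs_def)
      have "e + smul c (s e) \<noteq> 0 \<or> f + smul c (s f) \<noteq> 0"
      proof (rule ccontr)
        assume "\<not> ?thesis"
        then have "smul (1 + c * \<alpha>) e + smul (c * \<beta>) f = smul 0 e + smul 0 f"
          "smul (c * \<gamma>) e + smul (1 + c * \<delta>) f = smul 0 e + smul 0 f"
          unfolding we wf by (simp_all add: fun_eq_iff)
        then have z: "1 + c * \<alpha> = 0" "c * \<beta> = 0" "1 + c * \<delta> = 0" unfolding ef_lincomb_eq by auto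
        have "c \<noteq> 0" using cc by auto
        then have "\<beta> = 0" using z by simp
        moreover have "(c * \<alpha>) * (c * \<delta>) = 1"
          using z(1,3) by (metis add_eq_0_iff mult_minus_left mult_minus_right mult_1 minus_minus)
        then have "\<alpha> * \<delta> = 1" using cc by (metis mult.assoc mult.commute mult_1)
        ultimately show False using det one_neq_minus_one by simp
      qed
      then show ?thesis using eig[of e] eig[of f] iso vecs we wf by metis
    qed
    obtain u where u: "u \<in> vecs n" "u \<noteq> 0" "dot n u u = 0" "s u = smul 1 u" using fixed[of 1] by auto
    obtain w where w: "w \<in> vecs n" "w \<noteq> 0" "dot n w w = 0" "s w = smul (- 1) w" using fixed[of "- 1"] by auto
    have "u \<in> fixed n s" using u by (simp add: fixed_def fun_eq_iff)
    moreover have "w \<in> negated n s" using w by (simp add: negated_def fun_eq_iff)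
    ultimately show False
      using fixed_negated_planes_impossible[OF q] sD ss u w unfolding n by blast
  qed (simp add: n, rule insertI1)
qed

end

context siegel
begin

section \<open>Dimension at least ten\<close>

text \<open>
The complex structure on all coordinates, except that the coordinates $4,\dots,7$ are permuted by the
signed $4$-cycle
$\varepsilon_4 \mapsto \varepsilon_5 \mapsto \varepsilon_6 \mapsto \varepsilon_7 \mapsto -\varepsilon_4$.
\<close>

definition signed_perm :: "(nat \<Rightarrow> 'k) \<Rightarrow> nat \<Rightarrow> 'k" where
  "signed_perm v i = (if n \<le> i then v i else if i = 4 then - v 7 else if i \<in> {5, 6, 7} then v (i - 1)
     else if even i then - v (i + 1) else v (i - 1))"

text \<open>
The even polynomial $U = (g^4+1)(g^2+1)$ in $g = \tau\pi$ isolates the unipotent part: $(\pi^4+1)(\pi^2+1) = 0$,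
since $\pi^2 = -1$ off the $4$-cycle and $\pi^4 = -1$ on it, and what remains is $U = -4N$. Because $U$ is
even, both $sgs^{-1} = g^{-1}$ and $sgs^{-1} = -g^{-1}$ lead to $sUs^{-1} = g^{-6}U$, and this gives
$sNs^{-1} = -N$.

The element $h$ inverts $\tau$ through \<open>flip\<close> on the coordinates $0,\dots,3$. It maps $\pi$ to $-\pi^{-1}$:
outside the coordinates $4,\dots,7$ it commutes with the complex structure, and there it conjugates the
signed $4$-cycle $\rho$ to $\rho^3 = -\rho^{-1}$. The rotation of the coordinates $8, 9$ is the partner that
\<open>rot_pair_derived\<close> requires for the one on $2, 3$.
\<close>

lemma large_dim_quotient_weakly_real:
  assumes nm: "n = 4 * m + 2" and m: "2 \<le> m"
  shows "quotient_weakly_real (isometry_group n :: ((nat \<Rightarrow> 'k) \<Rightarrow> nat \<Rightarrow> 'k) monoid)"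
proof -
  have n10: "10 \<le> n" using nm m by simp
  have "(4::'k) = 2 * 2" by simp
  then have four: "(4::'k) \<noteq> 0" using two by (metis mult_eq_0_iff)
  define J :: "nat \<Rightarrow> nat \<Rightarrow> (nat \<Rightarrow> 'k) \<Rightarrow> nat \<Rightarrow> 'k" where "J x y = rot x y 0 1" for x y
  have JJ: "J x y \<circ> J x' y' \<in> derived_isometries n"
    if "x < n" "y < n" "x \<noteq> y" "x' < n" "y' < n" "x' \<noteq> y'" for x y x' y'
    unfolding J_def using that by (intro rot_pair_derived) auto
  have cplx_n: "cplx (Suc (2 * m)) v i = (if i < n then if even i then - v (Suc i) else v (i - 1) else v i)"
    for v :: "nat \<Rightarrow> 'k" and i
    using nm by (simp add: cplx_def)
  have "signed_perm v i = (cplx (Suc (2 * m)) \<circ> J 7 6 \<circ> (J 5 6 \<circ> J 6 7)) v i" for v i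
  proof -
    consider "n \<le> i" | "i = 4" | "i = 5" | "i = 6" | "i = 7" | "i < 4" | "8 \<le> i" "i < n" "even i" | "8 \<le> i" "i < n" "odd i"
      by linarith
    then show ?thesis
    proof cases
      case 6
      then show ?thesis using n10 by (auto simp: cplx_n signed_perm_def J_def rot_def)
    next
      case 8
      then have "8 \<le> i - 1" by presburger
      then show ?thesis using 8 by (auto simp: cplx_n signed_perm_def J_def rot_def)
    qed (use n10 in \<open>auto simp: cplx_n signed_perm_def J_def rot_def\<close>)
  qed
  then have "signed_perm = cplx (Suc (2 * m)) \<circ> J 7 6 \<circ> (J 5 6 \<circ> J 6 7)" by (intro ext)
  \<comment> \<open>an odd number of quarter turns in \<open>cplx (2 * m + 1)\<close>, so the last one is paired with \<open>J 7 6\<close>\<close>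
  also have "\<dots> = cplx (2 * m) \<circ> (J (4 * m) (4 * m + 1) \<circ> J 7 6) \<circ> (J 5 6 \<circ> J 6 7)"
    by (simp add: cplx_Suc comp_assoc J_def)
  finally have signed_perm: "signed_perm = cplx (2 * m) \<circ> (J (4 * m) (4 * m + 1) \<circ> J 7 6) \<circ> (J 5 6 \<circ> J 6 7)" .
  have signed_permD: "signed_perm \<in> derived_isometries n"
    unfolding signed_perm using nm n10 by (intro derived_comp cplx_even_derived JJ) auto
  note signed_perm_iso = derived_isometry[OF signed_permD]
  have low: "signed_perm w 0 = - w 1" "signed_perm w 1 = w 0" "signed_perm w 2 = - w 3" "signed_perm w 3 = w 2" for w
    using n10 by (simp_all add: signed_perm_def)
  have high: "signed_perm w i = 0" if "\<And>j. 4 \<le> j \<Longrightarrow> w j = 0" "4 \<le> i" for w i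
  proof -
    have "4 \<le> i - 1 \<or> i = 4" using that(2) by linarith
    then show ?thesis using that by (auto simp: signed_perm_def)
  qed
  have small: "i = 0 \<or> i = 1 \<or> i = 2 \<or> i = 3 \<or> 4 \<le> i" for i :: nat by presburger
  have ef_high: "e j = 0" "f j = 0" if "4 \<le> j" for j using that by (simp_all add: e_def f_def)
  have signed_perm_ef_at: "signed_perm e i = f i" "signed_perm f i = (- e) i" for i
    using small[of i] low high[of e i] high[of f i] ef_high by (auto simp: e_def f_def)
  have signed_perm_ef: "signed_perm e = f" "signed_perm f = - e"
    by (rule ext, rule signed_perm_ef_at(1)) (rule ext, rule signed_perm_ef_at(2))
  have signed_perm_N: "signed_perm (N v) = N (signed_perm v)" for v
  proof -
    have "dot n (signed_perm v) e = - dot n (signed_perm v) (signed_perm f)" "dot n (signed_perm v) f = dot n (signed_perm v) (signed_perm e)"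
      by (simp_all add: signed_perm_ef dot_linear)
    then have "dot n (signed_perm v) e = - dot n v f" "dot n (signed_perm v) f = dot n v e"
      by (simp_all add: isometry_dot[OF signed_perm_iso])
    then show ?thesis by (simp add: N_def isometry_linear[OF signed_perm_iso] signed_perm_ef fun_eq_iff)
  qed
  have signed_perm2_N: "signed_perm (signed_perm (N v)) = - N v" for v
    by (simp add: N_def isometry_linear[OF signed_perm_iso] signed_perm_ef fun_eq_iff)
  have signed_perm_poly: "signed_perm (signed_perm (signed_perm (signed_perm (signed_perm (signed_perm v))))) + signed_perm (signed_perm (signed_perm (signed_perm v))) + signed_perm (signed_perm v) + v = 0"
    if v: "v \<in> vecs n" for v
  proof -
    have s2: "signed_perm (signed_perm v) i = (if i = 4 then - v 6 else if i = 5 then - v 7 else if i = 6 then v 4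
        else if i = 7 then v 5 else - v i)" if "v \<in> vecs n" for v i
    proof -
      consider "n \<le> i" | "i = 4" | "i = 5" | "i = 6" | "i = 7" | "i < 4" | "8 \<le> i" "i < n" "even i" | "8 \<le> i" "i < n" "odd i"
        by linarith
      then show ?thesis
      proof cases
        case 1
        then show ?thesis using that n10 by (simp add: signed_perm_def vecs_def)
      next
        case 6
        then have "i = 0 \<or> i = 1 \<or> i = 2 \<or> i = 3" by presburger
        then show ?thesis using n10 by (auto simp: signed_perm_def)
      next
        case 7
        then have "Suc i < n" using nm by presburger
        then show ?thesis using 7 by (simp add: signed_perm_def)
      next
        case 8
        then have "8 \<le> i - 1" "i - 1 < n" "even (i - 1)" "Suc (i - 1) = i" by presburger+
        then show ?thesis using 8 by (simp add: signed_perm_def)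
      qed (use n10 in \<open>auto simp: signed_perm_def\<close>)
    qed
    have in_vecs: "signed_perm (signed_perm w) \<in> vecs n" if "w \<in> vecs n" for w
      by (intro isometry_vecs[OF signed_perm_iso] that)
    show ?thesis
      using v in_vecs[OF v] in_vecs[OF in_vecs[OF v]] by (auto simp: fun_eq_iff s2)
  qed
  define g where "g = tau 1 \<circ> signed_perm"
  have gD: "g \<in> derived_isometries n" unfolding g_def by (intro derived_comp tau_derived signed_permD)
  note gi = derived_isometry[OF gD]
  have g_app: "g v = signed_perm v + N (signed_perm v)" for v by (simp add: g_def tau_def fun_eq_iff)
  define h where "h = rot 2 3 (b\<^sup>2 - a\<^sup>2) (- 2 * a * b) \<circ> rot 8 9 (b\<^sup>2 - a\<^sup>2) (- 2 * a * b)
    \<circ> (rot 0 2 0 1 \<circ> rot 1 3 0 1) \<circ> (rot 4 5 0 1 \<circ> rot 7 6 0 1)"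
  have hD: "h \<in> derived_isometries n"
    unfolding h_def using n10 by (intro derived_comp rot_pair_derived rot_coeff) auto
  note hi = derived_isometry[OF hD]
  have "h e = flip e" "h f = flip f"
    by (auto simp: h_def flip_def rot_def e_def f_def fun_eq_iff)
  then have hN: "N (h v) = - h (N v)" for v
    using ab by (intro N_conj[OF hi]) (auto simp: flip_ef power2_eq_square)
  have h_signed_perm: "signed_perm (h (signed_perm v)) i = neg n (h v) i" for v i
  proof -
    have h_tail: "h w j = w j" if "10 \<le> j" for w j using that by (simp add: h_def rot_def)
    consider "n \<le> i" | "i < 10" | "10 \<le> i" "i < n" "even i" | "10 \<le> i" "i < n" "odd i" by linarith
    then show ?thesis
    proof cases
      case 1
      then show ?thesis using n10 by (simp add: signed_perm_def neg_def h_tail)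
    next
      case 2
      then have "i = 0 \<or> i = 1 \<or> i = 2 \<or> i = 3 \<or> i = 4 \<or> i = 5 \<or> i = 6 \<or> i = 7 \<or> i = 8 \<or> i = 9" by presburger
      then show ?thesis using n10
        by (elim disjE) (simp_all add: signed_perm_def neg_def h_def rot_def algebra_simps flip: numeral_3_eq_3)
    next
      case 3
      then have "Suc i < n" using nm by presburger
      then show ?thesis using 3 by (simp add: signed_perm_def neg_def h_tail)
    next
      case 4
      then have "10 \<le> i - 1" "i - 1 < n" "even (i - 1)" "Suc (i - 1) = i" by presburger+
      then show ?thesis using 4 by (simp add: signed_perm_def neg_def h_tail)
    qed
  qed
  then have h_signed_perm: "signed_perm (h (signed_perm v)) = neg n (h v)" for v by (intro ext)
  have ghg: "g (h (g v)) = neg n (h v)" for v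
  proof -
    have "h (g v) = h (signed_perm v) - N (h (signed_perm v))"
      by (simp add: g_app isometry_linear[OF hi] hN fun_eq_iff)
    then have "g (h (g v)) = signed_perm (h (signed_perm v)) - signed_perm (N (h (signed_perm v))) + N (signed_perm (h (signed_perm v)) - signed_perm (N (h (signed_perm v))))"
      by (simp only: g_app isometry_linear[OF signed_perm_iso])
    also have "\<dots> = signed_perm (h (signed_perm v))"
      by (simp add: signed_perm_N N_linear fun_eq_iff)
    finally show ?thesis by (simp only: h_signed_perm)
  qed
  show ?thesis
  proof (rule quotient_weakly_realI[OF _ n_even two gD hD _ ghg])
    show "3 \<le> n" "neg n \<in> {id, neg n}" using n10 by simp_all
    fix s \<epsilon> \<eta> assume sD: "s \<in> derived_isometries n" and \<epsilon>: "\<epsilon> \<in> {id, neg n}" and \<eta>: "\<eta> \<in> {id, neg n}"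
      and ss: "\<And>v. s (s v) = \<epsilon> v" and sg: "\<And>v. g (s (g v)) = \<eta> (s v)"
    note si = derived_isometry[OF sD]
    define G where "G v = g (g v)" for v
    have G_vecs: "G v \<in> vecs n" if "v \<in> vecs n" for v
      unfolding G_def by (intro isometry_vecs[OF gi] that)
    have G_app: "G v = signed_perm (signed_perm v) - smul 2 (N v)" for v
      by (simp add: G_def g_app isometry_linear[OF signed_perm_iso] N_linear signed_perm_N signed_perm2_N flip: signed_perm_N)
        (simp add: fun_eq_iff signed_perm_N signed_perm2_N flip: signed_perm_N)
    have G_linear: "G (u + v) = G u + G v" "G (u - v) = G u - G v" "G (smul c v) = smul c (G v)" "G (- v) = - G v" for u v c
      by (simp_all add: G_def isometry_linear[OF gi])
    \<comment> \<open>the sign \<open>\<eta>\<close> cancels in the square of \<open>g\<close>\<close>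
    have GsG: "G (s (G v)) = s v" for v
    proof -
      have "g (\<eta> w) = \<eta> (g w)" for w using \<eta> isometry_neg_commute[OF gi] by auto
      moreover have "\<eta> (\<eta> w) = w" for w using \<eta> neg_neg by auto
      ultimately show ?thesis unfolding G_def sg by (simp add: sg)
    qed
    define U where "U v = G (G (G v)) + G (G v) + G v + v" for v
    have G_N: "G (N v) = - N v" for v by (simp add: G_app signed_perm2_N fun_eq_iff)
    have N_signed_perm2: "N (signed_perm (signed_perm v)) = - N v" for v using signed_perm2_N[of v] by (simp add: signed_perm_N)
    have U: "U v = smul (- 4) (N v)" if v: "v \<in> vecs n" for v
    proof -
      have G2: "G (G v) = signed_perm (signed_perm (signed_perm (signed_perm v))) + smul 4 (N v)"
        by (subst G_app) (simp add: G_app isometry_linear[OF signed_perm_iso] signed_perm2_N N_linear N_signed_perm2 fun_eq_iff)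
      have "G (G (G v)) = signed_perm (signed_perm (signed_perm (signed_perm (signed_perm (signed_perm v))))) - smul 6 (N v)"
        unfolding G2 by (subst G_app) (simp add: isometry_linear[OF signed_perm_iso] signed_perm2_N N_linear N_signed_perm2 fun_eq_iff)
      then have "U v = (signed_perm (signed_perm (signed_perm (signed_perm (signed_perm (signed_perm v))))) + signed_perm (signed_perm (signed_perm (signed_perm v)))
          + signed_perm (signed_perm v) + v) + smul (- 4) (N v)"
        unfolding U_def G2 by (simp add: G_app fun_eq_iff)
      then show ?thesis unfolding signed_perm_poly[OF v] by simp
    qed
    have sN: "s (N v) = - N (s v)" if v: "v \<in> vecs n" for v
    proof -
      have "G (G (G (s (U v)))) = U (s v)"
        by (simp add: U_def isometry_linear[OF si] G_linear GsG)
      then have "smul (- 4) (G (G (G (s (N v))))) = smul (- 4) (N (s v))"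
        unfolding U[OF v] U[OF isometry_vecs[OF si v]] by (simp only: isometry_linear[OF si] G_linear)
      then have GsN: "G (G (G (s (N v)))) = N (s v)" using four by (simp add: fun_eq_iff)
      have "G (G (G (s (N v) + N (s v)))) = 0" by (simp add: G_linear GsN G_N)
      moreover have "G 0 = 0" by (simp add: G_def isometry_zero[OF gi])
      moreover have "G u = G w \<longleftrightarrow> u = w" for u w by (simp add: G_def isometry_inj[OF gi])
      ultimately have "s (N v) + N (s v) = 0" by metis
      then show ?thesis by (simp add: eq_neg_iff_add_eq_0)
    qed
    obtain \<alpha> \<beta> \<gamma> \<delta> where se: "s e = smul \<alpha> e + smul \<beta> f" and sf: "s f = smul \<gamma> e + smul \<delta> f"
      and det: "\<alpha> * \<delta> - \<beta> * \<gamma> = - 1" using anticommuting_action[OF si sN] by blast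
    have ge: "g e = f" and gf: "g f = - e" by (simp_all add: g_app signed_perm_ef N_linear)
    have gsf: "smul (- \<delta>) e + smul \<gamma> f = \<eta> (s e)"
      using sg[of e] by (simp add: ge sf isometry_linear[OF gi] gf) (simp add: fun_eq_iff)
    have sse: "s (s e) = smul (\<alpha> * \<alpha> + \<beta> * \<gamma>) e + smul (\<beta> * (\<alpha> + \<delta>)) f"
      unfolding se by (simp add: isometry_linear[OF si] se sf fun_eq_iff algebra_simps)
    have \<epsilon>e: "\<epsilon> e = smul c e + smul 0 f" if "c = (if \<epsilon> = id then 1 else - 1)" for c
      using \<epsilon> neg_vecs[OF ef_vecs(1)] that by (auto simp: fun_eq_iff)
    have "\<eta> \<noteq> neg n"
    proof
      assume "\<eta> = neg n"
      then have "smul (- \<delta>) e + smul \<gamma> f = smul (- \<alpha>) e + smul (- \<beta>) f"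
        using gsf neg_vecs[OF isometry_vecs[OF si ef_vecs(1)]] by (simp add: se fun_eq_iff)
      then have \<delta>\<gamma>: "\<delta> = \<alpha>" "\<gamma> = - \<beta>" unfolding ef_lincomb_eq by auto
      obtain c where "smul (\<alpha> * \<alpha> + \<beta> * \<gamma>) e + smul (\<beta> * (\<alpha> + \<delta>)) f = smul c e + smul 0 f"
        using ss[of e] \<epsilon>e unfolding sse by metis
      then have "\<beta> * (\<alpha> + \<delta>) = 0" unfolding ef_lincomb_eq by simp
      then have "2 * (\<alpha> * \<beta>) = 0" by (simp add: \<delta>\<gamma> algebra_simps)
      then have "\<alpha> = 0 \<or> \<beta> = 0" using two by simp
      then show False using det nonsquare[of \<alpha>] nonsquare[of \<beta>] by (auto simp: \<delta>\<gamma>)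
    qed
    then have \<eta>: "\<eta> = id" using \<eta> by simp
    then have "smul (- \<delta>) e + smul \<gamma> f = smul \<alpha> e + smul \<beta> f" using gsf by (simp add: se)
    then have \<delta>\<gamma>: "\<delta> = - \<alpha>" "\<gamma> = \<beta>" unfolding ef_lincomb_eq by auto
    have "\<epsilon> = id"
    proof (rule ccontr)
      assume "\<epsilon> \<noteq> id"
      then have "smul (\<alpha> * \<alpha> + \<beta> * \<gamma>) e + smul (\<beta> * (\<alpha> + \<delta>)) f = smul (- 1) e + smul 0 f"
        using ss[of e] \<epsilon>e[of "- 1"] unfolding sse by simp
      then have "\<alpha> * \<alpha> + \<beta> * \<gamma> = - 1" unfolding ef_lincomb_eq by simp
      moreover have "\<alpha> * \<alpha> + \<beta> * \<gamma> = 1" using det unfolding \<delta>\<gamma> by (simp add: eq_neg_iff_add_eq_0 algebra_simps)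
      ultimately show False using one_neq_minus_one by simp
    qed
    then have ss: "s (s v) = v" for v using ss by simp
    have sg: "g (s (g v)) = s v" for v using sg \<eta> by simp
    define g' where "g' = inv_into UNIV g"
    have g'i: "isometry n g'" unfolding g'_def by (rule isometry_inv[OF gi])
    have gg': "g (g' v) = v" and g'g: "g' (g v) = v" for v
      using isometry_bij[OF gi] by (simp_all add: g'_def bij_is_surj surj_f_inv_f bij_is_inj)
    \<comment> \<open>\<open>K = g - g\<inverse>\<close> anticommutes with \<open>s\<close> and so exchanges its eigenspaces\<close>
    define K where "K v = g v - g' v" for v
    have sgv: "s (g v) = g' (s v)" for v using g'g[of "s (g v)"] by (simp add: sg)
    have sg'v: "s (g' v) = g (s v)" for v using sg[of "g' v"] by (simp add: gg')
    have sK: "s (K v) = - K (s v)" for v by (simp add: K_def isometry_linear[OF si] sgv sg'v)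
    have K_vecs: "K v \<in> vecs n" if "v \<in> vecs n" for v
      using isometry_vecs[OF gi that] isometry_vecs[OF g'i that] by (simp add: K_def vecs_def)
    have K_diff: "K (u - v) = K u - K v" for u v
      by (simp add: K_def isometry_linear[OF gi] isometry_linear[OF g'i])
    have K_zero: "v = 0" if v: "v \<in> vecs n" and 0: "K v = 0" for v
    proof -
      have "g v = g' v" using 0 by (simp add: K_def)
      then have "G v = v" by (simp add: G_def gg')
      then have "U v = v + v + v + v" by (simp only: U_def)
      also have "\<dots> = smul 4 v" by (simp add: fun_eq_iff)
      finally have "smul 4 v = smul (- 4) (N v)" using U[OF v] by simp
      then have "4 * v i = 4 * (- N v i)" for i by (metis smul_apply mult_minus_left mult_minus_right)
      then have "v i = - N v i" for i using four by (metis mult_left_cancel)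
      then have vN: "v = - N v" by (intro ext) simp
      have "N v = 0" by (subst vN) (simp add: N_linear)
      then show "v = 0" using vN by simp
    qed
    have K_inj: "inj_on K (vecs n)"
    proof (rule inj_onI)
      fix u v :: "nat \<Rightarrow> 'k" assume uv: "u \<in> vecs n" "v \<in> vecs n" "K u = K v"
      then have "u - v \<in> vecs n" "K (u - v) = 0" by (simp_all add: vecs_def K_diff)
      then show "u = v" using K_zero by fastforce
    qed
    have sub: "fixed n s \<subseteq> vecs n" "negated n s \<subseteq> vecs n" by (auto simp: fixed_def negated_def)
    have fin: "finite (fixed n s)" "finite (negated n s)" using sub finite_vecs finite_subset by blast+
    have "K ` fixed n s \<subseteq> negated n s" using K_vecs sK by (auto simp: fixed_def negated_def)
    then have "card (fixed n s) \<le> card (negated n s)"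
      using card_inj_on_le[OF inj_on_subset[OF K_inj sub(1)] _ fin(2)] by blast
    moreover have "K ` negated n s \<subseteq> fixed n s"
    proof
      fix x assume "x \<in> K ` negated n s"
      then obtain v where v: "v \<in> vecs n" "s v = - v" "x = K v" by (auto simp: negated_def)
      have "K (- v) = - K v" by (simp add: K_def isometry_linear[OF gi] isometry_linear[OF g'i])
      then show "x \<in> fixed n s" using v K_vecs sK by (simp add: fixed_def)
    qed
    then have "card (negated n s) \<le> card (fixed n s)"
      using card_inj_on_le[OF inj_on_subset[OF K_inj sub(2)] _ fin(1)] by blast
    ultimately have eq: "card (negated n s) = card (fixed n s)" by simp
    have "CARD('k) ^ n = card (vecs n \<inter> fixed n s) * card (vecs n \<inter> negated n s)"
      unfolding card_vecs[symmetric]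
      by (rule card_involution_split[OF si ss two lin_subspace_vecs isometry_vecs[OF si]])
    also have "\<dots> = (card (fixed n s))\<^sup>2"
      using sub eq by (simp add: Int_absorb1 power2_eq_square)
    also have "CARD('k) ^ n = (CARD('k) ^ (2 * m + 1))\<^sup>2"
    proof -
      have "n = (2 * m + 1) * 2" by (simp add: nm)
      then show ?thesis by (simp only: power_mult)
    qed
    finally have "card (fixed n s) = CARD('k) ^ (2 * m + 1)" by (simp add: power2_eq_iff_nonneg)
    then show False
      using derived_involution_fixed_card[OF q n_even sD ss] power_mod_4[OF q, of "2 * m + 1"] by simp
  qed
qed

end

theorem theorem3p6:
  fixes q m :: nat and Q :: "'k::{field, finite} vec \<Rightarrow> 'k"
  assumes "primepow q" and "[q = 3] (mod 4)"
    and "CARD('k) = q"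
    and "m \<ge> 1"
    and "minus_type (4 * m + 2) Q"
  shows "\<exists>g\<in>carrier (POmega_group (4 * m + 2) Q). weakly_real_in (POmega_group (4 * m + 2) Q) g"
proof -
  let ?n = "4 * m + 2"
  have card: "CARD('k) mod 4 = 3" using assms(2,3) by (simp add: cong_def)
  then have "odd CARD('k)" by presburger
  then have two: "(2::'k) \<noteq> 0" by (rule two_nonzero_of_odd_card)
  obtain a b :: 'k where ab: "a\<^sup>2 + b\<^sup>2 = - 1"
    using binary_form_universal[of 1 1 "- 1 :: 'k"] by auto
  interpret siegel ?n a b
    using assms(4) ab card by unfold_locales auto
  obtain P P' where P: "P \<in> carrier_mat ?n ?n" "P' \<in> carrier_mat ?n ?n" "P * P' = 1\<^sub>m ?n" "P' * P = 1\<^sub>m ?n"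
    and QP: "\<And>v. v \<in> carrier_vec ?n \<Longrightarrow> Q (P *\<^sub>v v) = (\<Sum>i<?n. (v $ i)\<^sup>2)"
    using minus_type_sum_of_squares[OF card assms(5)] by blast
  obtain \<phi> where \<phi>: "\<phi> \<in> iso (isometry_group ?n :: ((nat \<Rightarrow> 'k) \<Rightarrow> nat \<Rightarrow> 'k) monoid) (orthogonal_group ?n Q)"
    using isometry_group_iso_orthogonal_group[OF P two QP] by blast
  have "quotient_weakly_real (isometry_group ?n :: ((nat \<Rightarrow> 'k) \<Rightarrow> nat \<Rightarrow> 'k) monoid)"
  proof (cases "m = 1")
    case True
    then show ?thesis by (intro six_dim_quotient_weakly_real) simp
  next
    case False
    then show ?thesis using assms(4) by (intro large_dim_quotient_weakly_real) auto
  qed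
  then have "quotient_weakly_real (orthogonal_group ?n Q)"
    by (rule iso_quotient_weakly_real[OF isometry_group_is_group orthogonal_group_is_group \<phi>])
  from group.ex_weakly_real_in_factor_group[OF orthogonal_group_is_group this] show ?thesis
    by (simp only: POmega_group_def Omega_group_def)
qed

end
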